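(* Let $\lambda>0$ and let $(\boldsymbol{i}(t),\theta(t))_{t\ge 0}$ be the stochastic approximation of the sparse inversion flow with switching rate $\lambda$, as defined in the context. Then the stochastic approximation $(\theta(t))_{t\ge0}$ has a unique stationary measure $\pi_*\in\mathrm{Prob}(X)$, and for any initial value $\theta(0)=\theta^{(0)}\in X$ and any $p\in(0,1)$ there are constants $c,c'>0$ such that $$\mathrm{W}_p\big(\pi_*,\mathbb{P}(\theta(t)\in\cdot)\big)\le c\exp(-c't)\qquad(t\ge0).$$
   Context: Let $n,m\in\mathbb{N}=\{1,2,\ldots\}$, $X=\mathbb{R}^n$, $b\in\mathbb{R}^m$, and $A\in\mathbb{R}^{m\times n}$ with $\mathrm{rank}(A)=n$. Set $\Phi_{\rm d}(\theta)=\frac12\|A\theta-b\|_2^2$ and $\Phi_{\rm r}(\theta)=\|\theta\|_1$ for $\theta\in X$. Then $\nabla\Phi_{\rm d}(\theta)=A^TA\theta-A^Tb$. The subdifferential of $\Phi_{\rm r}$ is $\partial\Phi_{\rm r}(\theta)=S(\theta_1)\times\cdots\times S(\theta_n)$, where $S(s)=\{1\}$ if $s>0$, $S(s)=\{-1\}$ if $s<0$ and $S(0)=[-1,1]$. Let $(\boldsymbol{i}(t))_{t\ge0}$ be a right-continuous continuous-time Markov process on $\{0,1\}$ with transition rate matrix $\begin{pmatrix}-\lambda&\lambda\\ \lambda&-\lambda\end{pmatrix}$ (with arbitrary initial state), i.e. it switches between the two states after independent exponential waiting times of mean $1/\lambda$. The stochastic approximation $(\boldsymbol{i}(t),\theta(t))_{t\ge0}$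 is the (almost surely well-defined) process whose $X$-component has continuous paths, obtained by concatenating the unique solutions, on the intervals between consecutive jumps of $\boldsymbol{i}$, of $$\frac{\mathrm{d}\theta(t)}{\mathrm{d}t}\in\begin{cases}\{-\nabla\Phi_{\rm d}(\theta(t))\},&\boldsymbol{i}(t)=0,\\-\partial\Phi_{\rm r}(\theta(t)),&\boldsymbol{i}(t)=1,\end{cases}\qquad\theta(0)=\theta^{(0)}\in X.$$ $\mathrm{Prob}(X)$ is the set of Borel probability measures on $X$. A stationary measure of $(\theta(t))_{t\ge0}$ means the $X$-marginal of an invariant probability measure of the Markov process $(\boldsymbol{i}(t),\theta(t))_{t\ge0}$ on $\{0,1\}\times X$. For $\pi,\pi'\in\mathrm{Prob}(X)$ and $p\in(0,1)$, $$\mathrm{W}_p(\pi,\pi'):=\inf_{\Gamma\in\mathrm{Coup}(\pi,\pi')}\int_{X\times X}\min\{1,\|\zeta-\zeta'\|_2^p\}\,\Gamma(\mathrm{d}\zeta,\mathrm{d}\zeta'),$$ where $\mathrm{Coup}(\pi,\pi')$ is the set of couplings of $\pi$ and $\pi'$. *)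

theory Defs
  imports "HOL-Probability.Probability"
begin

definition \<Phi>d :: "real^'n^'m \<Rightarrow> real^'m \<Rightarrow> real^'n \<Rightarrow> real" where
  "\<Phi>d A b \<theta> = 1/2 * (norm (A *v \<theta> - b))\<^sup>2"

definition \<Phi>r :: "real^'n \<Rightarrow> real" where
  "\<Phi>r \<theta> = (\<Sum>k\<in>UNIV. \<bar>\<theta> $ k\<bar>)"

definition subdifferential :: "('a::real_inner \<Rightarrow> real) \<Rightarrow> 'a \<Rightarrow> 'a set" where
  "subdifferential f x = {g. \<forall>y. f x + g \<bullet> (y - x) \<le> f y}"

lemma GDERIV_\<Phi>d:
  "GDERIV (\<Phi>d A b) \<theta> :> (transpose A *v (A *v \<theta>) - transpose A *v b)"
proof -
  have lin: "((\<lambda>x. A *v x) has_derivative (\<lambda>h. A *v h)) (at \<theta>)"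
    by (intro linear_imp_has_derivative matrix_vector_mul_linear)
  have d: "((\<lambda>x. 1/2 * ((A *v x - b) \<bullet> (A *v x - b))) has_derivative
        (\<lambda>h. 1/2 * ((A *v \<theta> - b) \<bullet> (A *v h) + (A *v h) \<bullet> (A *v \<theta> - b)))) (at \<theta>)"
    by (auto intro!: derivative_eq_intros lin)
  have "1/2 * ((A *v \<theta> - b) \<bullet> (A *v h) + (A *v h) \<bullet> (A *v \<theta> - b))
      = h \<bullet> (transpose A *v (A *v \<theta>) - transpose A *v b)" for h
  proof -
    have "1/2 * ((A *v \<theta> - b) \<bullet> (A *v h) + (A *v h) \<bullet> (A *v \<theta> - b)) = (A *v h) \<bullet> (A *v \<theta> - b)"
      by (simp add: inner_commute)
    also have "\<dots> = h \<bullet> (transpose A *v (A *v \<theta> - b))"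
      by (metis dot_lmul_matrix inner_commute transpose_matrix_vector)
    finally show ?thesis
      by (simp add: matrix_vector_mult_diff_distrib)
  qed
  with d show ?thesis
    by (simp add: gderiv_def \<Phi>d_def[abs_def] power2_norm_eq_inner)
qed

lemma subdifferential_\<Phi>r:
  fixes \<theta> :: "real^'n"
  shows "subdifferential \<Phi>r \<theta> =
    {g. \<forall>k. g $ k \<in> (if \<theta> $ k > 0 then {1} else if \<theta> $ k < 0 then {-1} else {-1..1})}"
proof (intro set_eqI iffI)
  fix g :: "real^'n"
  assume "g \<in> subdifferential \<Phi>r \<theta>"
  then have sub: "\<Phi>r \<theta> + g \<bullet> (y - \<theta>) \<le> \<Phi>r y" for y
    by (auto simp: subdifferential_def)
  have one: "\<bar>\<theta> $ k\<bar> + g $ k * s \<le> \<bar>\<theta> $ k + s\<bar>" for k s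
  proof -
    have "\<Phi>r (\<theta> + axis k s) = \<bar>\<theta> $ k + s\<bar> + (\<Sum>j\<in>UNIV - {k}. \<bar>\<theta> $ j\<bar>)"
      unfolding \<Phi>r_def by (subst sum.remove[of _ k]) (auto simp: axis_def)
    moreover have "\<Phi>r \<theta> = \<bar>\<theta> $ k\<bar> + (\<Sum>j\<in>UNIV - {k}. \<bar>\<theta> $ j\<bar>)"
      unfolding \<Phi>r_def by (subst sum.remove[of _ k]) auto
    moreover have "g \<bullet> axis k s = g $ k * s"
      by (simp add: inner_axis)
    ultimately show ?thesis
      using sub[of "\<theta> + axis k s"] by simp
  qed
  have "g $ k \<in> (if \<theta> $ k > 0 then {1} else if \<theta> $ k < 0 then {-1} else {-1..1})" for k
  proof -
    consider "\<theta> $ k > 0" | "\<theta> $ k < 0" | "\<theta> $ k = 0" by linarith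
    then show ?thesis
    proof cases
      case 1
      have "\<theta> $ k + g $ k * \<theta> $ k \<le> 2 * \<theta> $ k" "\<theta> $ k - g $ k * \<theta> $ k \<le> 0"
        using one[of k "\<theta> $ k"] one[of k "- (\<theta> $ k)"] 1 by auto
      then have "g $ k * \<theta> $ k = 1 * \<theta> $ k" by linarith
      then show ?thesis using 1 by simp
    next
      case 2
      have "- \<theta> $ k + g $ k * \<theta> $ k \<le> - 2 * \<theta> $ k" "- \<theta> $ k - g $ k * \<theta> $ k \<le> 0"
        using one[of k "\<theta> $ k"] one[of k "- (\<theta> $ k)"] 2 by auto
      then have "g $ k * \<theta> $ k = (-1) * \<theta> $ k" by linarith
      then have "g $ k = -1" using 2 mult_right_cancel[of "\<theta> $ k" "g $ k" "-1"] by linarith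
      then show ?thesis using 2 by simp
    next
      case 3
      then show ?thesis using one[of k 1] one[of k "-1"] by auto
    qed
  qed
  then show "g \<in> {g. \<forall>k. g $ k \<in> (if \<theta> $ k > 0 then {1} else if \<theta> $ k < 0 then {-1} else {-1..1})}"
    by simp
next
  fix g :: "real^'n"
  assume "g \<in> {g. \<forall>k. g $ k \<in> (if \<theta> $ k > 0 then {1} else if \<theta> $ k < 0 then {-1} else {-1..1})}"
  then have g: "g $ k \<in> (if \<theta> $ k > 0 then {1} else if \<theta> $ k < 0 then {-1} else {-1..1})" for k
    by blast
  have one: "\<bar>\<theta> $ k\<bar> + g $ k * (y $ k - \<theta> $ k) \<le> \<bar>y $ k\<bar>" for y :: "real^'n" and k
  proof -
    have "\<bar>g $ k\<bar> \<le> 1" "g $ k * \<theta> $ k = \<bar>\<theta> $ k\<bar>"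
      using g[of k] by (auto split: if_splits)
    moreover from this have "g $ k * y $ k \<le> \<bar>y $ k\<bar>"
      by (metis abs_ge_self abs_ge_zero abs_mult mult_left_le_one_le order_trans)
    ultimately show ?thesis by (simp add: algebra_simps)
  qed
  have "\<Phi>r \<theta> + g \<bullet> (y - \<theta>) \<le> \<Phi>r y" for y
    unfolding \<Phi>r_def inner_vec_def using one[of _ y]
    by (simp add: sum.distrib[symmetric] sum_mono)
  then show "g \<in> subdifferential \<Phi>r \<theta>"
    by (simp add: subdifferential_def)
qed

text \<open>The state space \<open>{0,1}\<close> is \<^typ>\<open>bool\<close>, with \<^const>\<open>False\<close> for \<open>0\<close> and \<^const>\<open>True\<close> for \<open>1\<close>.\<close>

definition drift :: "real^'n^'m \<Rightarrow> real^'m \<Rightarrow> bool \<Rightarrow> real^'n \<Rightarrow> (real^'n) set" where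
  "drift A b j \<theta> =
    (if j then uminus ` subdifferential \<Phi>r \<theta> else {- D |D. GDERIV (\<Phi>d A b) \<theta> :> D})"

lemma drift_False: "drift A b False \<theta> = {- (transpose A *v (A *v \<theta>) - transpose A *v b)}"
proof -
  have "D = D'" if "GDERIV (\<Phi>d A b) \<theta> :> D" "GDERIV (\<Phi>d A b) \<theta> :> D'" for D D'
  proof -
    have "(\<lambda>h. inner h D) = (\<lambda>h. inner h D')"
      using that unfolding gderiv_def by (rule has_derivative_unique)
    then show "D = D'"
      by (metis inner_commute vector_eq_rdot)
  qed
  then have "GDERIV (\<Phi>d A b) \<theta> :> D \<longleftrightarrow> D = transpose A *v (A *v \<theta>) - transpose A *v b" for D
    using GDERIV_\<Phi>d by blast
  then show ?thesis
    by (simp add: drift_def del: transpose_matrix_vector)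
qed

text \<open>
  Solutions of differential inclusions are absolutely continuous curves that satisfy the inclusion
  almost everywhere: for the second drift they have corners, where a coordinate reaches \<open>0\<close>.
  Absolute continuity on \<open>[a,c]\<close> is expressed by writing the curve as the primitive of a
  Lebesgue integrable velocity.
\<close>

definition solves_inclusion ::
  "('a::euclidean_space \<Rightarrow> 'a set) \<Rightarrow> real \<Rightarrow> real \<Rightarrow> (real \<Rightarrow> 'a) \<Rightarrow> bool" where
  "solves_inclusion F a c \<theta> \<longleftrightarrow>
    (\<exists>v. set_integrable lborel {a..c} v \<and>
         (\<forall>t\<in>{a..c}. \<theta> t = \<theta> a + (LINT s:{a..t}|lborel. v s)) \<and>
         (AE s\<in>{a..c} in lborel. v s \<in> F (\<theta> s)))"

text \<open>
  The path that starts in \<open>j\<close> and flips at the times \<open>w 0\<close>, \<open>w 0 + w 1\<close>, \<open>w 0 + w 1 + w 2\<close>, ...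
  For exponential waiting times, only finitely many of these lie before \<open>t\<close>, almost surely.
\<close>

definition switching_path :: "bool \<Rightarrow> (nat \<Rightarrow> real) \<Rightarrow> real \<Rightarrow> bool" where
  "switching_path j w t = (j \<noteq> odd (card {k. (\<Sum>l\<le>k. w l) \<le> t}))"

text \<open>
  The Markov jump process with both transition rates equal to \<open>lam\<close>; the initial state
  may be random, with any law.
\<close>

definition index_process :: "'w measure \<Rightarrow> real \<Rightarrow> (real \<Rightarrow> 'w \<Rightarrow> bool) \<Rightarrow> bool" where
  "index_process M lam i \<longleftrightarrow>
    prob_space M \<and>
    (\<forall>t\<ge>0. i t \<in> measurable M (count_space UNIV)) \<and>
    (\<exists>W :: nat \<Rightarrow> 'w \<Rightarrow> real.
       (\<forall>k. distributed M lborel (W k) (exponential_density lam)) \<and>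
       prob_space.indep_vars M (\<lambda>_. borel) W UNIV \<and>
       prob_space.indep_set M
         (sets (vimage_algebra (space M) (i 0) (count_space UNIV)))
         (sets (vimage_algebra (space M) (\<lambda>\<omega> k. W k \<omega>) (Pi\<^sub>M UNIV (\<lambda>_. borel)))) \<and>
       (AE \<omega> in M. \<forall>t\<ge>0. i t \<omega> = switching_path (i 0 \<omega>) (\<lambda>k. W k \<omega>) t))"

definition stochastic_approximation ::
  "'w measure \<Rightarrow> real \<Rightarrow> real^'n^'m \<Rightarrow> real^'m \<Rightarrow> real^'n \<Rightarrow>
    (real \<Rightarrow> 'w \<Rightarrow> bool) \<Rightarrow> (real \<Rightarrow> 'w \<Rightarrow> real^'n) \<Rightarrow> bool" where
  "stochastic_approximation M lam A b \<theta>0 i \<theta> \<longleftrightarrow>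
    index_process M lam i \<and>
    (\<forall>t\<ge>0. \<theta> t \<in> borel_measurable M) \<and>
    (AE \<omega> in M. \<theta> 0 \<omega> = \<theta>0 \<and>
       continuous_on {0..} (\<lambda>t. \<theta> t \<omega>) \<and>
       (\<forall>a c j. 0 \<le> a \<and> a < c \<and> (\<forall>s\<in>{a..<c}. i s \<omega> = j) \<longrightarrow>
          solves_inclusion (drift A b j) a c (\<lambda>t. \<theta> t \<omega>)))"

text \<open>
  The transition kernel of \<open>(i, \<theta>)\<close> at time \<open>t\<close>: the law of the pair at time \<open>t\<close> when it starts
  in \<open>z\<close>. This law is the same for every realisation of the process; \<^typ>\<open>nat \<Rightarrow> real\<close> carries
  one, with the waiting times as coordinates.
\<close>

definition transition_kernel ::
  "real \<Rightarrow> real^'n^'m \<Rightarrow> real^'m \<Rightarrow> real \<Rightarrow> bool \<times> (real^'n) \<Rightarrow> (bool \<times> (real^'n)) measure" where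
  "transition_kernel lam A b t z =
    (THE \<kappa>. \<exists>(M :: (nat \<Rightarrow> real) measure) i \<theta>.
       stochastic_approximation M lam A b (snd z) i \<theta> \<and>
       (AE \<omega> in M. i 0 \<omega> = fst z) \<and>
       \<kappa> = distr M (count_space UNIV \<Otimes>\<^sub>M borel) (\<lambda>\<omega>. (i t \<omega>, \<theta> t \<omega>)))"

definition invariant_measure ::
  "real \<Rightarrow> real^'n^'m \<Rightarrow> real^'m \<Rightarrow> (bool \<times> (real^'n)) measure \<Rightarrow> bool" where
  "invariant_measure lam A b \<mu> \<longleftrightarrow>
    prob_space \<mu> \<and> sets \<mu> = sets (count_space UNIV \<Otimes>\<^sub>M borel) \<and>
    (\<forall>t\<ge>0. \<forall>B\<in>sets \<mu>. (\<integral>\<^sup>+z. emeasure (transition_kernel lam A b t z) B \<partial>\<mu>) = emeasure \<mu> B)"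

definition stationary_measure ::
  "real \<Rightarrow> real^'n^'m \<Rightarrow> real^'m \<Rightarrow> (real^'n) measure \<Rightarrow> bool" where
  "stationary_measure lam A b \<pi> \<longleftrightarrow>
    (\<exists>\<mu>. invariant_measure lam A b \<mu> \<and> \<pi> = distr \<mu> borel snd)"

definition couplings ::
  "'a::euclidean_space measure \<Rightarrow> 'a measure \<Rightarrow> ('a \<times> 'a) measure set" where
  "couplings \<pi> \<pi>' =
    {\<Gamma>. prob_space \<Gamma> \<and> sets \<Gamma> = sets (borel \<Otimes>\<^sub>M borel) \<and>
        distr \<Gamma> borel fst = \<pi> \<and> distr \<Gamma> borel snd = \<pi>'}"

definition wasserstein :: "real \<Rightarrow> 'a::euclidean_space measure \<Rightarrow> 'a measure \<Rightarrow> real" where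
  "wasserstein p \<pi> \<pi>' =
    (INF \<Gamma>\<in>couplings \<pi> \<pi>'. \<integral>z. min 1 (norm (fst z - snd z) powr p) \<partial>\<Gamma>)"

end

theory Submission
  imports Defs
begin

text \<open>
  Both flows are nonexpansive, and the data flow contracts at an exponential rate because \<open>A\<close> is
  injective; moreover all large balls are forward invariant. Hence two trajectories driven by the same
  switching times approach each other at a rate that is exponential in the mean. Composing the flows
  backwards over independent exponential times converges for the same reason, and the limit has the
  law of the stationary process just before a jump. By the memoryless property this is also its
  law at a fixed time. For the convergence up to time \<open>t\<close>, the index process is nearly uniform at
  time \<open>t / 2\<close>, so the two processes can be coupled at that time to have equal indices up to an
  exponentially small probability, and from then on they are driven by the same switching times.
\<close>

section \<open>Exponential waiting times\<close>

text \<open>The regulariser flow contracts nothing, so no deterministic rate holds along the paths;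
  the exponential rate is available in expectation only, and with a weight that depends on the
  index. Expectations over the waiting times are handled by first-step analysis: such an expectation
  is the least solution of a renewal equation, so an explicit supersolution is enough for an upper
  bound. Contraction in the mean, mixing of the index and one half of the Chapman-Kolmogorov
  identity are all obtained in this way, without conditioning on the history of the process. This
  works because the process is a deterministic function of the initial state and of one i.i.d.
  sequence. Solutions of the inclusions are only absolutely continuous, so monotonicity of the
  drifts, and not a Lipschitz bound, is what forces every realisation to agree with that function.
  Uniqueness concerns the marginal on X, hence only functions of \<open>\<theta>\<close> have to be
  tested, and convergence of these from every deterministic start decides it.\<close>

definition expm :: "real \<Rightarrow> real measure" where
  "expm lam = density lborel (exponential_density lam)"

definition waits :: "real \<Rightarrow> (nat \<Rightarrow> real) measure" where
  "waits lam = (\<Pi>\<^sub>M k\<in>UNIV. expm lam)"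

definition rest :: "(nat \<Rightarrow> 'a) \<Rightarrow> nat \<Rightarrow> 'a" where
  "rest w k = w (Suc k)"

lemma rest_case_nat [simp]: "rest (case_nat r w) = w"
  by (simp add: rest_def fun_eq_iff)

lemma sets_expm [simp, measurable_cong]: "sets (expm lam) = sets borel"
  by (simp add: expm_def)

lemma space_expm [simp]: "space (expm lam) = UNIV"
  by (simp add: expm_def)

lemma sets_waits [measurable_cong]: "sets (waits lam) = sets (\<Pi>\<^sub>M k\<in>UNIV. borel)"
  unfolding waits_def by (intro sets_PiM_cong) auto

lemma space_waits [simp]: "space (waits lam) = UNIV"
  by (simp add: waits_def space_PiM)

lemma rest_measurable [measurable]:
  "rest \<in> (\<Pi>\<^sub>M k\<in>UNIV. borel :: 'a::topological_space measure) \<rightarrow>\<^sub>M (\<Pi>\<^sub>M k\<in>UNIV. borel)"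
proof (rule measurable_PiM_single')
  show "(\<lambda>w. rest w k) \<in> (\<Pi>\<^sub>M k\<in>UNIV. borel :: 'a measure) \<rightarrow>\<^sub>M borel" for k
    unfolding rest_def by measurable
qed auto

locale switching_rate =
  fixes lam :: real
  assumes lam_pos: "0 < lam"
begin

abbreviation "\<E> \<equiv> expm lam"
abbreviation "\<W> \<equiv> waits lam"

sublocale E: prob_space \<E>
  unfolding expm_def using lam_pos by (rule prob_space_exponential_density)

sublocale W: sequence_space \<E>
  by unfold_locales

lemma W_S: "W.S = \<W>"
  by (simp add: waits_def)

sublocale PW: prob_space \<W>
  unfolding waits_def by (rule W.P.prob_space_axioms)

lemma emeasure_expm_UNIV [simp]: "emeasure \<E> UNIV = 1"
  using E.emeasure_space_1 by simp

lemma emeasure_waits_UNIV [simp]: "emeasure \<W> UNIV = 1"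
  using PW.emeasure_space_1 by simp

text \<open>The product measure is unchanged when an independent entry is put in front
  (\<open>PiM_iter\<close>), so the first waiting time can be integrated separately from the
  remaining sequence. Every first-step analysis below rests on this.\<close>

lemma nn_integral_waits:
  assumes f [measurable]: "f \<in> borel_measurable \<W>"
  shows "(\<integral>\<^sup>+w. f w \<partial>\<W>) = (\<integral>\<^sup>+r. \<integral>\<^sup>+w. f (case_nat r w) \<partial>\<W> \<partial>\<E>)"
proof -
  have "(\<integral>\<^sup>+w. f w \<partial>\<W>) = (\<integral>\<^sup>+w. f w \<partial>distr (\<E> \<Otimes>\<^sub>M W.S) W.S (\<lambda>(s, \<omega>). case_nat s \<omega>))"
    using W.PiM_iter W_S by simp
  also have "\<dots> = (\<integral>\<^sup>+z. f (case z of (s, \<omega>) \<Rightarrow> case_nat s \<omega>) \<partial>(\<E> \<Otimes>\<^sub>M \<W>))"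
    unfolding W_S by (subst nn_integral_distr) (auto simp: W_S[symmetric])
  also have "\<dots> = (\<integral>\<^sup>+r. \<integral>\<^sup>+w. f (case_nat r w) \<partial>\<W> \<partial>\<E>)"
    by (subst PW.nn_integral_fst[symmetric]) (auto simp: W_S[symmetric])
  finally show ?thesis .
qed

lemma nn_integral_expm:
  assumes [measurable]: "f \<in> borel_measurable borel"
  shows "(\<integral>\<^sup>+r. f r \<partial>\<E>) = (\<integral>\<^sup>+r. ennreal (lam * exp (- lam * r)) * f r * indicator {0..} r \<partial>lborel)"
  unfolding expm_def
  by (subst nn_integral_density)
     (auto intro!: nn_integral_cong simp: exponential_density_def indicator_def mult_ac split: if_splits)

lemma AE_expm_pos: "AE r in \<E>. 0 < r"
proof -
  have "AE r in lborel. r \<noteq> (0::real)"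
    by (rule AE_lborel_singleton)
  then show ?thesis
    unfolding expm_def
    by (subst AE_density) (auto simp: exponential_density_def elim!: eventually_mono)
qed

lemma AE_waits_pos: "AE w in \<W>. \<forall>k. 0 < w k"
  unfolding AE_all_countable waits_def
  by (auto intro: AE_PiM_component AE_expm_pos E.prob_space_axioms)

lemma distr_rest: "distr \<W> \<W> rest = \<W>"
proof (rule measure_eqI)
  show "sets (distr \<W> \<W> rest) = sets \<W>" by simp
  fix B assume "B \<in> sets (distr \<W> \<W> rest)"
  then have B [measurable]: "B \<in> sets \<W>" by simp
  have [measurable]: "rest \<in> \<W> \<rightarrow>\<^sub>M \<W>" by measurable
  have "emeasure (distr \<W> \<W> rest) B = (\<integral>\<^sup>+w. indicator B w \<partial>distr \<W> \<W> rest)"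
    by simp
  also have "\<dots> = (\<integral>\<^sup>+w. indicator B (rest w) \<partial>\<W>)"
    by (rule nn_integral_distr) auto
  also have "\<dots> = (\<integral>\<^sup>+r. \<integral>\<^sup>+w. indicator B w \<partial>\<W> \<partial>\<E>)"
    by (subst nn_integral_waits) auto
  also have "\<dots> = emeasure \<W> B"
    by (simp add: E.emeasure_space_1[simplified])
  finally show "emeasure (distr \<W> \<W> rest) B = emeasure \<W> B" .
qed

lemma AE_rest:
  assumes "AE w in \<W>. P w"
  shows "AE w in \<W>. P (rest w)"
proof -
  have "AE w in distr \<W> \<W> rest. P w"
    unfolding distr_rest using assms .
  then show ?thesis
    by (rule AE_distrD[rotated]) measurable
qed

lemma emeasure_expm_gt:
  assumes "0 \<le> t"
  shows "emeasure \<E> {t<..} = ennreal (exp (- lam * t))"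
proof -
  have "distributed \<E> lborel (\<lambda>x. x) (exponential_density lam)"
    unfolding distributed_def expm_def by (auto simp: distr_id2)
  from E.exponential_distributedD_gt[OF this assms lam_pos]
  have "measure \<E> {t<..} = exp (- lam * t)"
    by (simp add: greaterThan_def mult.commute)
  then show ?thesis
    by (simp add: E.emeasure_eq_measure)
qed

text \<open>Translation by t reproduces the exponential density up to the factor
  \<open>exp (- lam * t)\<close>. In this unnormalised form no conditional law has to be
  introduced.\<close>

lemma memoryless:
  assumes [measurable]: "h \<in> borel_measurable borel" and t: "0 \<le> t"
  shows "(\<integral>\<^sup>+r. h r * indicator {t<..} r \<partial>\<E>) = ennreal (exp (- lam * t)) * (\<integral>\<^sup>+r. h (t + r) \<partial>\<E>)"
proof -
  have "(\<integral>\<^sup>+r. h r * indicator {t<..} r \<partial>\<E>)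
      = (\<integral>\<^sup>+r. ennreal (lam * exp (- lam * r)) * (h r * indicator {t<..} r) * indicator {0..} r \<partial>lborel)"
    by (rule nn_integral_expm) measurable
  also have "\<dots> = (\<integral>\<^sup>+r. ennreal (lam * exp (- lam * (t + r))) * (h (t + r) * indicator {t<..} (t + r)) * indicator {0..} (t + r) \<partial>lborel)"
    using nn_integral_real_affine[of "\<lambda>r. ennreal (lam * exp (- lam * r)) * (h r * indicator {t<..} r) * indicator {0..} r" 1 t]
    by simp
  also have "\<dots> = (\<integral>\<^sup>+r. ennreal (exp (- lam * t)) * (ennreal (lam * exp (- lam * r)) * h (t + r) * indicator {0..} r) \<partial>lborel)"
  \<comment> \<open>At r = 0 the strict indicator of \<open>{t<..}\<close> and the closed one of
    \<open>{0..}\<close> disagree; that point is a null set.\<close>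
  proof (rule nn_integral_cong_AE)
    have "AE r in lborel. r \<noteq> (0::real)"
      by (rule AE_lborel_singleton)
    then show "AE r in lborel. ennreal (lam * exp (- lam * (t + r))) * (h (t + r) * indicator {t<..} (t + r)) * indicator {0..} (t + r)
      = ennreal (exp (- lam * t)) * (ennreal (lam * exp (- lam * r)) * h (t + r) * indicator {0..} r)"
    proof eventually_elim
      case (elim r)
      have "ennreal (lam * exp (- lam * (t + r))) = ennreal (exp (- lam * t)) * ennreal (lam * exp (- lam * r))"
        using lam_pos by (simp add: ennreal_mult[symmetric] exp_add[symmetric] algebra_simps)
      then show ?case
        using elim t by (auto simp: indicator_def mult_ac)
    qed
  qed
  also have "\<dots> = ennreal (exp (- lam * t)) * (\<integral>\<^sup>+r. h (t + r) \<partial>\<E>)"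
    by (simp add: nn_integral_cmult nn_integral_expm)
  finally show ?thesis .
qed

text \<open>The Laplace transform at \<open>1\<close> of the partial sums decays geometrically, hence these diverge.\<close>

lemma AE_sum_unbounded:
  assumes K: "infinite K"
  shows "AE w in \<W>. \<forall>t. \<exists>n. t < (\<Sum>k\<in>K \<inter> {..<n}. w k)"
proof -
  define \<rho> where "\<rho> = (\<integral>\<^sup>+r. ennreal (exp (- r)) \<partial>\<E>)"
  have "\<rho> = (\<integral>\<^sup>+r. ennreal (lam * exp (- (lam + 1) * r)) * indicator {0..} r \<partial>lborel)"
    unfolding \<rho>_def using lam_pos
    by (subst nn_integral_expm)
       (auto intro!: nn_integral_cong simp: ennreal_mult[symmetric] exp_add[symmetric] algebra_simps indicator_def)
  also have "\<dots> = ennreal (0 - (- lam / (lam + 1) * exp (- (lam + 1) * 0)))"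
  proof (rule nn_integral_FTC_atLeast)
    have "((\<lambda>r. exp (- (lam + 1) * r)) \<longlongrightarrow> 0) at_top"
      using lam_pos by real_asymp
    then show "((\<lambda>r. - lam / (lam + 1) * exp (- (lam + 1) * r)) \<longlongrightarrow> 0) at_top"
      by (rule tendsto_mult_right_zero)
    fix r :: real
    show "DERIV (\<lambda>r. - lam / (lam + 1) * exp (- (lam + 1) * r)) r :> lam * exp (- (lam + 1) * r)"
      using lam_pos by (auto intro!: derivative_eq_intros simp: divide_simps) (simp add: algebra_simps)
  qed (use lam_pos in auto)
  finally have \<rho>: "\<rho> = ennreal (lam / (lam + 1))"
    by simp
  \<comment> \<open>The induction runs over all index sets at once: splitting off the first waiting
    time shifts K down by one and contributes a factor \<open>\<rho>\<close> exactly if 0 belongs to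
    K.\<close>
  have laplace: "(\<integral>\<^sup>+w. ennreal (exp (- (\<Sum>k\<in>K \<inter> {..<n}. w k))) \<partial>\<W>) = \<rho> ^ card (K \<inter> {..<n})" for K n
  proof (induction n arbitrary: K)
    case 0
    then show ?case by (simp add: PW.emeasure_space_1)
  next
    case (Suc n)
    let ?K = "{k. Suc k \<in> K}"
    let ?f = "\<lambda>w. ennreal (exp (- (\<Sum>k\<in>?K \<inter> {..<n}. w k)))"
    have split: "K \<inter> {..<Suc n} = (if 0 \<in> K then {0} else {}) \<union> Suc ` (?K \<inter> {..<n})"
      by (auto simp: lessThan_Suc_eq_insert_0)
    have "exp (- (\<Sum>k\<in>K \<inter> {..<Suc n}. (case_nat r w :: nat \<Rightarrow> real) k))
        = (if 0 \<in> K then exp (- r) else 1) * exp (- (\<Sum>k\<in>?K \<inter> {..<n}. w k))" for r w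
      unfolding split
      by (subst sum.union_disjoint) (auto simp: sum.reindex mult_exp_exp)
    then have "(\<integral>\<^sup>+w. ennreal (exp (- (\<Sum>k\<in>K \<inter> {..<Suc n}. w k))) \<partial>\<W>)
      = (\<integral>\<^sup>+r. \<integral>\<^sup>+w. ennreal (if 0 \<in> K then exp (- r) else 1) * ?f w \<partial>\<W> \<partial>\<E>)"
      by (subst nn_integral_waits) (auto simp: ennreal_mult)
    also have "\<dots> = (\<integral>\<^sup>+r. ennreal (if 0 \<in> K then exp (- r) else 1) * \<rho> ^ card (?K \<inter> {..<n}) \<partial>\<E>)"
      by (simp add: nn_integral_cmult Suc.IH)
    also have "\<dots> = (if 0 \<in> K then \<rho> else 1) * \<rho> ^ card (?K \<inter> {..<n})"
      by (simp add: nn_integral_multc \<rho>_def E.emeasure_space_1)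
    also have "\<dots> = \<rho> ^ card (K \<inter> {..<Suc n})"
      unfolding split
      by (subst card_Un_disjoint) (auto simp: card_image)
    finally show ?case .
  qed
  let ?S = "\<lambda>n w. \<Sum>k\<in>K \<inter> {..<n}. w k"
  \<comment> \<open>The infimum vanishes exactly if the partial sums are unbounded, and its integral
    lies below every Laplace transform, hence is 0.\<close>
  let ?L = "\<lambda>w. INF n. ennreal (exp (- ?S n w))"
  have card_top: "filterlim (\<lambda>n. card (K \<inter> {..<n})) at_top sequentially"
    unfolding filterlim_at_top
  proof
    fix m
    obtain F where F: "F \<subseteq> K" "finite F" "card F = m"
      using K infinite_arbitrarily_large by blast
    then obtain n0 where n0: "F \<subseteq> {..<n0}"
      using finite_nat_iff_bounded by blast
    have "m \<le> card (K \<inter> {..<n})" if "n0 \<le> n" for n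
      using F n0 that by (subst F(3)[symmetric]) (intro card_mono, auto)
    then show "eventually (\<lambda>n. m \<le> card (K \<inter> {..<n})) sequentially"
      by (auto simp: eventually_sequentially)
  qed
  have "(\<lambda>n. (lam / (lam + 1)) ^ n) \<longlonglongrightarrow> 0"
    using lam_pos by (intro LIMSEQ_power_zero) auto
  then have "(\<lambda>n. ennreal ((lam / (lam + 1)) ^ card (K \<inter> {..<n}))) \<longlonglongrightarrow> ennreal 0"
    by (intro tendsto_ennrealI) (rule filterlim_compose[OF _ card_top])
  then have lim: "(\<lambda>n. \<rho> ^ card (K \<inter> {..<n})) \<longlonglongrightarrow> 0"
    using lam_pos by (simp add: \<rho> ennreal_power)
  have "(\<integral>\<^sup>+w. ?L w \<partial>\<W>) \<le> \<rho> ^ card (K \<inter> {..<n})" for n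
    by (subst laplace[symmetric]) (intro nn_integral_mono INF_lower UNIV_I)
  then have "(\<integral>\<^sup>+w. ?L w \<partial>\<W>) = 0"
    using LIMSEQ_le_const[OF lim] by (metis le_zero_eq)
  then have "AE w in \<W>. ?L w = 0"
    by (subst (asm) nn_integral_0_iff_AE) auto
  then show ?thesis
  proof eventually_elim
    case (elim w)
    show ?case
    proof
      fix t
      have "?L w < ennreal (exp (- t))"
        unfolding elim by simp
      then obtain n where "ennreal (exp (- ?S n w)) < ennreal (exp (- t))"
        unfolding INF_less_iff by auto
      then show "\<exists>n. t < ?S n w"
        by (auto simp: ennreal_less_iff)
    qed
  qed
qed


section \<open>Renewal equations for functionals of the waiting times\<close>

definition "unbdd w \<longleftrightarrow> (\<forall>t. \<exists>n. t < (\<Sum>k<n. w k))" for w :: "nat \<Rightarrow> real"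

text \<open>Positivity of the entries is not part of \<open>unbdd\<close>, so every real r may be
  put in front. This fits the renewal equation, whose outer integral runs over all r.\<close>

lemma unbdd_case_nat: "unbdd w \<Longrightarrow> unbdd (case_nat r w)"
  unfolding unbdd_def
proof
  fix t assume "\<forall>t. \<exists>n. t < (\<Sum>k<n. w k)"
  then obtain n where "t - r < (\<Sum>k<n. w k)" by blast
  then have "t < (\<Sum>k<Suc n. case_nat r w k)"
    by (subst sum.lessThan_Suc_shift) simp
  then show "\<exists>n. t < (\<Sum>k<n. case_nat r w k)" by blast
qed

lemma AE_unbdd: "AE w in \<W>. unbdd w"
  using AE_sum_unbounded[of UNIV] by (simp add: unbdd_def)

text \<open>First-step analysis: \<open>a t s\<close> is the value if no jump occurs up to time t,
  and \<open>J s r\<close> is the state from which the functional restarts after a jump at time r.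
  The state type is left open because a pair of trajectories with a common index is needed as well
  as a single one.\<close>

lemma renewal:
  fixes u :: "real \<Rightarrow> 's \<Rightarrow> (nat \<Rightarrow> real) \<Rightarrow> ennreal"
  assumes meas: "\<And>t s. u t s \<in> borel_measurable \<W>"
    and rec: "\<And>t s w. 0 \<le> t \<Longrightarrow> unbdd w \<Longrightarrow>
      u t s w = (if t < w 0 then a t s else u (t - w 0) (J s (w 0)) (rest w))"
    and t: "0 \<le> t"
  shows "(\<integral>\<^sup>+w. u t s w \<partial>\<W>) =
    (\<integral>\<^sup>+r. (if t < r then a t s else \<integral>\<^sup>+w. u (t - r) (J s r) w \<partial>\<W>) \<partial>\<E>)"
proof -
  have "(\<integral>\<^sup>+w. u t s w \<partial>\<W>) = (\<integral>\<^sup>+r. \<integral>\<^sup>+w. u t s (case_nat r w) \<partial>\<W> \<partial>\<E>)"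
    by (rule nn_integral_waits[OF meas])
  also have "\<dots> = (\<integral>\<^sup>+r. (if t < r then a t s else \<integral>\<^sup>+w. u (t - r) (J s r) w \<partial>\<W>) \<partial>\<E>)"
  proof (rule nn_integral_cong)
    fix r
    have "(\<integral>\<^sup>+w. u t s (case_nat r w) \<partial>\<W>) =
        (\<integral>\<^sup>+w. (if t < r then a t s else u (t - r) (J s r) w) \<partial>\<W>)"
      using AE_unbdd
      by (intro nn_integral_cong_AE) (auto elim!: eventually_mono simp: rec[OF t unbdd_case_nat])
    then show "(\<integral>\<^sup>+w. u t s (case_nat r w) \<partial>\<W>) =
        (if t < r then a t s else \<integral>\<^sup>+w. u (t - r) (J s r) w \<partial>\<W>)"
      by simp
  qed
  finally show ?thesis .
qed

text \<open>Expected values are the least solutions of their renewal equation: the part of \<open>u\<close> with at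
  most \<open>n\<close> jumps lies below any supersolution.\<close>

lemma renewal_minimal:
  fixes u :: "real \<Rightarrow> 's \<Rightarrow> (nat \<Rightarrow> real) \<Rightarrow> ennreal"
  assumes meas: "\<And>t s. u t s \<in> borel_measurable \<W>"
    and rec: "\<And>t s w. 0 \<le> t \<Longrightarrow> unbdd w \<Longrightarrow>
      u t s w = (if t < w 0 then a t s else u (t - w 0) (J s (w 0)) (rest w))"
    and super: "\<And>t s. 0 \<le> t \<Longrightarrow>
      (\<integral>\<^sup>+r. (if t < r then a t s else g (t - r) (J s r)) \<partial>\<E>) \<le> g t s"
    and t: "0 \<le> t"
  shows "(\<integral>\<^sup>+w. u t s w \<partial>\<W>) \<le> g t s"
proof -
  note [measurable] = meas
  \<comment> \<open>The quantifier over all m up to n makes \<open>ind\<close> increasing in n for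
    every w, even for one with negative entries; monotone convergence asks for this
    everywhere.\<close>
  define ind where "ind n t w = (indicator {w. \<exists>m\<le>n. t < (\<Sum>k<m. w k)} w :: ennreal)" for n t and w :: "nat \<Rightarrow> real"
  have [measurable]: "ind n t \<in> borel_measurable \<W>" for n t
    unfolding ind_def by measurable
  have trunc: "(\<integral>\<^sup>+w. u t s w * ind n t w \<partial>\<W>) \<le> g t s" if "0 \<le> t" for n t s
    using that
  proof (induction n arbitrary: t s)
    case 0
    then show ?case by (simp add: ind_def)
  next
    case (Suc n)
    have ind_Suc: "ind (Suc n) t (case_nat r w) = ind n (t - r) w" if "\<not> t < r" for r w
    proof -
      \<comment> \<open>The case m = 0 would say t < 0, so the first waiting time can always be
        split off.\<close>
      have "(\<exists>m\<le>Suc n. t < (\<Sum>k<m. (case_nat r w :: nat \<Rightarrow> real) k)) \<longleftrightarrow>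
          (\<exists>m\<le>n. t < (\<Sum>k<Suc m. case_nat r w k))"
        using Suc.prems by (metis Suc_le_mono lessThan_0 not_le old.nat.exhaust sum.empty)
      also have "\<dots> \<longleftrightarrow> (\<exists>m\<le>n. t - r < (\<Sum>k<m. w k))"
        by (simp add: sum.lessThan_Suc_shift less_diff_eq algebra_simps del: sum.lessThan_Suc)
      finally show ?thesis by (simp add: ind_def indicator_def)
    qed
    have "(\<integral>\<^sup>+w. u t s w * ind (Suc n) t w \<partial>\<W>) =
        (\<integral>\<^sup>+r. \<integral>\<^sup>+w. u t s (case_nat r w) * ind (Suc n) t (case_nat r w) \<partial>\<W> \<partial>\<E>)"
      by (rule nn_integral_waits) measurable
    also have "\<dots> \<le> (\<integral>\<^sup>+r. (if t < r then a t s else g (t - r) (J s r)) \<partial>\<E>)"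
    proof (rule nn_integral_mono)
      fix r
      have "(\<integral>\<^sup>+w. u t s (case_nat r w) * ind (Suc n) t (case_nat r w) \<partial>\<W>)
        \<le> (\<integral>\<^sup>+w. (if t < r then a t s else u (t - r) (J s r) w * ind n (t - r) w) \<partial>\<W>)"
        using AE_unbdd
      proof (intro nn_integral_mono_AE, eventually_elim)
        case (elim w)
        show ?case
        proof (cases "t < r")
          case True
          have "ind (Suc n) t (case_nat r w) \<le> 1"
            by (simp add: ind_def indicator_def)
          then have "a t s * ind (Suc n) t (case_nat r w) \<le> a t s * 1"
            by (intro mult_left_mono) auto
          then show ?thesis
            using True rec[OF Suc.prems unbdd_case_nat[OF elim(2)], of s r] by simp
        next
          case False
          then show ?thesis
            using rec[OF Suc.prems unbdd_case_nat[OF elim(2)], of s r] ind_Suc[OF False, of w] by simp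
        qed
      qed
      also have "\<dots> \<le> (if t < r then a t s else g (t - r) (J s r))"
        using Suc.IH[of "t - r" "J s r"] by simp
      finally show "(\<integral>\<^sup>+w. u t s (case_nat r w) * ind (Suc n) t (case_nat r w) \<partial>\<W>)
        \<le> (if t < r then a t s else g (t - r) (J s r))" .
    qed
    also have "\<dots> \<le> g t s"
      by (rule super[OF Suc.prems])
    finally show ?case .
  qed
  have "(\<integral>\<^sup>+w. u t s w \<partial>\<W>) = (\<integral>\<^sup>+w. (SUP n. u t s w * ind n t w) \<partial>\<W>)"
    using AE_unbdd
  proof (intro nn_integral_cong_AE, eventually_elim)
    case (elim w)
    then obtain n where "t < (\<Sum>k<n. w k)" by (auto simp: unbdd_def)
    then have "u t s w * ind n t w = u t s w"
      by (subst ind_def) (auto simp: indicator_def)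
    moreover have "u t s w * ind m t w \<le> u t s w" for m
      by (auto simp: ind_def indicator_def)
    ultimately show ?case
      by (intro antisym SUP_least) (metis SUP_upper UNIV_I)
  qed
  also have "\<dots> = (SUP n. \<integral>\<^sup>+w. u t s w * ind n t w \<partial>\<W>)"
    by (rule nn_integral_monotone_convergence_SUP)
       (auto simp: incseq_def le_fun_def ind_def indicator_def intro: order_trans)
  also have "\<dots> \<le> g t s"
    using trunc[OF t] by (rule SUP_least)
  finally show ?thesis .
qed

end

section \<open>Monotone differential inclusions\<close>

text \<open>The two closed intervals share the point b, which is null; closed intervals are kept
  because \<open>solves_inclusion\<close> is stated with them.\<close>

lemma set_integral_combine:
  fixes q :: "real \<Rightarrow> 'a::euclidean_space"
  assumes q: "set_integrable lborel {a..c} q" and "a \<le> b" "b \<le> c"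
  shows "(LINT r:{a..c}|lborel. q r) = (LINT r:{a..b}|lborel. q r) + (LINT r:{b..c}|lborel. q r)"
proof -
  have sub: "set_integrable lborel B q" if "B \<subseteq> {a..c}" "B \<in> sets borel" for B
    using that by (intro set_integrable_subset[OF q]) auto
  have "{a..c} = {a..b} \<union> {b<..c}" using assms by auto
  then have "(LINT r:{a..c}|lborel. q r) = (LINT r:{a..b}|lborel. q r) + (LINT r:{b<..c}|lborel. q r)"
    using assms(2,3) by (simp only:) (intro set_integral_Un sub, auto)
  also have "(LINT r:{b<..c}|lborel. q r) = (LINT r:{b..c}|lborel. q r)"
  proof (rule set_integral_cong_set)
    show "AE x in lborel. (x \<in> {b..c}) = (x \<in> {b<..c})"
      using AE_lborel_singleton[of b] by eventually_elim auto
    show "set_borel_measurable lborel {b<..c} q" "set_borel_measurable lborel {b..c} q"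
      unfolding set_borel_measurable_def using assms(2,3)
      by (intro borel_measurable_integrable[OF sub[unfolded set_integrable_def]]; auto)+
  qed
  finally show ?thesis .
qed

text \<open>For a monotone inclusion the squared distance of two solutions does not increase. The distance
  need not be differentiable, so additivity over short intervals replaces the chain rule.\<close>

lemma monotone_inclusion_unique:
  fixes x y :: "real \<Rightarrow> 'a::euclidean_space"
  assumes mono: "\<And>p q v u. v \<in> F p \<Longrightarrow> u \<in> F q \<Longrightarrow> (v - u) \<bullet> (p - q) \<le> 0"
    and x: "solves_inclusion F a c x" and y: "solves_inclusion F a c y"
    and cont: "continuous_on {a..c} x" "continuous_on {a..c} y"
    and init: "x a = y a" and t: "t \<in> {a..c}"
  shows "x t = y t"
proof -
  obtain v where v: "set_integrable lborel {a..c} v"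
      "\<And>t. t \<in> {a..c} \<Longrightarrow> x t = x a + (LINT s:{a..t}|lborel. v s)"
      "AE s\<in>{a..c} in lborel. v s \<in> F (x s)"
    using x unfolding solves_inclusion_def by blast
  obtain u where u: "set_integrable lborel {a..c} u"
      "\<And>t. t \<in> {a..c} \<Longrightarrow> y t = y a + (LINT s:{a..t}|lborel. u s)"
      "AE s\<in>{a..c} in lborel. u s \<in> F (y s)"
    using y unfolding solves_inclusion_def by blast
  define q where "q s = v s - u s" for s
  define d where "d s = x s - y s" for s
  have q: "set_integrable lborel {a..c} q"
    unfolding q_def using v(1) u(1) by (rule set_integral_diff)
  have q_sub: "set_integrable lborel {s..t} q" if "a \<le> s" "t \<le> c" for s t
    using that by (intro set_integrable_subset[OF q]) auto
  have d_cont: "continuous_on {a..c} d"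
    unfolding d_def by (intro continuous_intros cont)
  have d_eq: "d t = (LINT s:{a..t}|lborel. q s)" if "t \<in> {a..c}" for t
    unfolding q_def d_def using that init
    by (subst v(2), simp, subst u(2), simp, subst set_integral_diff)
       (auto intro!: set_integrable_subset[OF v(1)] set_integrable_subset[OF u(1)])
  have d_diff: "d t - d s = (LINT r:{s..t}|lborel. q r)" if "a \<le> s" "s \<le> t" "t \<le> c" for s t
  proof -
    have "(LINT r:{a..t}|lborel. q r) = (LINT r:{a..s}|lborel. q r) + (LINT r:{s..t}|lborel. q r)"
      using that by (intro set_integral_combine q_sub) auto
    then show ?thesis
      using that by (simp add: d_eq)
  qed
  have q_le: "AE s in lborel. s \<in> {a..c} \<longrightarrow> q s \<bullet> d s \<le> 0"
    using v(3) u(3) by eventually_elim (auto simp: q_def d_def mono)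
  have qn: "set_integrable lborel {s..t} (\<lambda>r. norm (q r))" if "a \<le> s" "t \<le> c" for s t
    using q_sub[OF that] by (rule set_integrable_norm)
  let ?Q = "\<lambda>s t. LINT r:{s..t}|lborel. norm (q r)"
  \<comment> \<open>On an interval so short that d varies by less than
    \<open>\<epsilon> / 2\<close>, the sum of its values at the two ends differs from twice any
    inner value by at most \<open>\<epsilon>\<close>. As q has nonpositive inner product with d
    almost everywhere, the increment of the squared norm, which is the integral of q paired with
    that sum, is at most \<open>\<epsilon>\<close> times the integral of the norm of q. The Bolzano
    principle for intervals carries this additive bound from short intervals to long ones, and
    afterwards \<open>\<epsilon>\<close> tends to 0.\<close>
  have bound: "(norm (d t))\<^sup>2 \<le> \<epsilon> * ?Q a t" if \<epsilon>: "0 < \<epsilon>" for \<epsilon>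
  proof -
    have *: "a \<le> s \<and> t' \<le> c \<longrightarrow> (norm (d t'))\<^sup>2 - (norm (d s))\<^sup>2 \<le> \<epsilon> * ?Q s t'"
      if st: "s \<le> t'" for s t'
      using st
    proof (induction rule: Bolzano)
      case (trans r s t)
      show ?case
      proof safe
        assume rt: "a \<le> r" "t \<le> c"
        have "?Q r t = ?Q r s + ?Q s t"
          using trans rt by (intro set_integral_combine qn) auto
        then show "(norm (d t))\<^sup>2 - (norm (d r))\<^sup>2 \<le> \<epsilon> * ?Q r t"
          using trans rt by (simp add: distrib_left)
      qed
    next
      case (local p)
      show ?case
      proof (cases "p \<in> {a..c}")
        case False
        then have "\<not> (a \<le> s \<and> t' \<le> c)" if "s \<le> p" "p \<le> t'" for s t'
          using that by auto
        then show ?thesis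
          using zero_less_one by blast
      next
        case True
        obtain \<delta> where \<delta>: "0 < \<delta>" "\<And>r. r \<in> {a..c} \<Longrightarrow> dist r p < \<delta> \<Longrightarrow> dist (d r) (d p) < \<epsilon> / 4"
          using d_cont True \<epsilon> unfolding continuous_on_iff by (metis divide_pos_pos zero_less_numeral)
        have "(norm (d t'))\<^sup>2 - (norm (d s))\<^sup>2 \<le> \<epsilon> * ?Q s t'"
          if st: "s \<le> p" "p \<le> t'" "t' - s < \<delta>" "a \<le> s" "t' \<le> c" for s t'
        proof -
          have qi: "integrable lborel (\<lambda>r. indicator {s..t'} r *\<^sub>R q r)"
            using q_sub[of s t'] st by (simp add: set_integrable_def)
          have "(norm (d t'))\<^sup>2 - (norm (d s))\<^sup>2 = (LINT r:{s..t'}|lborel. q r) \<bullet> (d t' + d s)"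
            using st by (subst d_diff[symmetric]) (auto simp: power2_norm_eq_inner algebra_simps inner_commute)
          also have "\<dots> = (LINT r:{s..t'}|lborel. q r \<bullet> (d t' + d s))"
            unfolding set_lebesgue_integral_def using qi
            by (subst integral_inner_left[symmetric]) auto
          also have "\<dots> \<le> (LINT r:{s..t'}|lborel. \<epsilon> * norm (q r))"
          proof (rule set_integral_mono_AE)
            show "set_integrable lborel {s..t'} (\<lambda>r. q r \<bullet> (d t' + d s))"
              using integrable_inner_left[OF qi] by (simp add: set_integrable_def)
            show "set_integrable lborel {s..t'} (\<lambda>r. \<epsilon> * norm (q r))"
              using qn st by simp
            show "AE r\<in>{s..t'} in lborel. q r \<bullet> (d t' + d s) \<le> \<epsilon> * norm (q r)"
              using q_le
            proof eventually_elim
              case (elim r)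
              show ?case
              proof
                assume r: "r \<in> {s..t'}"
                have near: "dist (d r') (d p) < \<epsilon> / 4" if "r' \<in> {s..t'}" for r'
                  using that st by (intro \<delta>(2)) (auto simp: dist_real_def)
                have "dist (d t') (d r) < \<epsilon> / 2" "dist (d s) (d r) < \<epsilon> / 2"
                  using near[of t'] near[of s] near[OF r] st
                    dist_triangle2[of "d t'" "d r" "d p"] dist_triangle2[of "d s" "d r" "d p"] by auto
                then have "norm ((d t' - d r) + (d s - d r)) \<le> \<epsilon>"
                  by (intro norm_triangle_le) (auto simp: dist_norm)
                then have "q r \<bullet> ((d t' - d r) + (d s - d r)) \<le> norm (q r) * \<epsilon>"
                  by (meson mult_left_mono norm_cauchy_schwarz norm_ge_zero order_trans)
                moreover have "q r \<bullet> d r \<le> 0"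
                  using elim r st by auto
                ultimately show "q r \<bullet> (d t' + d s) \<le> \<epsilon> * norm (q r)"
                  by (simp add: inner_add_right inner_diff_right mult.commute)
              qed
            qed
          qed
          also have "\<dots> = \<epsilon> * ?Q s t'"
            by simp
          finally show ?thesis .
        qed
        then show ?thesis
          using \<delta>(1) by blast
      qed
    qed
    have "d a = 0" using init by (simp add: d_def)
    with *[of a t] t show ?thesis by auto
  qed
  have "((\<lambda>\<epsilon>. \<epsilon> * ?Q a t) \<longlongrightarrow> 0 * ?Q a t) (at_right 0)"
    by (intro tendsto_intros)
  then have "(norm (d t))\<^sup>2 \<le> 0 * ?Q a t"
    by (rule tendsto_lowerbound) (auto intro!: eventually_at_right_less[THEN eventually_mono] bound)
  then show ?thesis by (simp add: d_def)
qed

section \<open>The data flow and the regulariser flow\<close>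

text \<open>The matrix exponential exp (t B) applied to x. It is written as one real power series
  per coordinate, so that termwise differentiation of real power series applies.\<close>

definition lin_flow :: "real^'n^'n \<Rightarrow> real \<Rightarrow> real^'n \<Rightarrow> real^'n" where
  "lin_flow B t x = (\<chi> i. \<Sum>k. ((((*v) B) ^^ k) x $ i / fact k) * t ^ k)"

lemma lin_flow_summable:
  fixes B :: "real^'n^'n"
  shows "summable (\<lambda>k. ((((*v) B) ^^ k) x $ i / fact k) * t ^ k)"
proof -
  obtain c where c: "\<And>y. norm (B *v y) \<le> c * norm y" "0 < c"
    using linear_bounded_pos[OF matrix_vector_mul_linear[of B]] by (metis mult.commute)
  have pow: "norm ((((*v) B) ^^ k) x) \<le> c ^ k * norm x" for k
  proof (induction k)
    case (Suc k)
    have "norm (B *v (((*v) B) ^^ k) x) \<le> c * norm ((((*v) B) ^^ k) x)"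
      by (rule c)
    also have "\<dots> \<le> c * (c ^ k * norm x)"
      using Suc c by (intro mult_left_mono) auto
    finally show ?case by (simp add: mult.assoc)
  qed simp
  have "summable (\<lambda>k. norm x * (inverse (fact k) * (c * \<bar>t\<bar>) ^ k))"
    by (intro summable_mult summable_exp)
  then show ?thesis
  proof (rule summable_comparison_test'[where N = 0])
    fix k
    have "\<bar>(((*v) B) ^^ k) x $ i\<bar> \<le> c ^ k * norm x"
      using component_le_norm_cart[of "(((*v) B) ^^ k) x" i] pow[of k] by linarith
    then have "\<bar>(((*v) B) ^^ k) x $ i\<bar> * (\<bar>t\<bar> ^ k / fact k) \<le> c ^ k * norm x * (\<bar>t\<bar> ^ k / fact k)"
      by (intro mult_right_mono) auto
    then show "norm ((((*v) B) ^^ k) x $ i / fact k * t ^ k) \<le> norm x * (inverse (fact k) * (c * \<bar>t\<bar>) ^ k)"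
      by (simp add: abs_mult power_abs power_mult_distrib field_simps)
  qed
qed

lemma lin_flow_zero: "lin_flow B 0 x = x"
  by (simp add: lin_flow_def vec_eq_iff powser_zero del: times_divide_eq_left)

lemma has_vector_derivative_vec_iff:
  fixes f :: "real \<Rightarrow> real^'n"
  assumes "\<And>i. ((\<lambda>t. f t $ i) has_real_derivative f' $ i) (at t within S)"
  shows "(f has_vector_derivative f') (at t within S)"
  unfolding has_vector_derivative_def has_derivative_componentwise_within[of f]
  using assms by (auto simp: Basis_vec_def inner_axis has_field_derivative_def mult_commute_abs)

lemma lin_flow_deriv:
  fixes B :: "real^'n^'n"
  shows "((\<lambda>t. lin_flow B t x) has_vector_derivative B *v lin_flow B t x) (at t)"
proof (rule has_vector_derivative_vec_iff)
  fix i
  let ?c = "\<lambda>i k. (((*v) B) ^^ k) x $ i / fact k"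
  have "((\<lambda>t. \<Sum>k. ?c i k * t ^ k) has_real_derivative (\<Sum>k. diffs (?c i) k * t ^ k)) (at t)"
    by (rule termdiffs_strong_converges_everywhere) (rule lin_flow_summable)
  moreover have "(\<Sum>k. diffs (?c i) k * t ^ k) = (B *v lin_flow B t x) $ i"
  proof -
    have "diffs (?c i) k * t ^ k = (\<Sum>j\<in>UNIV. B $ i $ j * (?c j k * t ^ k))" for k
    proof -
      have "diffs (?c i) k = (\<Sum>j\<in>UNIV. B $ i $ j * (((*v) B) ^^ k) x $ j) / fact k"
        by (simp add: diffs_def fact_Suc matrix_vector_mult_def del: of_nat_Suc)
      then show ?thesis
        by (simp add: sum_divide_distrib sum_distrib_right mult.assoc)
    qed
    moreover have "(\<lambda>k. \<Sum>j\<in>UNIV. B $ i $ j * (?c j k * t ^ k)) sums (\<Sum>j\<in>UNIV. B $ i $ j * lin_flow B t x $ j)"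
      unfolding lin_flow_def vec_lambda_beta
      by (intro sums_sum sums_mult summable_sums lin_flow_summable)
    ultimately show ?thesis
      by (simp add: sums_iff matrix_vector_mult_def)
  qed
  ultimately show "((\<lambda>t. lin_flow B t x $ i) has_real_derivative (B *v lin_flow B t x) $ i) (at t)"
    by (simp add: lin_flow_def)
qed

lemma normal_equation_decay:
  fixes A :: "real^'n^'m" and d :: "real \<Rightarrow> real^'n"
  assumes \<kappa>: "\<And>v. \<kappa> * norm v \<le> norm (A *v v)" "0 \<le> \<kappa>"
    and d: "\<And>t. (d has_vector_derivative - (transpose A *v (A *v d t))) (at t)"
    and t: "0 \<le> t"
  shows "norm (d t) \<le> exp (- \<kappa>\<^sup>2 * t) * norm (d 0)"
proof -
  let ?f = "\<lambda>t. exp (2 * \<kappa>\<^sup>2 * t) * (d t \<bullet> d t)"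
  have "?f t \<le> ?f 0"
  proof (rule DERIV_nonpos_imp_nonincreasing[OF t])
    fix s
    have A: "d s \<bullet> (transpose A *v (A *v d s)) = (norm (A *v d s))\<^sup>2"
      by (metis dot_lmul_matrix inner_commute power2_norm_eq_inner transpose_matrix_vector)
    have "((\<lambda>t. d t \<bullet> d t) has_vector_derivative (d s \<bullet> - (transpose A *v (A *v d s)) + - (transpose A *v (A *v d s)) \<bullet> d s)) (at s)"
      using bounded_bilinear.has_vector_derivative[OF bounded_bilinear_inner d d] .
    then have "((\<lambda>t. d t \<bullet> d t) has_real_derivative - 2 * (norm (A *v d s))\<^sup>2) (at s)"
      unfolding has_real_derivative_iff_has_vector_derivative
      by (simp add: inner_commute[of _ "d s"] A del: transpose_matrix_vector)
    then have "(?f has_real_derivative exp (2 * \<kappa>\<^sup>2 * s) * (- 2 * (norm (A *v d s))\<^sup>2) + (2 * \<kappa>\<^sup>2 * exp (2 * \<kappa>\<^sup>2 * s)) * (d s \<bullet> d s)) (at s)"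
      by (auto intro!: derivative_eq_intros)
    moreover have "exp (2 * \<kappa>\<^sup>2 * s) * (- 2 * (norm (A *v d s))\<^sup>2) + (2 * \<kappa>\<^sup>2 * exp (2 * \<kappa>\<^sup>2 * s)) * (d s \<bullet> d s) \<le> 0"
    proof -
      have "(\<kappa> * norm (d s))\<^sup>2 \<le> (norm (A *v d s))\<^sup>2"
        using \<kappa> by (intro power_mono) auto
      then have "2 * exp (2 * \<kappa>\<^sup>2 * s) * (\<kappa>\<^sup>2 * (d s \<bullet> d s)) \<le> 2 * exp (2 * \<kappa>\<^sup>2 * s) * (norm (A *v d s))\<^sup>2"
        by (intro mult_left_mono) (auto simp: power2_norm_eq_inner power_mult_distrib)
      then show ?thesis by (simp add: algebra_simps)
    qed
    ultimately show "\<exists>y. (?f has_real_derivative y) (at s) \<and> y \<le> 0" by blast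
  qed
  then have "(exp (\<kappa>\<^sup>2 * t) * norm (d t))\<^sup>2 \<le> (norm (d 0))\<^sup>2"
    by (simp add: power_mult_distrib power2_norm_eq_inner exp_double[symmetric] mult.assoc)
  then have "exp (\<kappa>\<^sup>2 * t) * norm (d t) \<le> norm (d 0)"
    by (rule power2_le_imp_le) simp
  then show ?thesis
    by (simp add: exp_minus field_simps)
qed

text \<open>Near (t0, x0) the comparison passes through f t x0: the change of x costs at most its
  own size, uniformly in t, and the change of t is continuous for the fixed x0. Joint continuity is
  what makes the random compositions Borel measurable.\<close>

lemma continuous_on_nonexpansive_flow:
  fixes f :: "real \<Rightarrow> 'a::real_normed_vector \<Rightarrow> 'a"
  assumes "\<And>x. continuous_on UNIV (\<lambda>t. f t x)" and "\<And>t x y. norm (f t x - f t y) \<le> norm (x - y)"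
  shows "continuous_on UNIV (\<lambda>(t, x). f t x)"
  unfolding continuous_on_def
proof (rule ballI)
  fix z0 :: "real \<times> 'a"
  obtain t0 x0 where z0: "z0 = (t0, x0)" by (cases z0)
  have f: "((\<lambda>z. f (fst z) x0) \<longlongrightarrow> f t0 x0) (at (t0, x0))"
    using assms(1)[of x0] by (intro isCont_tendsto_compose[where g = "\<lambda>t. f t x0"])
      (auto simp: continuous_on_eq_continuous_at intro!: tendsto_eq_intros)
  have "((\<lambda>z. norm (snd z - x0) + norm (f (fst z) x0 - f t0 x0)) \<longlongrightarrow> norm (x0 - x0) + norm (f t0 x0 - f t0 x0)) (at (t0, x0))"
    by (intro tendsto_intros f) (auto intro!: tendsto_eq_intros)
  then have lim0: "((\<lambda>z. norm (snd z - x0) + norm (f (fst z) x0 - f t0 x0)) \<longlongrightarrow> 0) (at (t0, x0))"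
    by simp
  have "((\<lambda>z. f (fst z) (snd z) - f t0 x0) \<longlongrightarrow> 0) (at (t0, x0))"
  proof (rule Lim_null_comparison[OF _ lim0],
      rule always_eventually, rule allI)
    fix z
    show "norm (f (fst z) (snd z) - f t0 x0) \<le> norm (snd z - x0) + norm (f (fst z) x0 - f t0 x0)"
      using norm_triangle_ineq[of "f (fst z) (snd z) - f (fst z) x0" "f (fst z) x0 - f t0 x0"]
        assms(2)[of "fst z" "snd z" x0] by simp
  qed
  then show "((\<lambda>(t, x). f t x) \<longlongrightarrow> (case z0 of (t, x) \<Rightarrow> f t x)) (at z0 within UNIV)"
    by (simp add: Lim_null[symmetric] split_def z0)
qed

text \<open>Soft thresholding. It is the solution at time t of the scalar inclusion whose drift is
  minus the subdifferential of the absolute value: unit speed towards 0, then rest.\<close>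

definition soft :: "real \<Rightarrow> real \<Rightarrow> real" where
  "soft t x = sgn x * max 0 (\<bar>x\<bar> - t)"

lemma soft_add: "0 \<le> s \<Longrightarrow> 0 \<le> t \<Longrightarrow> soft (s + t) x = soft t (soft s x)"
  by (auto simp: soft_def sgn_if max_def abs_if)

lemma soft_zero [simp]: "soft 0 x = x"
  by (auto simp: soft_def sgn_if)

lemma soft_nonexpansive: "0 \<le> t \<Longrightarrow> \<bar>soft t x - soft t y\<bar> \<le> \<bar>x - y\<bar>"
  by (auto simp: soft_def sgn_if max_def abs_if)

lemma soft_abs_le: "0 \<le> t \<Longrightarrow> \<bar>soft t x\<bar> \<le> \<bar>x\<bar>"
  by (auto simp: soft_def sgn_if max_def abs_if)

definition reg_flow :: "real \<Rightarrow> real^'n \<Rightarrow> real^'n" where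
  "reg_flow t x = (\<chi> k. soft t (x $ k))"

text \<open>The constant c is a solution of the normal equations, that is, an equilibrium; around it
  the flow is linear with generator minus \<open>transpose A ** A\<close>. That such a c exists is
  \<open>normal_equation_solvable\<close>.\<close>

definition data_flow :: "real^'n^'m \<Rightarrow> real^'m \<Rightarrow> real \<Rightarrow> real^'n \<Rightarrow> real^'n" where
  "data_flow A b t x = (let c = SOME c. transpose A *v (A *v c) = transpose A *v b
    in c + lin_flow (- (transpose A ** A)) t (x - c))"

text \<open>Truncating time at \<open>0\<close> makes the flow nonexpansive and jointly continuous for all times.\<close>

definition flow :: "real^'n^'m \<Rightarrow> real^'m \<Rightarrow> bool \<Rightarrow> real \<Rightarrow> real^'n \<Rightarrow> real^'n" where
  "flow A b j t x = (if j then reg_flow (max 0 t) x else data_flow A b (max 0 t) x)"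

lemma minus_matrix_vector_mult: "(- M) *v x = - (M *v x)" for M :: "real^'n^'m"
  by (simp add: vec_eq_iff matrix_vector_mult_def sum_negf)

lemma rank_bounded_below:
  fixes A :: "real^'n^'m"
  assumes "rank A = CARD('n)"
  obtains \<kappa> where "0 < \<kappa>" "\<And>v. \<kappa> * norm v \<le> norm (A *v v)"
proof -
  have "inj ((*v) A)" using assms full_rank_injective[of A] by blast
  from linear_inj_bounded_below_pos[of "(*v) A", OF matrix_vector_mul_linear this] that
  show ?thesis by blast
qed

text \<open>If \<open>transpose A *v (A *v v)\<close> vanishes, pairing it with v shows A v = 0,
  hence v = 0 by full rank. An injective linear map of a finite-dimensional space into itself is
  onto.\<close>

lemma normal_equation_solvable:
  fixes A :: "real^'n^'m"
  assumes "rank A = CARD('n)"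
  shows "\<exists>c. transpose A *v (A *v c) = transpose A *v b"
proof -
  let ?M = "\<lambda>v. transpose A *v (A *v v)"
  have lin: "linear ?M"
    by (intro linear_compose[of "(*v) A" "(*v) (transpose A)", unfolded o_def] matrix_vector_mul_linear)
  have "v = 0" if "?M v = 0" for v
  proof -
    have "(A *v v) \<bullet> (A *v v) = 0"
      using that by (metis dot_lmul_matrix inner_commute inner_zero_left transpose_matrix_vector)
    then have "A *v v = 0" by simp
    then show ?thesis
      using assms full_rank_injective[of A] matrix_left_invertible_injective
      by (metis inj_eq matrix_vector_mult_0_right)
  qed
  then have "inj ?M"
    using lin by (simp add: linear_injective_0 del: transpose_matrix_vector)
  then have "surj ?M"
    by (rule linear_injective_imp_surjective[OF lin]) (rule refl)
  then show ?thesis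
    by (metis surjD)
qed

lemma data_flow_deriv:
  fixes A :: "real^'n^'m"
  assumes "rank A = CARD('n)"
  shows "((\<lambda>t. data_flow A b t x) has_vector_derivative
    - (transpose A *v (A *v data_flow A b t x) - transpose A *v b)) (at t)"
proof -
  define c where "c = (SOME c. transpose A *v (A *v c) = transpose A *v b)"
  have c: "transpose A *v (A *v c) = transpose A *v b"
    unfolding c_def by (rule someI_ex[OF normal_equation_solvable[OF assms]])
  have "((\<lambda>t. c + lin_flow (- (transpose A ** A)) t (x - c)) has_vector_derivative
      0 + - (transpose A ** A) *v lin_flow (- (transpose A ** A)) t (x - c)) (at t)"
    by (intro has_vector_derivative_add has_vector_derivative_const lin_flow_deriv)
  moreover have "0 + - (transpose A ** A) *v y = - (transpose A *v (A *v (c + y)) - transpose A *v b)" for y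
    by (simp add: minus_matrix_vector_mult matrix_vector_mul_assoc[symmetric] matrix_vector_right_distrib c
        del: transpose_matrix_vector)
  ultimately show ?thesis
    unfolding data_flow_def c_def[symmetric] Let_def by (simp only:)
qed

lemma data_flow_zero: "data_flow A b 0 x = x"
  by (simp add: data_flow_def lin_flow_zero Let_def)

lemma data_flow_contract:
  fixes A :: "real^'n^'m"
  assumes "rank A = CARD('n)" and \<kappa>: "\<And>v. \<kappa> * norm v \<le> norm (A *v v)" "0 \<le> \<kappa>" and "0 \<le> t"
  shows "norm (data_flow A b t x - data_flow A b t y) \<le> exp (- \<kappa>\<^sup>2 * t) * norm (x - y)"
proof -
  have "norm (data_flow A b t x - data_flow A b t y) \<le>
      exp (- \<kappa>\<^sup>2 * t) * norm (data_flow A b 0 x - data_flow A b 0 y)"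
  proof (rule normal_equation_decay[OF \<kappa> _ \<open>0 \<le> t\<close>])
    fix t
    have "((\<lambda>t. data_flow A b t x - data_flow A b t y) has_vector_derivative
      - (transpose A *v (A *v data_flow A b t x) - transpose A *v b)
      - - (transpose A *v (A *v data_flow A b t y) - transpose A *v b)) (at t)"
      by (intro has_vector_derivative_diff data_flow_deriv assms)
    then show "((\<lambda>t. data_flow A b t x - data_flow A b t y) has_vector_derivative
        - (transpose A *v (A *v (data_flow A b t x - data_flow A b t y)))) (at t)"
      by (simp add: matrix_vector_mult_diff_distrib del: transpose_matrix_vector)
  qed
  then show ?thesis by (simp add: data_flow_zero)
qed

text \<open>Both sides solve the same affine equation in t and agree at t = 0. Their difference
  solves the linear equation, and the decay estimate with constant 0 makes it vanish.\<close>

lemma data_flow_add: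
  fixes A :: "real^'n^'m"
  assumes A: "rank A = CARD('n)" and "0 \<le> t"
  shows "data_flow A b (s + t) x = data_flow A b t (data_flow A b s x)"
proof -
  let ?d = "\<lambda>t. data_flow A b (s + t) x - data_flow A b t (data_flow A b s x)"
  have "norm (?d t) \<le> exp (- 0\<^sup>2 * t) * norm (?d 0)"
  proof (rule normal_equation_decay[OF _ _ _ \<open>0 \<le> t\<close>])
    fix t
    have "((\<lambda>t. data_flow A b t x) \<circ> (\<lambda>t. s + t) has_vector_derivative
        1 *\<^sub>R - (transpose A *v (A *v data_flow A b (s + t) x) - transpose A *v b)) (at t)"
      by (intro vector_diff_chain_at data_flow_deriv A) (auto intro!: derivative_eq_intros)
    then have "((\<lambda>t. data_flow A b (s + t) x) has_vector_derivative
        - (transpose A *v (A *v data_flow A b (s + t) x) - transpose A *v b)) (at t)"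
      by (simp add: o_def del: transpose_matrix_vector)
    then have "(?d has_vector_derivative
      - (transpose A *v (A *v data_flow A b (s + t) x) - transpose A *v b)
      - - (transpose A *v (A *v data_flow A b t (data_flow A b s x)) - transpose A *v b)) (at t)"
      by (intro has_vector_derivative_diff data_flow_deriv A)
    then show "(?d has_vector_derivative - (transpose A *v (A *v ?d t))) (at t)"
      by (simp add: matrix_vector_mult_diff_distrib del: transpose_matrix_vector)
  qed auto
  then show ?thesis by (simp add: data_flow_zero)
qed

text \<open>The velocity \<open>?v\<close> of the orbit solves the linear equation itself, so it
  decays exponentially from its initial value \<open>transpose A *v b\<close>; integrating its bound
  gives the claim. The factor \<open>1 - exp (- \<kappa>\<^sup>2 * t)\<close> is kept because it
  complements the contraction factor in \<open>data_flow_ball\<close>.\<close>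

lemma data_flow_0_bound:
  fixes A :: "real^'n^'m"
  assumes A: "rank A = CARD('n)" and \<kappa>: "\<And>v. \<kappa> * norm v \<le> norm (A *v v)" "0 < \<kappa>" and t: "0 \<le> t"
  shows "norm (data_flow A b t 0) \<le> (1 - exp (- \<kappa>\<^sup>2 * t)) * (norm (transpose A *v b) / \<kappa>\<^sup>2)"
proof -
  let ?v = "\<lambda>t. - (transpose A *v (A *v data_flow A b t 0) - transpose A *v b)"
  have v_deriv: "(?v has_vector_derivative - (transpose A *v (A *v ?v t))) (at t)" for t
  proof -
    have lin: "bounded_linear (\<lambda>v. transpose A *v (A *v v))"
      by (intro linear_conv_bounded_linear[THEN iffD1]
          linear_compose[of "(*v) A" "(*v) (transpose A)", unfolded o_def] matrix_vector_mul_linear)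
    have "(?v has_vector_derivative - (transpose A *v (A *v ?v t) - 0)) (at t)"
      by (intro has_vector_derivative_minus has_vector_derivative_diff has_vector_derivative_const
          bounded_linear.has_vector_derivative[OF lin] data_flow_deriv A)
    then show ?thesis by simp
  qed
  have v_bound: "norm (?v s) \<le> exp (- \<kappa>\<^sup>2 * s) * norm (transpose A *v b)" if "0 \<le> s" for s
    using normal_equation_decay[of \<kappa> A ?v, OF \<kappa>(1) _ v_deriv that] \<kappa>(2)
    by (simp add: data_flow_zero del: transpose_matrix_vector)
  show ?thesis
  proof (cases "t = 0")
    case True
    then show ?thesis by (simp add: data_flow_zero)
  next
    case False
    let ?C = "norm (transpose A *v b) / \<kappa>\<^sup>2"
    have "norm (data_flow A b t 0 - data_flow A b 0 0) \<le> - ?C * exp (- \<kappa>\<^sup>2 * t) - - ?C * exp (- \<kappa>\<^sup>2 * 0)"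
    proof (rule differentiable_bound_general)
      show "0 < t" using False t by simp
      show "continuous_on {0..t} (\<lambda>t. data_flow A b t 0)"
        by (intro continuous_at_imp_continuous_on ballI has_vector_derivative_continuous[OF data_flow_deriv[OF A]])
      show "continuous_on {0..t} (\<lambda>t. - ?C * exp (- \<kappa>\<^sup>2 * t))"
        by (intro continuous_intros)
      fix s assume s: "0 < s" "s < t"
      show "((\<lambda>t. data_flow A b t 0) has_vector_derivative ?v s) (at s)"
        by (rule data_flow_deriv[OF A])
      have "((\<lambda>t. - ?C * exp (- \<kappa>\<^sup>2 * t)) has_real_derivative exp (- \<kappa>\<^sup>2 * s) * norm (transpose A *v b)) (at s)"
        using \<kappa>(2) by (auto intro!: derivative_eq_intros simp: field_simps)
      then show "((\<lambda>t. - ?C * exp (- \<kappa>\<^sup>2 * t)) has_vector_derivative exp (- \<kappa>\<^sup>2 * s) * norm (transpose A *v b)) (at s)"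
        by (simp add: has_real_derivative_iff_has_vector_derivative)
      show "norm (?v s) \<le> exp (- \<kappa>\<^sup>2 * s) * norm (transpose A *v b)"
        using s by (intro v_bound) simp
    qed
    then show ?thesis by (simp add: data_flow_zero algebra_simps)
  qed
qed

text \<open>The distance to the orbit of 0 shrinks by a factor e, and that orbit is within (1 - e)
  times the constant of the origin, so the bound is a convex combination of numbers below R. The
  radius does not grow with t, so it survives any number of switches.\<close>

lemma data_flow_ball:
  fixes A :: "real^'n^'m"
  assumes A: "rank A = CARD('n)" and \<kappa>: "\<And>v. \<kappa> * norm v \<le> norm (A *v v)" "0 < \<kappa>" and t: "0 \<le> t"
    and x: "norm x \<le> R" and R: "norm (transpose A *v b) / \<kappa>\<^sup>2 \<le> R"
  shows "norm (data_flow A b t x) \<le> R"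
proof -
  let ?e = "exp (- \<kappa>\<^sup>2 * t)"
  have "norm (data_flow A b t x) \<le> norm (data_flow A b t x - data_flow A b t 0) + norm (data_flow A b t 0)"
    by (metis diff_add_cancel norm_triangle_ineq)
  also have "\<dots> \<le> ?e * norm (x - 0) + (1 - ?e) * (norm (transpose A *v b) / \<kappa>\<^sup>2)"
    using \<kappa>(2) by (intro add_mono data_flow_contract data_flow_0_bound A \<kappa>(1) t) auto
  also have "\<dots> \<le> ?e * R + (1 - ?e) * R"
    using x R t by (intro add_mono mult_left_mono) auto
  finally show ?thesis by (simp add: algebra_simps)
qed

lemma flow_zero: "flow A b j 0 x = x"
  by (simp add: flow_def reg_flow_def data_flow_zero vec_eq_iff)

lemma flow_add:
  fixes A :: "real^'n^'m"
  assumes "rank A = CARD('n)" "0 \<le> s" "0 \<le> t"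
  shows "flow A b j (s + t) x = flow A b j t (flow A b j s x)"
  using assms by (auto simp: flow_def reg_flow_def data_flow_add vec_eq_iff soft_add)

lemma reg_flow_nonexpansive: "0 \<le> t \<Longrightarrow> norm (reg_flow t x - reg_flow t y) \<le> norm (x - y)"
  by (rule norm_le_componentwise_cart) (simp add: reg_flow_def soft_nonexpansive)

lemma reg_flow_ball: "0 \<le> t \<Longrightarrow> norm (reg_flow t x) \<le> norm x"
  by (rule norm_le_componentwise_cart) (simp add: reg_flow_def soft_abs_le)

lemma flow_contract:
  fixes A :: "real^'n^'m"
  assumes A: "rank A = CARD('n)" and \<kappa>: "\<And>v. \<kappa> * norm v \<le> norm (A *v v)" "0 \<le> \<kappa>" and "0 \<le> t"
  shows "norm (flow A b j t x - flow A b j t y) \<le> exp (- (if j then 0 else \<kappa>\<^sup>2) * t) * norm (x - y)"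
  using assms data_flow_contract[OF assms, of b x y] by (simp add: flow_def reg_flow_nonexpansive)

lemma flow_continuous:
  fixes A :: "real^'n^'m"
  assumes A: "rank A = CARD('n)"
  shows "continuous_on UNIV (\<lambda>(t, x). flow A b j t x)"
proof (rule continuous_on_nonexpansive_flow)
  fix t x y
  show "norm (flow A b j t x - flow A b j t y) \<le> norm (x - y)"
    using reg_flow_nonexpansive[of "max 0 t" x y] data_flow_contract[of A 0 "max 0 t" b x y, OF A]
    by (simp add: flow_def)
  have "continuous_on UNIV (\<lambda>t. data_flow A b t x)"
    by (intro continuous_at_imp_continuous_on ballI has_vector_derivative_continuous[OF data_flow_deriv[OF A]])
  then have "continuous_on UNIV (\<lambda>t. data_flow A b (max 0 t) x)"
    by (rule continuous_on_compose2) (auto intro!: continuous_intros)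
  moreover have "continuous_on UNIV (\<lambda>t. reg_flow (max 0 t) x)"
    unfolding reg_flow_def soft_def by (intro continuous_intros)
  ultimately show "continuous_on UNIV (\<lambda>t. flow A b j t x)"
    by (cases j) (simp_all add: flow_def)
qed

text \<open>Both drifts are negative subgradients of convex functions. For the norm the two
  subgradient inequalities are added; for the data term the inner product is minus a squared
  norm.\<close>

lemma drift_monotone:
  fixes A :: "real^'n^'m"
  assumes v: "v \<in> drift A b j p" and u: "u \<in> drift A b j q"
  shows "(v - u) \<bullet> (p - q) \<le> 0"
proof (cases j)
  case True
  obtain g h where g: "g \<in> subdifferential \<Phi>r p" "v = - g" and h: "h \<in> subdifferential \<Phi>r q" "u = - h"
    using u v True by (auto simp: drift_def)
  have "\<Phi>r p + g \<bullet> (q - p) \<le> \<Phi>r q" "\<Phi>r q + h \<bullet> (p - q) \<le> \<Phi>r p"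
    using g h by (auto simp: subdifferential_def)
  then show ?thesis
    by (simp add: g h inner_diff_right inner_diff_left)
next
  case False
  have "v - u = - (transpose A *v (A *v (p - q)))"
    using u v False by (simp add: drift_False matrix_vector_mult_diff_distrib del: transpose_matrix_vector)
  moreover have "(transpose A *v (A *v (p - q))) \<bullet> (p - q) = (norm (A *v (p - q)))\<^sup>2"
    by (metis dot_lmul_matrix power2_norm_eq_inner transpose_matrix_vector)
  ultimately show ?thesis by (simp del: transpose_matrix_vector)
qed

lemma flow_solves:
  fixes A :: "real^'n^'m"
  assumes A: "rank A = CARD('n)" and "a \<le> c"
  shows "solves_inclusion (drift A b j) a c (\<lambda>t. flow A b j (t - a) x)"
proof (cases j)
  case False
  let ?v = "\<lambda>t. - (transpose A *v (A *v data_flow A b (t - a) x) - transpose A *v b)"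
  have lin: "bounded_linear (\<lambda>v. transpose A *v (A *v v))"
    by (intro linear_conv_bounded_linear[THEN iffD1]
        linear_compose[of "(*v) A" "(*v) (transpose A)", unfolded o_def] matrix_vector_mul_linear)
  have deriv: "((\<lambda>t. data_flow A b (t - a) x) has_vector_derivative ?v t) (at t)" for t
  proof -
    have "((\<lambda>t. data_flow A b t x) \<circ> (\<lambda>t. t - a) has_vector_derivative 1 *\<^sub>R ?v t) (at t)"
      by (intro vector_diff_chain_at data_flow_deriv A) (auto intro!: derivative_eq_intros)
    then show ?thesis by (simp add: o_def del: transpose_matrix_vector)
  qed
  have v_cont: "continuous_on UNIV ?v"
    by (intro continuous_intros bounded_linear.continuous_on[OF lin]
        continuous_at_imp_continuous_on ballI has_vector_derivative_continuous[OF deriv])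
  show ?thesis
    unfolding solves_inclusion_def
  proof (intro exI[of _ ?v] conjI ballI)
    show "set_integrable lborel {a..c} ?v"
      by (rule borel_integrable_atLeastAtMost') (rule continuous_on_subset[OF v_cont], simp)
    fix t assume t: "t \<in> {a..c}"
    have "(LBINT s:{a..t}. ?v s) = data_flow A b (t - a) x - data_flow A b (a - a) x"
      unfolding set_lebesgue_integral_def using t
      by (intro integral_FTC_Icc continuous_on_subset[OF v_cont]
          has_vector_derivative_at_within[OF deriv]) auto
    then show "flow A b j (t - a) x = flow A b j (a - a) x + (LBINT s:{a..t}. ?v s)"
      using t False by (simp add: flow_def del: transpose_matrix_vector)
  next
    show "AE s\<in>{a..c} in lborel. ?v s \<in> drift A b j (flow A b j (s - a) x)"
      using False by (auto simp: drift_False flow_def simp del: transpose_matrix_vector)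
  qed
next
  case True
  \<comment> \<open>Coordinate k moves towards 0 with unit speed until the time
    \<open>a + \<bar>x $ k\<bar>\<close> and then rests. Once it has reached 0 the velocity is 0,
    which belongs to \<open>{-1..1}\<close>, so the inclusion holds at every time of the
    interval.\<close>
  let ?v = "\<lambda>t. \<chi> k. - sgn (x $ k) * indicator {..<a + \<bar>x $ k\<bar>} t"
  \<comment> \<open>As a finite sum of constant vectors on half-lines the velocity can be integrated
    term by term; each term contributes the length of an interval.\<close>
  have v_eq: "?v t = (\<Sum>k\<in>UNIV. indicator {..<a + \<bar>x $ k\<bar>} t *\<^sub>R axis k (- sgn (x $ k)))" for t
    by (simp add: vec_eq_iff axis_def if_distrib sum.delta cong: if_cong)
  have int: "set_integrable lborel {a..t} (\<lambda>t. indicator {..<a + \<bar>x $ k\<bar>} t *\<^sub>R axis k (- sgn (x $ k)))" for t k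
  proof -
    have "set_integrable lborel ({a..t} \<inter> {..<a + \<bar>x $ k\<bar>}) (\<lambda>t. axis k (- sgn (x $ k)) :: real^'n)"
      unfolding set_integrable_def
      by (intro integrable_scaleR_left integrable_real_indicator emeasure_bounded_finite)
         (auto intro: bounded_subset[of "{a..t}"])
    then show ?thesis
      by (simp add: set_integrable_def indicator_inter_arith)
  qed
  show ?thesis
    unfolding solves_inclusion_def
  proof (intro exI[of _ ?v] conjI ballI)
    show "set_integrable lborel {a..c} ?v"
      unfolding v_eq set_integrable_def scaleR_sum_right
      by (intro Bochner_Integration.integrable_sum int[unfolded set_integrable_def])
    fix t assume t: "t \<in> {a..c}"
    have "(LBINT s. indicator {a..t} s *\<^sub>R indicator {..<a + \<bar>x $ k\<bar>} s *\<^sub>R axis k (- sgn (x $ k)))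
        = measure lborel ({a..t} \<inter> {..<a + \<bar>x $ k\<bar>}) *\<^sub>R (axis k (- sgn (x $ k)) :: real^'n)" for k
    proof -
      have "(LBINT s. indicator {a..t} s *\<^sub>R indicator {..<a + \<bar>x $ k\<bar>} s *\<^sub>R axis k (- sgn (x $ k)))
        = (LBINT s. indicator ({a..t} \<inter> {..<a + \<bar>x $ k\<bar>}) s *\<^sub>R (axis k (- sgn (x $ k)) :: real^'n))"
        by (simp add: indicator_inter_arith)
      also have "\<dots> = (LBINT s. indicator ({a..t} \<inter> {..<a + \<bar>x $ k\<bar>}) s) *\<^sub>R axis k (- sgn (x $ k))"
        by (intro integral_scaleR_left integrable_real_indicator emeasure_bounded_finite)
           (auto intro: bounded_subset[of "{a..t}"])
      finally show ?thesis by simp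
    qed
    then have "(LBINT s:{a..t}. ?v s) = (\<Sum>k\<in>UNIV. measure lborel ({a..t} \<inter> {..<a + \<bar>x $ k\<bar>}) *\<^sub>R axis k (- sgn (x $ k)))"
      unfolding v_eq set_lebesgue_integral_def scaleR_sum_right
      using int[of t] by (subst Bochner_Integration.integral_sum) (auto simp: set_integrable_def)
    moreover have "measure lborel ({a..t} \<inter> {..<a + \<bar>x $ k\<bar>}) = min (t - a) \<bar>x $ k\<bar>" for k
    proof (cases "t < a + \<bar>x $ k\<bar>")
      case True
      then have "{a..t} \<inter> {..<a + \<bar>x $ k\<bar>} = {a..t}" by auto
      then show ?thesis using True t by simp
    next
      case False
      then have "{a..t} \<inter> {..<a + \<bar>x $ k\<bar>} = {a..<a + \<bar>x $ k\<bar>}" by auto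
      then show ?thesis using False t by simp
    qed
    ultimately show "flow A b j (t - a) x = flow A b j (a - a) x + (LBINT s:{a..t}. ?v s)"
      using t True
      by (auto simp: flow_def reg_flow_def soft_def vec_eq_iff axis_def sgn_if min_def max_def
          if_distrib[of "\<lambda>x. _ * x"] sum.delta cong: if_cong)
  next
    have "?v s \<in> drift A b True (flow A b True (s - a) x)" if "s \<in> {a..c}" for s
    proof -
      have "?v s = - (- ?v s)" by simp
      moreover have "- ?v s \<in> subdifferential \<Phi>r (flow A b True (s - a) x)"
        using that unfolding subdifferential_\<Phi>r
        by (auto simp: flow_def reg_flow_def soft_def sgn_if indicator_def max_def)
      ultimately show ?thesis
        unfolding drift_def by (simp only: if_True) (rule image_eqI)
    qed
    then show "AE s\<in>{a..c} in lborel. ?v s \<in> drift A b j (flow A b j (s - a) x)"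
      using True by auto
  qed
qed

section \<open>Randomly switched contractive flows\<close>

context switching_rate
begin

lemma nn_integral_expm_split:
  assumes [measurable]: "h \<in> borel_measurable borel"
  shows "(\<integral>\<^sup>+r. (if t < r then a else h r) \<partial>\<E>) = a * emeasure \<E> {t<..} + (\<integral>\<^sup>+r. h r * indicator {..t} r \<partial>\<E>)"
proof -
  have "(\<integral>\<^sup>+r. (if t < r then a else h r) \<partial>\<E>) = (\<integral>\<^sup>+r. a * indicator {t<..} r + h r * indicator {..t} r \<partial>\<E>)"
    by (intro nn_integral_cong) (auto simp: indicator_def)
  then show ?thesis
    by (simp add: nn_integral_add nn_integral_cmult)
qed

text \<open>Evaluates one step of a renewal equation in closed form: H is a primitive of h against
  the exponential density, and a is the value without a jump. It serves to check explicit
  supersolutions.\<close>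

lemma nn_integral_expm_FTC:
  assumes [measurable]: "h \<in> borel_measurable borel"
    and t: "0 \<le> t" and a: "0 \<le> a"
    and h: "\<And>r. 0 \<le> r \<Longrightarrow> r \<le> t \<Longrightarrow> 0 \<le> h r"
    and H: "\<And>r. 0 \<le> r \<Longrightarrow> r \<le> t \<Longrightarrow> (H has_real_derivative lam * exp (- lam * r) * h r) (at r)"
  shows "(\<integral>\<^sup>+r. (if t < r then ennreal a else ennreal (h r)) \<partial>\<E>) = ennreal (a * exp (- lam * t) + (H t - H 0))"
proof -
  have "(\<integral>\<^sup>+r. ennreal (h r) * indicator {..t} r \<partial>\<E>)
      = (\<integral>\<^sup>+r. ennreal (lam * exp (- lam * r) * h r) * indicator {0..t} r \<partial>lborel)"
    using lam_pos h
    by (subst nn_integral_expm) (auto intro!: nn_integral_cong simp: ennreal_mult indicator_def)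
  also have "\<dots> = ennreal (H t - H 0)"
    using lam_pos h by (intro nn_integral_FTC_Icc H t) auto
  finally have int: "(\<integral>\<^sup>+r. ennreal (h r) * indicator {..t} r \<partial>\<E>) = ennreal (H t - H 0)" .
  have "H 0 \<le> H t"
    using h H lam_pos by (intro DERIV_nonneg_imp_nondecreasing[OF t]) (auto intro!: exI mult_nonneg_nonneg)
  then show ?thesis
    using a t by (subst nn_integral_expm_split) (auto simp: int emeasure_expm_gt ennreal_mult ennreal_plus)
qed

text \<open>One step for a candidate of the form C exp (- c t): k is the contraction rate in the
  current state and C' the weight of the next one. With d = lam + k - c and q = exp (- d t) the
  integral equals exp (- c t) times the convex combination q * 1 + (1 - q) * (lam * C' / d), so it
  suffices that both entries are at most C.\<close>

lemma nn_integral_expm_exp_le: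
  assumes t: "0 \<le> t" and k: "0 \<le> k" "0 \<le> C'" "1 \<le> C" and c: "c < lam + k" "0 \<le> c"
    and C: "lam * C' \<le> C * (lam + k - c)"
  shows "(\<integral>\<^sup>+r. (if t < r then ennreal (exp (- k * t)) else ennreal (C' * exp (- c * (t - r)) * exp (- k * r))) \<partial>\<E>)
    \<le> ennreal (C * exp (- c * t))"
proof -
  define d where "d = lam + k - c"
  have d: "0 < d" using c by (simp add: d_def)
  let ?H = "\<lambda>r. - (lam * C' / d) * exp (- c * t) * exp (- d * r)"
  have "(\<integral>\<^sup>+r. (if t < r then ennreal (exp (- k * t)) else ennreal (C' * exp (- c * (t - r)) * exp (- k * r))) \<partial>\<E>)
      = ennreal (exp (- k * t) * exp (- lam * t) + (?H t - ?H 0))"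
  proof (rule nn_integral_expm_FTC[OF _ t])
    fix r
    have "exp (- c * t) * exp (- d * r) = exp (- lam * r) * (exp (- c * (t - r)) * exp (- k * r))"
      by (simp add: exp_add[symmetric] d_def algebra_simps)
    then show "(?H has_real_derivative lam * exp (- lam * r) * (C' * exp (- c * (t - r)) * exp (- k * r))) (at r)"
      using d by (auto intro!: derivative_eq_intros simp: mult_ac)
  qed (use k in auto)
  also have "exp (- k * t) * exp (- lam * t) + (?H t - ?H 0) \<le> C * exp (- c * t)"
  proof -
    define q where "q = exp (- d * t)"
    have q: "0 \<le> q" "q \<le> 1" using d t by (auto simp: q_def)
    have "exp (- k * t) * exp (- lam * t) = exp (- c * t) * q"
      by (simp add: q_def exp_add[symmetric] d_def algebra_simps)
    then have "exp (- k * t) * exp (- lam * t) + (?H t - ?H 0) = exp (- c * t) * (q * 1 + (1 - q) * (lam * C' / d))"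
      unfolding q_def by (simp add: algebra_simps)
    also have "\<dots> \<le> exp (- c * t) * (q * C + (1 - q) * C)"
      using q k C d by (intro mult_left_mono add_mono) (auto simp: divide_le_eq d_def)
    finally show ?thesis by (simp add: algebra_simps)
  qed
  finally show ?thesis by (simp add: ennreal_leI)
qed

end

abbreviation states :: "(bool \<times> 'a::topological_space) measure" where
  "states \<equiv> count_space UNIV \<Otimes>\<^sub>M borel"

lemma space_states [simp]: "space states = UNIV"
  by (simp add: space_pair_measure)

text \<open>All that the probabilistic part uses of the two flows. State \<open>False\<close>
  contracts at rate \<open>\<kappa>\<close>, state \<open>True\<close> is merely nonexpansive, and
  every ball of radius at least R is invariant under both. In the application this rate is the
  square of the lower bound of A.\<close>

locale switched_flow = switching_rate lam for lam :: real +
  fixes \<phi> :: "bool \<Rightarrow> real \<Rightarrow> 'a::euclidean_space \<Rightarrow> 'a" and \<kappa> R :: real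
  assumes \<phi>_cont: "\<And>j. continuous_on UNIV (\<lambda>(t, x). \<phi> j t x)"
    and \<phi>_zero: "\<And>j x. \<phi> j 0 x = x"
    and \<phi>_add: "\<And>j s t x. 0 \<le> s \<Longrightarrow> 0 \<le> t \<Longrightarrow> \<phi> j (s + t) x = \<phi> j t (\<phi> j s x)"
    and \<phi>_contract: "\<And>j t x y. 0 \<le> t \<Longrightarrow> norm (\<phi> j t x - \<phi> j t y) \<le> exp (- (if j then 0 else \<kappa>) * t) * norm (x - y)"
    and \<phi>_ball: "\<And>j t x r. 0 \<le> t \<Longrightarrow> norm x \<le> r \<Longrightarrow> R \<le> r \<Longrightarrow> norm (\<phi> j t x) \<le> r"
    and \<kappa>_pos: "0 < \<kappa>" and R_nonneg: "0 \<le> R"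
begin

lemma \<phi>_measurable [measurable (raw)]:
  assumes [measurable]: "j \<in> M \<rightarrow>\<^sub>M count_space UNIV" "t \<in> borel_measurable M" "x \<in> borel_measurable M"
  shows "(\<lambda>z. \<phi> (j z) (t z) (x z)) \<in> borel_measurable M"
proof -
  have [measurable]: "(\<lambda>z. \<phi> i (t z) (x z)) \<in> borel_measurable M" for i
    using assms(2,3) \<phi>_cont[of i, unfolded split_def] by (rule borel_measurable_continuous_Pair)
  have "(\<lambda>z. if j z then \<phi> True (t z) (x z) else \<phi> False (t z) (x z)) \<in> borel_measurable M"
    by measurable
  moreover have "(\<lambda>z. if j z then \<phi> True (t z) (x z) else \<phi> False (t z) (x z)) = (\<lambda>z. \<phi> (j z) (t z) (x z))"
    by auto
  ultimately show ?thesis by simp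
qed

section \<open>Switched trajectories and their transition semigroup\<close>

definition move :: "bool \<times> 'a \<Rightarrow> real \<Rightarrow> bool \<times> 'a" where
  "move z t = (fst z, \<phi> (fst z) t (snd z))"

definition jump :: "bool \<times> 'a \<Rightarrow> real \<Rightarrow> bool \<times> 'a" where
  "jump z t = (\<not> fst z, \<phi> (fst z) t (snd z))"

lemma move_measurable [measurable (raw)]:
  assumes [measurable]: "z \<in> M \<rightarrow>\<^sub>M states" "t \<in> borel_measurable M"
  shows "(\<lambda>x. move (z x) (t x)) \<in> M \<rightarrow>\<^sub>M states"
  unfolding move_def by measurable

lemma jump_measurable [measurable (raw)]:
  assumes [measurable]: "z \<in> M \<rightarrow>\<^sub>M states" "t \<in> borel_measurable M"
  shows "(\<lambda>x. jump (z x) (t x)) \<in> M \<rightarrow>\<^sub>M states"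
  unfolding jump_def by measurable

lemma move_zero [simp]: "move z 0 = z"
  by (simp add: move_def \<phi>_zero)

lemma move_move: "0 \<le> s \<Longrightarrow> 0 \<le> t \<Longrightarrow> move (move z s) t = move z (s + t)"
  by (simp add: move_def \<phi>_add)

lemma jump_move: "0 \<le> s \<Longrightarrow> 0 \<le> t \<Longrightarrow> jump (move z s) t = jump z (s + t)"
  by (simp add: move_def jump_def \<phi>_add)

text \<open>The number n bounds the depth of the recursion over jumps. Primitive recursion makes
  measurability an easy induction; the result for n = 0 is a dummy that is not reached when the
  first n waiting times exceed t.\<close>

primrec traj_fuel :: "nat \<Rightarrow> real \<Rightarrow> bool \<times> 'a \<Rightarrow> (nat \<Rightarrow> real) \<Rightarrow> bool \<times> 'a" where
  "traj_fuel 0 t z w = z"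
| "traj_fuel (Suc n) t z w = (if t < w 0 then move z t else traj_fuel n (t - w 0) (jump z (w 0)) (rest w))"

text \<open>Any depth whose waiting times exceed t gives the same value
  (\<open>traj_fuel_stable\<close>). The least one is a natural number depending on w, so
  measurability follows from a countable case distinction. Sequences without such a depth form a
  null set.\<close>

definition traj :: "real \<Rightarrow> bool \<times> 'a \<Rightarrow> (nat \<Rightarrow> real) \<Rightarrow> bool \<times> 'a" where
  "traj t z w = traj_fuel (LEAST n. t < (\<Sum>k<n. w k)) t z w"

lemma traj_fuel_measurable [measurable (raw)]:
  assumes "t \<in> borel_measurable M" "z \<in> M \<rightarrow>\<^sub>M states" "w \<in> M \<rightarrow>\<^sub>M (\<Pi>\<^sub>M k\<in>UNIV. borel)"
  shows "(\<lambda>x. traj_fuel n (t x) (z x) (w x)) \<in> M \<rightarrow>\<^sub>M states"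
  using assms
proof (induction n arbitrary: t z w)
  case (Suc n)
  note [measurable] = Suc.prems
  have [measurable]: "(\<lambda>x. traj_fuel n (t x - w x 0) (jump (z x) (w x 0)) (rest (w x))) \<in> M \<rightarrow>\<^sub>M states"
    by (rule Suc.IH) measurable
  show ?case by simp
qed simp

lemma traj_measurable [measurable (raw)]:
  assumes [measurable]: "t \<in> borel_measurable M" "z \<in> M \<rightarrow>\<^sub>M states" "w \<in> M \<rightarrow>\<^sub>M (\<Pi>\<^sub>M k\<in>UNIV. borel)"
  shows "(\<lambda>x. traj (t x) (z x) (w x)) \<in> M \<rightarrow>\<^sub>M states"
  unfolding traj_def
  by (rule measurable_compose_countable[where f = "\<lambda>n x. traj_fuel n (t x) (z x) (w x)"]) measurable

lemma traj_fuel_stable: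
  "0 \<le> t \<Longrightarrow> t < (\<Sum>k<n. w k) \<Longrightarrow> n \<le> m \<Longrightarrow> traj_fuel m t z w = traj_fuel n t z w"
proof (induction n arbitrary: m t z w)
  case (Suc n)
  then obtain m' where m: "m = Suc m'" "n \<le> m'" by (cases m) auto
  have "t - w 0 < (\<Sum>k<n. rest w k)"
    using Suc.prems(2) by (simp add: sum.lessThan_Suc_shift rest_def del: sum.lessThan_Suc)
  then show ?case
    using Suc.IH[of "t - w 0" "rest w" m'] m by auto
qed simp

lemma traj_eq_fuel:
  assumes "0 \<le> t" "t < (\<Sum>k<n. w k)"
  shows "traj t z w = traj_fuel n t z w"
  unfolding traj_def using assms
  by (intro traj_fuel_stable[symmetric] LeastI[of "\<lambda>n. t < (\<Sum>k<n. w k)"] Least_le) auto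

lemma traj_rec:
  assumes "0 \<le> t" "unbdd w"
  shows "traj t z w = (if t < w 0 then move z t else traj (t - w 0) (jump z (w 0)) (rest w))"
proof -
  obtain m where m: "t < (\<Sum>k<m. w k)" using assms by (auto simp: unbdd_def)
  then obtain n where n: "m = Suc n" using assms by (cases m) auto
  have "t - w 0 < (\<Sum>k<n. rest w k)"
    using m n by (simp add: sum.lessThan_Suc_shift rest_def del: sum.lessThan_Suc)
  then show ?thesis
    using assms m n traj_eq_fuel[of t w m z] traj_eq_fuel[of "t - w 0" "rest w" n] by auto
qed

lemma traj_ball:
  assumes "0 \<le> t" "\<And>k. 0 \<le> w k" "norm (snd z) \<le> r" "R \<le> r"
  shows "norm (snd (traj t z w)) \<le> r"
proof -
  have "norm (snd (traj_fuel n t z w)) \<le> r" for n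
    using assms
    by (induction n arbitrary: t z w) (auto simp: move_def jump_def \<phi>_ball rest_def)
  then show ?thesis by (simp add: traj_def)
qed

text \<open>The transition semigroup acting on nonnegative functions.\<close>

definition P :: "real \<Rightarrow> (bool \<times> 'a \<Rightarrow> ennreal) \<Rightarrow> bool \<times> 'a \<Rightarrow> ennreal" where
  "P t f z = (\<integral>\<^sup>+w. f (traj t z w) \<partial>\<W>)"

lemma P_measurable [measurable (raw)]:
  assumes [measurable]: "f \<in> borel_measurable states" "t \<in> borel_measurable M" "z \<in> M \<rightarrow>\<^sub>M states"
  shows "(\<lambda>x. P (t x) f (z x)) \<in> borel_measurable M"
  unfolding P_def by measurable

lemma P_renewal:
  assumes [measurable]: "f \<in> borel_measurable states" and "0 \<le> t"
  shows "P t f z = (\<integral>\<^sup>+r. (if t < r then f (move z t) else P (t - r) f (jump z r)) \<partial>\<E>)"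
  unfolding P_def using assms(2)
  by (intro renewal[where J = jump and a = "\<lambda>t z. f (move z t)" and u = "\<lambda>t z w. f (traj t z w)"])
     (auto simp: traj_rec)

text \<open>As a function of t, the right-hand side solves the renewal equation whose value without
  a jump is \<open>P s f (move z t)\<close>. On the event that the first jump comes after t,
  memorylessness restarts the process at \<open>move z t\<close>; before t nothing changes.\<close>

lemma P_shift:
  assumes f [measurable]: "f \<in> borel_measurable states" and t: "0 \<le> t" and s: "0 \<le> s"
  shows "(\<integral>\<^sup>+r. (if t < r then P s f (move z t) else P (t - r + s) f (jump z r)) \<partial>\<E>) = P (t + s) f z"
proof -
  let ?h = "\<lambda>r. if t + s < r then f (move z (t + s)) else P (t + s - r) f (jump z r)"
  have [measurable]: "?h \<in> borel_measurable borel" by measurable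
  have "P (t + s) f z = (\<integral>\<^sup>+r. ?h r \<partial>\<E>)"
    using t s by (intro P_renewal f) simp
  also have "\<dots> = (\<integral>\<^sup>+r. ?h r * indicator {t<..} r + ?h r * indicator {..t} r \<partial>\<E>)"
    by (intro nn_integral_cong) (auto simp: indicator_def)
  also have "\<dots> = ennreal (exp (- lam * t)) * (\<integral>\<^sup>+r. ?h (t + r) \<partial>\<E>) + (\<integral>\<^sup>+r. ?h r * indicator {..t} r \<partial>\<E>)"
    by (subst nn_integral_add) (auto simp: memoryless[OF _ t])
  also have "(\<integral>\<^sup>+r. ?h (t + r) \<partial>\<E>) = P s f (move z t)"
  proof -
    have "(\<integral>\<^sup>+r. ?h (t + r) \<partial>\<E>) = (\<integral>\<^sup>+r. (if s < r then f (move (move z t) s) else P (s - r) f (jump (move z t) r)) \<partial>\<E>)"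
      using AE_expm_pos t s
      by (intro nn_integral_cong_AE) (auto elim!: eventually_mono simp: move_move jump_move)
    then show ?thesis using P_renewal[OF f s] by simp
  qed
  also have "(\<integral>\<^sup>+r. ?h r * indicator {..t} r \<partial>\<E>) = (\<integral>\<^sup>+r. P (t - r + s) f (jump z r) * indicator {..t} r \<partial>\<E>)"
    using s by (intro nn_integral_cong) (auto simp: indicator_def algebra_simps)
  also have "ennreal (exp (- lam * t)) * P s f (move z t) + \<dots> =
      (\<integral>\<^sup>+r. (if t < r then P s f (move z t) else P (t - r + s) f (jump z r)) \<partial>\<E>)"
    using t by (subst nn_integral_expm_split) (auto simp: emeasure_expm_gt mult.commute)
  finally show ?thesis ..
qed

text \<open>The left-hand side is the least solution of the renewal equation in t that the
  right-hand side solves by \<open>P_shift\<close>.\<close>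

lemma P_P_le:
  assumes [measurable]: "f \<in> borel_measurable states" and "0 \<le> t" and "0 \<le> s"
  shows "P t (P s f) z \<le> P (t + s) f z"
  unfolding P_def[of t]
  by (rule renewal_minimal[where J = jump and a = "\<lambda>t z. P s f (move z t)" and u = "\<lambda>t z w. P s f (traj t z w)"
        and g = "\<lambda>t z. P (t + s) f z"])
     (use assms in \<open>auto simp: traj_rec P_shift\<close>)

lemma P_one: "P t (\<lambda>_. 1) = (\<lambda>_. 1)"
  by (simp add: P_def fun_eq_iff)

lemma P_add:
  assumes [measurable]: "f \<in> borel_measurable states" "g \<in> borel_measurable states"
  shows "P t (\<lambda>x. f x + g x) z = P t f z + P t g z"
  unfolding P_def by (rule nn_integral_add) measurable

text \<open>Minimality gives one inequality; both sides have total mass \<open>1\<close>.\<close>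

lemma chapman_kolmogorov:
  assumes B [measurable]: "B \<in> sets states" and "0 \<le> t" and "0 \<le> s"
  shows "P t (P s (indicator B)) z = P (t + s) (indicator B) z"
proof (rule antisym)
  let ?C = "indicator (- B) :: bool \<times> 'a \<Rightarrow> ennreal"
  have [measurable]: "- B \<in> sets states"
    using B by (metis Compl_eq_Diff_UNIV sets.compl_sets space_borel space_count_space space_pair_measure UNIV_Times_UNIV)
  have split: "(\<lambda>x. indicator B x + ?C x) = (\<lambda>_. 1)"
    by (auto simp: indicator_def)
  have "P (t + s) (indicator B) z + P (t + s) ?C z = 1"
    by (subst P_add[symmetric]) (auto simp: split P_one)
  also have "\<dots> = P t (P s (indicator B)) z + P t (P s ?C) z"
    by (subst P_add[symmetric], measurable, subst P_add[symmetric]) (auto simp: split P_one)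
  also have "\<dots> \<le> P t (P s (indicator B)) z + P (t + s) ?C z"
    using assms by (intro add_left_mono P_P_le) auto
  finally have "P (t + s) ?C z + P (t + s) (indicator B) z \<le> P (t + s) ?C z + P t (P s (indicator B)) z"
    by (simp add: add.commute)
  moreover have "P (t + s) ?C z \<le> P (t + s) (\<lambda>_. 1) z"
    unfolding P_def by (intro nn_integral_mono) (simp add: indicator_def)
  then have "P (t + s) ?C z < \<top>"
    by (auto simp: P_one intro: order.strict_trans1)
  ultimately show "P (t + s) (indicator B) z \<le> P t (P s (indicator B)) z"
    by (auto simp: ennreal_add_left_cancel_le)
qed (use assms in \<open>auto intro: P_P_le\<close>)

text \<open>The candidate \<open>?g\<close> is the exact transition probability of the symmetric
  two-state chain, with the sign \<open>?\<sigma>\<close> telling whether the start is already i. It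
  solves the renewal equation. Since the bound holds for both indices, it also controls each index
  from below.\<close>

lemma P_index_le:
  assumes "0 \<le> t"
  shows "P t (\<lambda>x. indicator {i} (fst x)) z \<le> ennreal (1 / 2 + 1 / 2 * exp (- 2 * lam * t))"
proof -
  let ?\<sigma> = "\<lambda>z :: bool \<times> 'a. if fst z = i then 1 else - 1 :: real"
  let ?g = "\<lambda>t z. ennreal (1 / 2 + ?\<sigma> z / 2 * exp (- 2 * lam * t))"
  have "P t (\<lambda>x. indicator {i} (fst x)) z \<le> ?g t z"
    unfolding P_def
  proof (rule renewal_minimal[where J = jump and a = "\<lambda>t z. indicator {i} (fst (move z t))"
        and u = "\<lambda>t z w. indicator {i} (fst (traj t z w))" and g = ?g])
    fix t :: real and s :: "bool \<times> 'a" assume t: "0 \<le> t"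
    let ?h = "\<lambda>r. 1 / 2 - ?\<sigma> s / 2 * exp (- 2 * lam * (t - r))"
    let ?H = "\<lambda>r. - exp (- lam * r) / 2 - ?\<sigma> s / 2 * exp (- 2 * lam * t) * exp (lam * r)"
    have \<sigma>: "?\<sigma> s = 1 \<or> ?\<sigma> s = -1" by auto
    have "(\<integral>\<^sup>+r. (if t < r then indicator {i} (fst (move s t)) else ?g (t - r) (jump s r)) \<partial>\<E>)
        = (\<integral>\<^sup>+r. (if t < r then ennreal ((1 + ?\<sigma> s) / 2) else ennreal (?h r)) \<partial>\<E>)"
      by (intro nn_integral_cong) (auto simp: move_def jump_def)
    also have "\<dots> = ennreal ((1 + ?\<sigma> s) / 2 * exp (- lam * t) + (?H t - ?H 0))"
    proof (rule nn_integral_expm_FTC[OF _ t])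
      fix r assume "0 \<le> r" "r \<le> t"
      then show "0 \<le> ?h r"
        using lam_pos by (auto intro: order_trans[of "-1" 0])
      have "exp (- 2 * lam * t) * exp (lam * r) = exp (- lam * r) * exp (- 2 * lam * (t - r))"
        by (simp add: exp_add[symmetric] algebra_simps)
      then show "(?H has_real_derivative lam * exp (- lam * r) * ?h r) (at r)"
        by (auto intro!: derivative_eq_intros simp: algebra_simps)
    qed auto
    also have "(1 + ?\<sigma> s) / 2 * exp (- lam * t) + (?H t - ?H 0) = 1 / 2 + ?\<sigma> s / 2 * exp (- 2 * lam * t)"
      using exp_add[of "- 2 * lam * t" "lam * t"] by (simp add: field_simps)
    finally show "(\<integral>\<^sup>+r. (if t < r then indicator {i} (fst (move s t)) else ?g (t - r) (jump s r)) \<partial>\<E>) \<le> ?g t s"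
      by simp
  next
    fix t and z :: "bool \<times> 'a"
    have "(\<lambda>w. fst (traj t z w)) \<in> \<W> \<rightarrow>\<^sub>M count_space UNIV"
      by (rule measurable_compose[OF _ measurable_fst]) measurable
    then show "(\<lambda>w. indicator {i} (fst (traj t z w)) :: ennreal) \<in> borel_measurable \<W>"
      by (rule measurable_compose) simp
  qed (use assms in \<open>auto simp: traj_rec\<close>)
  also have "\<dots> \<le> ennreal (1 / 2 + 1 / 2 * exp (- 2 * lam * t))"
    by (intro ennreal_leI) auto
  finally show ?thesis .
qed

text \<open>Put k = \<open>\<kappa> * p\<close> and give state \<open>True\<close> the weight 1 + k
  / (2 lam), state \<open>False\<close> the weight 1. This value c is the one for which (1 + k / (2
  lam)) (lam - c) = lam, so the one-step inequality in state \<open>True\<close> is an equality; the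
  inequality in state \<open>False\<close> needs only c at most k / 2.\<close>

definition rate :: "real \<Rightarrow> real" where
  "rate p = lam * (\<kappa> * p) / (2 * lam + \<kappa> * p)"

lemma rate_pos: "0 < p \<Longrightarrow> 0 < rate p"
  using lam_pos \<kappa>_pos by (simp add: rate_def add_pos_pos)

text \<open>Synchronous coupling: both trajectories use the same index and the same waiting times. A
  unit weight would not give decay, since nothing is gained while the index is \<open>True\<close>;
  there a larger weight accounts for the wait until contraction begins.\<close>

lemma traj_contract:
  assumes p: "0 < p" and t: "0 \<le> t"
  shows "(\<integral>\<^sup>+w. ennreal (norm (snd (traj t (j, x) w) - snd (traj t (j, y) w)) powr p) \<partial>\<W>)
    \<le> ennreal ((1 + \<kappa> * p / (2 * lam)) * exp (- rate p * t) * norm (x - y) powr p)"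
proof -
  define k where "k = \<kappa> * p"
  define c where "c = rate p"
  define C where "C j = (if j then 1 + k / (2 * lam) else 1)" for j
  have k: "0 < k" using p \<kappa>_pos by (simp add: k_def)
  have c: "c = lam * k / (2 * lam + k)" "0 < c"
    using rate_pos[OF p] by (auto simp: c_def rate_def k_def)
  have c_lam: "c < lam" using lam_pos k by (simp add: c divide_less_eq add_pos_pos)
  let ?k = "\<lambda>j. if j then 0 else k"
  have C_ge: "1 \<le> C j" for j using k lam_pos by (simp add: C_def)
  \<comment> \<open>The one-step condition of \<open>nn_integral_expm_exp_le\<close> in both states:
    the next weight times lam against the current weight times the available rate.\<close>
  have C: "lam * C (\<not> j) \<le> C j * (lam + ?k j - c)" for j
  proof (cases j)
    case True
    have "lam - c = 2 * lam * lam / (2 * lam + k)"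
      using k lam_pos by (simp add: c divide_simps) (simp add: algebra_simps)
    moreover have "1 + k / (2 * lam) = (2 * lam + k) / (2 * lam)"
      using lam_pos by (simp add: add_divide_distrib)
    ultimately have "(1 + k / (2 * lam)) * (lam - c) = lam"
      using k lam_pos by simp
    with True show ?thesis by (simp add: C_def)
  next
    case False
    have "c \<le> k / 2" using k lam_pos by (simp add: c field_simps)
    then show ?thesis using False k lam_pos by (simp add: C_def field_simps)
  qed
  let ?u = "\<lambda>t (j, x, y) w. ennreal (norm (snd (traj t (j, x) w) - snd (traj t (j, y) w)) powr p)"
  let ?g = "\<lambda>t (j, x, y). ennreal (C j * exp (- c * t) * norm (x - y) powr p)"
  have contr: "norm (\<phi> j r x - \<phi> j r y) powr p \<le> exp (- ?k j * r) * norm (x - y) powr p" if "0 \<le> r" for j r x y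
  proof -
    have "norm (\<phi> j r x - \<phi> j r y) powr p \<le> (exp (- (if j then 0 else \<kappa>) * r) * norm (x - y)) powr p"
      using p by (intro powr_mono2 \<phi>_contract that) auto
    also have "\<dots> = exp (- ?k j * r) * norm (x - y) powr p"
      by (auto simp: powr_mult exp_powr_real k_def mult_ac)
    finally show ?thesis .
  qed
  have "(\<integral>\<^sup>+w. ?u t (j, x, y) w \<partial>\<W>) \<le> ?g t (j, x, y)"
  \<comment> \<open>The state is a triple: one common index and the two positions.\<close>
  proof (rule renewal_minimal[where J = "\<lambda>(j, x, y) r. (\<not> j, \<phi> j r x, \<phi> j r y)"
        and a = "\<lambda>t (j, x, y). ennreal (norm (\<phi> j t x - \<phi> j t y) powr p)", OF _ _ _ t])
    show "?u t s \<in> borel_measurable \<W>" for t s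
      by (cases s) (auto simp: split_def)
    show "?u t s w = (if t < w 0 then (\<lambda>(j, x, y). ennreal (norm (\<phi> j t x - \<phi> j t y) powr p)) s
       else ?u (t - w 0) ((\<lambda>(j, x, y) r. (\<not> j, \<phi> j r x, \<phi> j r y)) s (w 0)) (rest w))" if "0 \<le> t" "unbdd w" for t s w
      using that by (cases s) (auto simp: traj_rec move_def jump_def)
    fix t :: real and s :: "bool \<times> 'a \<times> 'a" assume t: "0 \<le> t"
    obtain j x y where s: "s = (j, x, y)" by (cases s)
    let ?N = "ennreal (norm (x - y) powr p)"
    have "(\<integral>\<^sup>+r. (if t < r then ennreal (norm (\<phi> j t x - \<phi> j t y) powr p) else ?g (t - r) (\<not> j, \<phi> j r x, \<phi> j r y)) \<partial>\<E>)
      \<le> (\<integral>\<^sup>+r. ?N * (if t < r then ennreal (exp (- ?k j * t)) else ennreal (C (\<not> j) * exp (- c * (t - r)) * exp (- ?k j * r))) \<partial>\<E>)"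
      using AE_expm_pos
    proof (intro nn_integral_mono_AE, eventually_elim)
      case (elim r)
      have "C (\<not> j) * exp (- c * (t - r)) * norm (\<phi> j r x - \<phi> j r y) powr p
          \<le> C (\<not> j) * exp (- c * (t - r)) * (exp (- ?k j * r) * norm (x - y) powr p)"
        using elim C_ge[of "\<not> j"] by (intro mult_left_mono contr) auto
      then show ?case
        using contr[OF t, of j x y] C_ge[of "\<not> j"]
        by (auto simp: ennreal_mult[symmetric] mult_ac intro!: ennreal_leI)
    qed
    also have "\<dots> = ?N * (\<integral>\<^sup>+r. (if t < r then ennreal (exp (- ?k j * t)) else ennreal (C (\<not> j) * exp (- c * (t - r)) * exp (- ?k j * r))) \<partial>\<E>)"
      by (rule nn_integral_cmult) measurable
    also have "\<dots> \<le> ?N * ennreal (C j * exp (- c * t))"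
      using k c c_lam C[of j] C_ge[of j] C_ge[of "\<not> j"]
      by (intro mult_left_mono nn_integral_expm_exp_le t) auto
    also have "\<dots> = ?g t s"
      using C_ge[of j] by (simp add: s ennreal_mult[symmetric] mult_ac)
    finally have "(\<integral>\<^sup>+r. (if t < r then ennreal (norm (\<phi> j t x - \<phi> j t y) powr p) else ?g (t - r) (\<not> j, \<phi> j r x, \<phi> j r y)) \<partial>\<E>) \<le> ?g t s" .
    then show "(\<integral>\<^sup>+r. (if t < r then (\<lambda>(j, x, y). ennreal (norm (\<phi> j t x - \<phi> j t y) powr p)) s
        else ?g (t - r) ((\<lambda>(j, x, y) r. (\<not> j, \<phi> j r x, \<phi> j r y)) s r)) \<partial>\<E>) \<le> ?g t s"
      unfolding s prod.case .
  qed
  also have "C j \<le> 1 + k / (2 * lam)"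
    using k lam_pos by (simp add: C_def)
  then have "?g t (j, x, y) \<le> ennreal ((1 + k / (2 * lam)) * exp (- c * t) * norm (x - y) powr p)"
    by (auto intro!: ennreal_leI mult_right_mono)
  finally show ?thesis by (simp add: k_def c_def)
qed

end

section \<open>The stationary law\<close>

context switched_flow
begin

text \<open>Time is read backwards: \<open>w 0\<close> is the most recent waiting time and j the
  index during it. A further waiting time is inserted innermost, in the remote past, which is why
  these compositions converge along almost every w, and not only in law.\<close>

primrec pull :: "nat \<Rightarrow> bool \<Rightarrow> (nat \<Rightarrow> real) \<Rightarrow> 'a" where
  "pull 0 j w = 0"
| "pull (Suc n) j w = \<phi> j (w 0) (pull n (\<not> j) (rest w))"

definition pull_lim :: "bool \<Rightarrow> (nat \<Rightarrow> real) \<Rightarrow> 'a" where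
  "pull_lim j w = lim (\<lambda>n. pull n j w)"

lemma pull_measurable [measurable (raw)]:
  assumes "w \<in> M \<rightarrow>\<^sub>M (\<Pi>\<^sub>M k\<in>UNIV. borel)"
  shows "(\<lambda>x. pull n j (w x)) \<in> borel_measurable M"
  using assms
proof (induction n arbitrary: j w)
  case (Suc n)
  note [measurable] = Suc.prems
  have [measurable]: "(\<lambda>x. pull n (\<not> j) (rest (w x))) \<in> borel_measurable M"
    by (rule Suc.IH) measurable
  show ?case by simp
qed simp

lemma pull_lim_measurable [measurable (raw)]:
  assumes [measurable]: "j \<in> M \<rightarrow>\<^sub>M count_space UNIV" "w \<in> M \<rightarrow>\<^sub>M (\<Pi>\<^sub>M k\<in>UNIV. borel)"
  shows "(\<lambda>x. pull_lim (j x) (w x)) \<in> borel_measurable M"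
proof -
  have [measurable]: "(\<lambda>x. pull_lim i (w x)) \<in> borel_measurable M" for i
    unfolding pull_lim_def by (intro borel_measurable_lim_metric) measurable
  show ?thesis
    by (rule measurable_compose_countable[where f = "\<lambda>i x. pull_lim i (w x)"]) measurable
qed

lemma pull_ball:
  assumes "\<And>k. 0 \<le> w k"
  shows "norm (pull n j w) \<le> R"
  using assms
proof (induction n arbitrary: j w)
  case (Suc n)
  have "norm (pull n (\<not> j) (rest w)) \<le> R"
    by (rule Suc.IH) (simp add: rest_def Suc.prems)
  then show ?case
    using Suc.prems by (simp add: \<phi>_ball)
qed (simp add: R_nonneg)

text \<open>The two compositions share their n outer flows. Innermost they compare 0 with a point of
  norm at most R, and each outer flow with index \<open>False\<close>, that is, each k with
  \<open>j = odd k\<close>, contracts by its waiting time.\<close>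

lemma pull_dist:
  assumes "\<And>k. 0 \<le> w k"
  shows "norm (pull (n + m) j w - pull n j w) \<le> exp (- \<kappa> * (\<Sum>k\<in>{k. j = odd k} \<inter> {..<n}. w k)) * R"
  using assms
proof (induction n arbitrary: j w)
  case 0
  then show ?case using pull_ball[of w m j] by simp
next
  case (Suc n)
  let ?K = "\<lambda>j n. {k. j = odd k} \<inter> {..<n}"
  have split: "?K j (Suc n) = (if j then {} else {0}) \<union> Suc ` ?K (\<not> j) n"
    by (auto simp: lessThan_Suc_eq_insert_0)
  have sum: "(\<Sum>k\<in>?K j (Suc n). w k) = (if j then 0 else w 0) + (\<Sum>k\<in>?K (\<not> j) n. rest w k)"
    unfolding split by (subst sum.union_disjoint) (auto simp: sum.reindex rest_def)
  have "norm (pull (Suc n + m) j w - pull (Suc n) j w)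
      \<le> exp (- (if j then 0 else \<kappa>) * w 0) * norm (pull (n + m) (\<not> j) (rest w) - pull n (\<not> j) (rest w))"
    using \<phi>_contract[OF Suc.prems[of 0], of j] by simp
  also have "\<dots> \<le> exp (- (if j then 0 else \<kappa>) * w 0) * (exp (- \<kappa> * (\<Sum>k\<in>?K (\<not> j) n. rest w k)) * R)"
    by (intro mult_left_mono Suc.IH) (auto simp: rest_def Suc.prems)
  also have "\<dots> = exp (- \<kappa> * (\<Sum>k\<in>?K j (Suc n). w k)) * R"
    unfolding sum mult.assoc[symmetric] exp_add[symmetric] by (auto simp: algebra_simps)
  finally show ?case .
qed

lemma pull_convergent:
  assumes w: "\<And>k. 0 \<le> w k" and unb: "\<forall>t. \<exists>n. t < (\<Sum>k\<in>{k. j = odd k} \<inter> {..<n}. w k)"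
  shows "convergent (\<lambda>n. pull n j w)"
proof -
  have "Cauchy (\<lambda>n. pull n j w)"
    unfolding Cauchy_altdef
  proof (intro allI impI)
    fix e :: real assume e: "0 < e"
    define \<delta> where "\<delta> = e / (2 * (R + 1))"
    have \<delta>: "0 < \<delta>" using e R_nonneg by (simp add: \<delta>_def)
    obtain n where n: "- ln \<delta> / \<kappa> < (\<Sum>k\<in>{k. j = odd k} \<inter> {..<n}. w k)"
      using unb by blast
    have "exp (- \<kappa> * (\<Sum>k\<in>{k. j = odd k} \<inter> {..<n}. w k)) \<le> exp (ln \<delta>)"
      using n \<kappa>_pos by (subst exp_le_cancel_iff) (simp add: field_simps)
    then have d: "norm (pull m j w - pull n j w) \<le> \<delta> * R" if "n \<le> m" for m
      using pull_dist[of w n "m - n" j] w that R_nonneg \<delta>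
        mult_right_mono[of "exp (- \<kappa> * (\<Sum>k\<in>{k. j = odd k} \<inter> {..<n}. w k))" \<delta> R] by simp
    have "\<delta> * R < e / 2"
      using e R_nonneg by (simp add: \<delta>_def field_simps)
    then have "dist (pull m j w) (pull m' j w) < e" if "n \<le> m" "m < m'" for m m'
      using d[of m] d[of m'] that dist_triangle2[of "pull m j w" "pull m' j w" "pull n j w"]
      by (simp add: dist_norm)
    then show "\<exists>M. \<forall>m\<ge>M. \<forall>n>m. dist (pull m j w) (pull n j w) < e"
      by blast
  qed
  then show ?thesis by (simp add: Cauchy_convergent_iff)
qed

lemma infinite_parity: "infinite {k :: nat. j = odd k}"
proof (cases j)
  case True
  have "range (\<lambda>k. 2 * k + 1) \<subseteq> {k :: nat. odd k}" by auto
  moreover have "infinite (range (\<lambda>k :: nat. 2 * k + 1))"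
    by (rule range_inj_infinite) (auto simp: inj_on_def)
  ultimately show ?thesis using True by (auto dest: finite_subset)
next
  case False
  have "range (\<lambda>k. 2 * k) \<subseteq> {k :: nat. even k}" by auto
  moreover have "infinite (range (\<lambda>k :: nat. 2 * k))"
    by (rule range_inj_infinite) (auto simp: inj_on_def)
  ultimately show ?thesis using False by (auto dest: finite_subset)
qed

lemma AE_pull_convergent: "AE w in \<W>. convergent (\<lambda>n. pull n j w)"
  using AE_waits_pos AE_sum_unbounded[OF infinite_parity[of j]]
  by eventually_elim (auto intro!: pull_convergent simp: less_imp_le)

lemma AE_pull_lim_ball: "AE w in \<W>. norm (pull_lim j w) \<le> R"
  using AE_waits_pos AE_pull_convergent[of j]
proof eventually_elim
  case (elim w)
  then have "(\<lambda>n. norm (pull n j w)) \<longlonglongrightarrow> norm (pull_lim j w)"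
    by (intro tendsto_norm) (simp add: pull_lim_def convergent_LIMSEQ_iff)
  then show ?case
    by (rule LIMSEQ_le_const2) (use elim pull_ball in \<open>auto simp: less_imp_le\<close>)
qed

text \<open>Continuity of the outermost flow lets the recursion of \<open>pull\<close> pass to the
  limit. This random fixed-point equation is the source of all invariance statements about
  \<open>stat\<close>.\<close>

lemma AE_pull_lim_rec: "AE w in \<W>. pull_lim j w = \<phi> j (w 0) (pull_lim (\<not> j) (rest w))"
  using AE_rest[OF AE_pull_convergent[of "\<not> j"]]
proof eventually_elim
  case (elim w)
  then have lim: "(\<lambda>n. pull n (\<not> j) (rest w)) \<longlonglongrightarrow> pull_lim (\<not> j) (rest w)"
    by (simp add: pull_lim_def convergent_LIMSEQ_iff)
  have "continuous_on UNIV ((\<lambda>(t, x). \<phi> j t x) \<circ> (\<lambda>x. (w 0, x)))"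
    by (intro continuous_on_compose continuous_intros continuous_on_subset[OF \<phi>_cont]) auto
  then have "isCont (\<lambda>x. \<phi> j (w 0) x) x" for x
    by (simp add: o_def continuous_on_eq_continuous_at)
  then have "(\<lambda>n. pull (Suc n) j w) \<longlonglongrightarrow> \<phi> j (w 0) (pull_lim (\<not> j) (rest w))"
    using isCont_tendsto_compose[of _ "\<phi> j (w 0)", OF _ lim] by simp
  then show ?case
    unfolding pull_lim_def by (intro limI) (rule LIMSEQ_imp_Suc)
qed

text \<open>The law of the state just before a jump of the stationary process.\<close>

definition stat :: "(bool \<times> 'a) measure" where
  "stat = distr (measure_pmf (bernoulli_pmf (1 / 2)) \<Otimes>\<^sub>M \<W>) states (\<lambda>(j, w). (j, pull_lim j w))"

lemma sets_stat [simp, measurable_cong]: "sets stat = sets states"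
  by (simp add: stat_def)

lemma space_stat [simp]: "space stat = UNIV"
  using sets_eq_imp_space_eq[OF sets_stat] by simp

lemma nn_integral_stat:
  assumes [measurable]: "f \<in> borel_measurable states"
  shows "(\<integral>\<^sup>+z. f z \<partial>stat) =
    ennreal (1 / 2) * (\<integral>\<^sup>+w. f (True, pull_lim True w) \<partial>\<W>) +
    ennreal (1 / 2) * (\<integral>\<^sup>+w. f (False, pull_lim False w) \<partial>\<W>)"
proof -
  have "(\<integral>\<^sup>+z. f z \<partial>stat) = (\<integral>\<^sup>+x. f (fst x, pull_lim (fst x) (snd x)) \<partial>(measure_pmf (bernoulli_pmf (1 / 2)) \<Otimes>\<^sub>M \<W>))"
    unfolding stat_def by (subst nn_integral_distr) (auto simp: split_def)
  also have "\<dots> = (\<integral>\<^sup>+j. \<integral>\<^sup>+w. f (j, pull_lim j w) \<partial>\<W> \<partial>measure_pmf (bernoulli_pmf (1 / 2)))"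
    by (subst PW.nn_integral_fst[symmetric]) auto
  finally show ?thesis
    by (simp add: mult.commute)
qed

text \<open>Leads from the state just before a jump to the state right after it; the position does
  not change.\<close>

definition flip :: "bool \<times> 'a \<Rightarrow> bool \<times> 'a" where
  "flip z = (\<not> fst z, snd z)"

lemma flip_measurable [measurable]: "flip \<in> states \<rightarrow>\<^sub>M states"
  unfolding flip_def by measurable

text \<open>From the state after a jump, flowing for a fresh exponential time leads to the state
  before the next jump. On the sequence space this is the fixed-point equation of
  \<open>pull_lim\<close>, with the first waiting time integrated out; the fair index is preserved
  by flipping.\<close>

lemma nn_integral_stat_move:
  assumes f [measurable]: "f \<in> borel_measurable states"
  shows "(\<integral>\<^sup>+z. \<integral>\<^sup>+r. f (move (flip z) r) \<partial>\<E> \<partial>stat) = (\<integral>\<^sup>+z. f z \<partial>stat)"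
proof -
  have *: "(\<integral>\<^sup>+w. \<integral>\<^sup>+r. f (move (flip (\<not> j, pull_lim (\<not> j) w)) r) \<partial>\<E> \<partial>\<W>) = (\<integral>\<^sup>+w. f (j, pull_lim j w) \<partial>\<W>)" for j
  proof -
    have "(\<integral>\<^sup>+w. f (j, pull_lim j w) \<partial>\<W>) = (\<integral>\<^sup>+w. f (j, \<phi> j (w 0) (pull_lim (\<not> j) (rest w))) \<partial>\<W>)"
      using AE_pull_lim_rec[of j] by (intro nn_integral_cong_AE) (auto elim!: eventually_mono)
    also have "\<dots> = (\<integral>\<^sup>+r. \<integral>\<^sup>+w. f (j, \<phi> j r (pull_lim (\<not> j) w)) \<partial>\<W> \<partial>\<E>)"
      by (subst nn_integral_waits) auto
    also have "\<dots> = (\<integral>\<^sup>+w. \<integral>\<^sup>+r. f (j, \<phi> j r (pull_lim (\<not> j) w)) \<partial>\<E> \<partial>\<W>)"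
      by (rule pair_sigma_finite.Fubini') (auto intro: pair_sigma_finite.intro PW.sigma_finite_measure_axioms E.sigma_finite_measure_axioms)
    finally show ?thesis by (simp add: move_def flip_def)
  qed
  show ?thesis
    using *[of True] *[of False] by (subst (1 2) nn_integral_stat) (auto simp: add.commute)
qed

text \<open>The law of the flipped stationary state is invariant for the embedded chain of states
  right after the jumps.\<close>

lemma nn_integral_stat_jump:
  assumes f [measurable]: "f \<in> borel_measurable states"
  shows "(\<integral>\<^sup>+z. \<integral>\<^sup>+r. f (jump (flip z) r) \<partial>\<E> \<partial>stat) = (\<integral>\<^sup>+z. f (flip z) \<partial>stat)"
  using nn_integral_stat_move[of "\<lambda>z. f (flip z)"] by (simp add: jump_def move_def flip_def)

lemma prob_space_stat: "prob_space stat"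
  unfolding stat_def
  by (intro prob_space.prob_space_distr prob_space_pair PW.prob_space_axioms measure_pmf.prob_space_axioms) measurable

lemma indicator_interval_measurable [measurable (raw)]:
  fixes a b :: "'b \<Rightarrow> real"
  assumes [measurable]: "a \<in> borel_measurable M" "b \<in> borel_measurable M"
  shows "(\<lambda>x. indicator {..a x} (b x) :: ennreal) \<in> borel_measurable M"
    and "(\<lambda>x. indicator {a x<..} (b x) :: ennreal) \<in> borel_measurable M"
proof -
  have "(\<lambda>x. if b x \<le> a x then 1 else 0 :: ennreal) \<in> borel_measurable M"
    "(\<lambda>x. if a x < b x then 1 else 0 :: ennreal) \<in> borel_measurable M"
    by measurable
  then show "(\<lambda>x. indicator {..a x} (b x) :: ennreal) \<in> borel_measurable M"
    "(\<lambda>x. indicator {a x<..} (b x) :: ennreal) \<in> borel_measurable M"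
    by (simp_all add: indicator_def of_bool_def)
qed

text \<open>When \<open>z\<close> is distributed like the stationary state after a jump, so is \<open>jump z q\<close>. Then the two
  integrals over \<open>{0..t}\<close> agree, and what is left is the invariance.\<close>

lemma P_move_balance:
  assumes f [measurable]: "f \<in> borel_measurable states" and t: "0 \<le> t"
  shows "(\<integral>\<^sup>+q. P t f (move z q) \<partial>\<E>) + (\<integral>\<^sup>+v. lam * P v f z * indicator {0..t} v \<partial>lborel)
    = (\<integral>\<^sup>+q. f (move z q) \<partial>\<E>) + (\<integral>\<^sup>+u. lam * (\<integral>\<^sup>+q. P u f (jump z q) \<partial>\<E>) * indicator {0..t} u \<partial>lborel)"
proof -
  have pair: "pair_sigma_finite \<E> (lborel :: real measure)" "pair_sigma_finite \<E> \<E>"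
    by (auto intro: pair_sigma_finite.intro E.sigma_finite_measure_axioms sigma_finite_lborel)
  let ?Q = "\<lambda>u q. P u f (jump z q)"
  \<comment> \<open>Renewal at the first jump after the initial stretch q. Memorylessness merges q
    with the elapsed time r: the total q + r, weighted by the density at r, becomes an exponential
    time restricted to values above r.\<close>
  have A: "(\<integral>\<^sup>+q. P t f (move z q) \<partial>\<E>) = (\<integral>\<^sup>+q. f (move z q) * indicator {t<..} q \<partial>\<E>)
      + (\<integral>\<^sup>+r. lam * (\<integral>\<^sup>+q. ?Q (t - r) q * indicator {r<..} q \<partial>\<E>) * indicator {0..t} r \<partial>lborel)"
  proof -
    have "(\<integral>\<^sup>+q. P t f (move z q) \<partial>\<E>)
        = (\<integral>\<^sup>+q. ennreal (exp (- lam * t)) * f (move z (t + q)) + (\<integral>\<^sup>+r. ?Q (t - r) (r + q) * indicator {..t} r \<partial>\<E>) \<partial>\<E>)"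
    proof (rule nn_integral_cong_AE, use AE_expm_pos in eventually_elim)
      fix q :: real assume q: "0 < q"
      have "P t f (move z q) = f (move (move z q) t) * emeasure \<E> {t<..} + (\<integral>\<^sup>+r. P (t - r) f (jump (move z q) r) * indicator {..t} r \<partial>\<E>)"
        by (subst P_renewal[OF f t], subst nn_integral_expm_split) auto
      also have "(\<integral>\<^sup>+r. P (t - r) f (jump (move z q) r) * indicator {..t} r \<partial>\<E>) = (\<integral>\<^sup>+r. ?Q (t - r) (r + q) * indicator {..t} r \<partial>\<E>)"
        using AE_expm_pos q by (intro nn_integral_cong_AE) (auto elim!: eventually_mono simp: jump_move add.commute)
      finally show "P t f (move z q) = ennreal (exp (- lam * t)) * f (move z (t + q)) + (\<integral>\<^sup>+r. ?Q (t - r) (r + q) * indicator {..t} r \<partial>\<E>)"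
        using t q by (simp add: emeasure_expm_gt move_move mult.commute add.commute)
    qed
    also have "\<dots> = (\<integral>\<^sup>+q. f (move z q) * indicator {t<..} q \<partial>\<E>) + (\<integral>\<^sup>+q. \<integral>\<^sup>+r. ?Q (t - r) (r + q) * indicator {..t} r \<partial>\<E> \<partial>\<E>)"
      by (subst nn_integral_add) (auto simp: memoryless t nn_integral_cmult)
    also have "(\<integral>\<^sup>+q. \<integral>\<^sup>+r. ?Q (t - r) (r + q) * indicator {..t} r \<partial>\<E> \<partial>\<E>) = (\<integral>\<^sup>+r. \<integral>\<^sup>+q. ?Q (t - r) (r + q) * indicator {..t} r \<partial>\<E> \<partial>\<E>)"
      by (rule pair_sigma_finite.Fubini'[OF pair(2)]) measurable
    also have "\<dots> = (\<integral>\<^sup>+r. (\<integral>\<^sup>+q. ?Q (t - r) (r + q) \<partial>\<E>) * indicator {..t} r \<partial>\<E>)"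
      by (intro nn_integral_cong nn_integral_multc) measurable
    also have "\<dots> = (\<integral>\<^sup>+r. ennreal (lam * exp (- lam * r)) * ((\<integral>\<^sup>+q. ?Q (t - r) (r + q) \<partial>\<E>) * indicator {..t} r) * indicator {0..} r \<partial>lborel)"
      by (rule nn_integral_expm) measurable
    also have "\<dots> = (\<integral>\<^sup>+r. lam * (\<integral>\<^sup>+q. ?Q (t - r) q * indicator {r<..} q \<partial>\<E>) * indicator {0..t} r \<partial>lborel)"
    proof (rule nn_integral_cong)
      fix r
      have "(\<integral>\<^sup>+q. ?Q (t - r) q * indicator {r<..} q \<partial>\<E>) = ennreal (exp (- lam * r)) * (\<integral>\<^sup>+q. ?Q (t - r) (r + q) \<partial>\<E>)" if "0 \<le> r"
        using that by (intro memoryless) measurable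
      then show "ennreal (lam * exp (- lam * r)) * ((\<integral>\<^sup>+q. ?Q (t - r) (r + q) \<partial>\<E>) * indicator {..t} r) * indicator {0..} r
          = lam * (\<integral>\<^sup>+q. ?Q (t - r) q * indicator {r<..} q \<partial>\<E>) * indicator {0..t} r"
        using lam_pos by (cases "0 \<le> r"; cases "r \<le> t") (simp_all add: ennreal_mult mult_ac)
    qed
    finally show ?thesis .
  qed
  \<comment> \<open>Renewal for a start at z, integrated over the horizon v. The density
    \<open>lam * exp (- lam * v)\<close> of the event without a jump turns the first term into an
    integral over an exponential time restricted to \<open>{..t}\<close>.\<close>
  have C: "(\<integral>\<^sup>+v. lam * P v f z * indicator {0..t} v \<partial>lborel) = (\<integral>\<^sup>+q. f (move z q) * indicator {..t} q \<partial>\<E>)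
      + (\<integral>\<^sup>+v. lam * (\<integral>\<^sup>+q. ?Q (v - q) q * indicator {..v} q \<partial>\<E>) * indicator {0..t} v \<partial>lborel)"
  proof -
    have "(\<integral>\<^sup>+v. lam * P v f z * indicator {0..t} v \<partial>lborel)
      = (\<integral>\<^sup>+v. ennreal (lam * exp (- lam * v)) * (f (move z v) * indicator {..t} v) * indicator {0..} v
          + lam * (\<integral>\<^sup>+q. ?Q (v - q) q * indicator {..v} q \<partial>\<E>) * indicator {0..t} v \<partial>lborel)"
    proof (rule nn_integral_cong)
      fix v
      show "lam * P v f z * indicator {0..t} v = ennreal (lam * exp (- lam * v)) * (f (move z v) * indicator {..t} v) * indicator {0..} v
          + lam * (\<integral>\<^sup>+q. ?Q (v - q) q * indicator {..v} q \<partial>\<E>) * indicator {0..t} v"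
      proof (cases "0 \<le> v \<and> v \<le> t")
        case True
        then have "P v f z = f (move z v) * ennreal (exp (- lam * v)) + (\<integral>\<^sup>+q. ?Q (v - q) q * indicator {..v} q \<partial>\<E>)"
          by (subst P_renewal[OF f], simp, subst nn_integral_expm_split) (auto simp: emeasure_expm_gt)
        then show ?thesis
          using True lam_pos by (simp add: ennreal_mult distrib_left mult_ac)
      qed (auto simp: indicator_def)
    qed
    also have "\<dots> = (\<integral>\<^sup>+v. ennreal (lam * exp (- lam * v)) * (f (move z v) * indicator {..t} v) * indicator {0..} v \<partial>lborel)
        + (\<integral>\<^sup>+v. lam * (\<integral>\<^sup>+q. ?Q (v - q) q * indicator {..v} q \<partial>\<E>) * indicator {0..t} v \<partial>lborel)"
      by (rule nn_integral_add) measurable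
    also have "(\<integral>\<^sup>+v. ennreal (lam * exp (- lam * v)) * (f (move z v) * indicator {..t} v) * indicator {0..} v \<partial>lborel)
        = (\<integral>\<^sup>+v. f (move z v) * indicator {..t} v \<partial>\<E>)"
      by (rule nn_integral_expm[symmetric]) measurable
    finally show ?thesis .
  qed
  have swap: "(\<integral>\<^sup>+v. lam * (\<integral>\<^sup>+q. g v q \<partial>\<E>) * indicator {0..t} v \<partial>lborel)
      = (\<integral>\<^sup>+q. lam * (\<integral>\<^sup>+v. g v q * indicator {0..t} v \<partial>lborel) \<partial>\<E>)"
    if [measurable]: "(\<lambda>(v, q). g v q) \<in> borel_measurable (borel \<Otimes>\<^sub>M borel)" for g
  proof -
    have "(\<integral>\<^sup>+v. lam * (\<integral>\<^sup>+q. g v q \<partial>\<E>) * indicator {0..t} v \<partial>lborel)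
        = (\<integral>\<^sup>+v. \<integral>\<^sup>+q. lam * (g v q * indicator {0..t} v) \<partial>\<E> \<partial>lborel)"
      by (intro nn_integral_cong) (simp add: nn_integral_cmult nn_integral_multc mult.assoc)
    also have "\<dots> = (\<integral>\<^sup>+q. \<integral>\<^sup>+v. lam * (g v q * indicator {0..t} v) \<partial>lborel \<partial>\<E>)"
      by (rule pair_sigma_finite.Fubini'[OF pair(1)]) measurable
    finally show ?thesis
      by (simp add: nn_integral_cmult)
  qed
  \<comment> \<open>For a fixed jump time q the substitutions u = t - v and u = v - q carry the two
    integrals to the parts of \<open>{0..t}\<close> above and below t - q, which together give the
    whole interval.\<close>
  have key: "(\<integral>\<^sup>+v. ?Q (t - v) q * indicator {v<..} q * indicator {0..t} v \<partial>lborel)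
      + (\<integral>\<^sup>+v. ?Q (v - q) q * indicator {..v} q * indicator {0..t} v \<partial>lborel)
      = (\<integral>\<^sup>+u. ?Q u q * indicator {0..t} u \<partial>lborel)" if q: "0 < q" for q
  proof -
    have "(\<integral>\<^sup>+v. ?Q (t - v) q * indicator {v<..} q * indicator {0..t} v \<partial>lborel)
        = (\<integral>\<^sup>+u. ?Q (t - (t - u)) q * indicator {t - u<..} q * indicator {0..t} (t - u) \<partial>lborel)"
      using nn_integral_real_affine[of "\<lambda>v. ?Q (t - v) q * indicator {v<..} q * indicator {0..t} v" "- 1" t]
      by simp
    also have "\<dots> = (\<integral>\<^sup>+u. ?Q u q * indicator ({0..t} \<inter> {t - q<..}) u \<partial>lborel)"
      by (intro nn_integral_cong) (auto simp: indicator_def)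
    finally have 1: "(\<integral>\<^sup>+v. ?Q (t - v) q * indicator {v<..} q * indicator {0..t} v \<partial>lborel)
      = (\<integral>\<^sup>+u. ?Q u q * indicator ({0..t} \<inter> {t - q<..}) u \<partial>lborel)" .
    have "(\<integral>\<^sup>+v. ?Q (v - q) q * indicator {..v} q * indicator {0..t} v \<partial>lborel)
        = (\<integral>\<^sup>+u. ?Q (q + u - q) q * indicator {..q + u} q * indicator {0..t} (q + u) \<partial>lborel)"
      using nn_integral_real_affine[of "\<lambda>v. ?Q (v - q) q * indicator {..v} q * indicator {0..t} v" 1 q]
      by simp
    also have "\<dots> = (\<integral>\<^sup>+u. ?Q u q * indicator ({0..t} \<inter> {..t - q}) u \<partial>lborel)"
      using q by (intro nn_integral_cong) (auto simp: indicator_def)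
    finally have 2: "(\<integral>\<^sup>+v. ?Q (v - q) q * indicator {..v} q * indicator {0..t} v \<partial>lborel)
      = (\<integral>\<^sup>+u. ?Q u q * indicator ({0..t} \<inter> {..t - q}) u \<partial>lborel)" .
    show ?thesis
      unfolding 1 2
      by (subst nn_integral_add[symmetric]) (auto intro!: nn_integral_cong simp: indicator_def)
  qed
  have "(\<integral>\<^sup>+r. lam * (\<integral>\<^sup>+q. ?Q (t - r) q * indicator {r<..} q \<partial>\<E>) * indicator {0..t} r \<partial>lborel)
      + (\<integral>\<^sup>+v. lam * (\<integral>\<^sup>+q. ?Q (v - q) q * indicator {..v} q \<partial>\<E>) * indicator {0..t} v \<partial>lborel)
      = (\<integral>\<^sup>+q. lam * (\<integral>\<^sup>+v. ?Q (t - v) q * indicator {v<..} q * indicator {0..t} v \<partial>lborel)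
         + lam * (\<integral>\<^sup>+v. ?Q (v - q) q * indicator {..v} q * indicator {0..t} v \<partial>lborel) \<partial>\<E>)"
    by (subst (1 2) swap, measurable, subst nn_integral_add) auto
  also have "\<dots> = (\<integral>\<^sup>+q. lam * (\<integral>\<^sup>+u. ?Q u q * indicator {0..t} u \<partial>lborel) \<partial>\<E>)"
    using AE_expm_pos
    by (intro nn_integral_cong_AE) (auto elim!: eventually_mono simp: distrib_left[symmetric] key)
  also have "\<dots> = (\<integral>\<^sup>+u. lam * (\<integral>\<^sup>+q. ?Q u q \<partial>\<E>) * indicator {0..t} u \<partial>lborel)"
    by (rule swap[symmetric]) measurable
  finally have BD: "(\<integral>\<^sup>+r. lam * (\<integral>\<^sup>+q. ?Q (t - r) q * indicator {r<..} q \<partial>\<E>) * indicator {0..t} r \<partial>lborel)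
      + (\<integral>\<^sup>+v. lam * (\<integral>\<^sup>+q. ?Q (v - q) q * indicator {..v} q \<partial>\<E>) * indicator {0..t} v \<partial>lborel)
      = (\<integral>\<^sup>+u. lam * (\<integral>\<^sup>+q. ?Q u q \<partial>\<E>) * indicator {0..t} u \<partial>lborel)" .
  have split: "(\<integral>\<^sup>+q. f (move z q) * indicator {t<..} q \<partial>\<E>) + (\<integral>\<^sup>+q. f (move z q) * indicator {..t} q \<partial>\<E>) = (\<integral>\<^sup>+q. f (move z q) \<partial>\<E>)"
    by (subst nn_integral_add[symmetric]) (auto intro!: nn_integral_cong simp: indicator_def)
  show ?thesis
    unfolding A C BD[symmetric] split[symmetric] by (simp add: ac_simps)
qed

text \<open>The balance identity is integrated over flipped stationary states. By
  \<open>nn_integral_stat_move\<close> its outer terms become the two sides of the claim, and by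
  \<open>nn_integral_stat_jump\<close> the remaining terms both equal \<open>?c\<close>. Cancelling
  it in \<open>ennreal\<close> requires that it be finite; it is at most lam times t.\<close>

lemma stat_invariant:
  assumes B [measurable]: "B \<in> sets states" and t: "0 \<le> t"
  shows "(\<integral>\<^sup>+z. P t (indicator B) z \<partial>stat) = emeasure stat B"
proof -
  interpret stat: prob_space stat by (rule prob_space_stat)
  let ?f = "indicator B :: bool \<times> 'a \<Rightarrow> ennreal"
  have pair: "pair_sigma_finite stat (lborel :: real measure)"
    by (auto intro: pair_sigma_finite.intro stat.sigma_finite_measure_axioms sigma_finite_lborel)
  let ?c = "\<integral>\<^sup>+v. lam * (\<integral>\<^sup>+z. P v ?f (flip z) \<partial>stat) * indicator {0..t} v \<partial>lborel"
  have swap: "(\<integral>\<^sup>+z. (\<integral>\<^sup>+v. lam * g v z * indicator {0..t} v \<partial>lborel) \<partial>stat)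
      = (\<integral>\<^sup>+v. lam * (\<integral>\<^sup>+z. g v z \<partial>stat) * indicator {0..t} v \<partial>lborel)"
    if [measurable]: "(\<lambda>(v, z). g v z) \<in> borel_measurable (borel \<Otimes>\<^sub>M states)"
      for g :: "real \<Rightarrow> bool \<times> 'a \<Rightarrow> ennreal"
  proof -
    have "(\<integral>\<^sup>+z. (\<integral>\<^sup>+v. lam * g v z * indicator {0..t} v \<partial>lborel) \<partial>stat)
      = (\<integral>\<^sup>+v. (\<integral>\<^sup>+z. lam * g v z * indicator {0..t} v \<partial>stat) \<partial>lborel)"
      by (rule pair_sigma_finite.Fubini'[OF pair, symmetric]) measurable
    then show ?thesis
      by (simp add: nn_integral_cmult nn_integral_multc)
  qed
  have "(\<integral>\<^sup>+z. P t ?f z \<partial>stat) + ?c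
      = (\<integral>\<^sup>+z. (\<integral>\<^sup>+q. P t ?f (move (flip z) q) \<partial>\<E>) + (\<integral>\<^sup>+v. lam * P v ?f (flip z) * indicator {0..t} v \<partial>lborel) \<partial>stat)"
    by (subst nn_integral_add) (auto simp: nn_integral_stat_move swap)
  also have "\<dots> = (\<integral>\<^sup>+z. (\<integral>\<^sup>+q. ?f (move (flip z) q) \<partial>\<E>)
      + (\<integral>\<^sup>+u. lam * (\<integral>\<^sup>+q. P u ?f (jump (flip z) q) \<partial>\<E>) * indicator {0..t} u \<partial>lborel) \<partial>stat)"
    by (intro nn_integral_cong P_move_balance t) measurable
  also have "\<dots> = (\<integral>\<^sup>+z. ?f z \<partial>stat) + ?c"
    by (subst nn_integral_add) (auto simp: nn_integral_stat_move nn_integral_stat_jump swap)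
  finally have eq: "(\<integral>\<^sup>+z. P t ?f z \<partial>stat) + ?c = emeasure stat B + ?c"
    by simp
  have "P v ?f z \<le> P v (\<lambda>_. 1) z" for v z
    unfolding P_def by (intro nn_integral_mono) (simp add: indicator_def)
  then have "(\<integral>\<^sup>+z. P v ?f (flip z) \<partial>stat) \<le> (\<integral>\<^sup>+z. 1 \<partial>stat)" for v
    by (intro nn_integral_mono) (simp add: P_one)
  then have "(\<integral>\<^sup>+z. P v ?f (flip z) \<partial>stat) \<le> 1" for v
    using stat.emeasure_space_1 by simp
  then have "?c \<le> (\<integral>\<^sup>+v. ennreal lam * 1 * indicator {0..t} v \<partial>lborel)"
    by (intro nn_integral_mono mult_right_mono mult_left_mono) auto
  also have "\<dots> < \<top>"
    using t by (simp add: nn_integral_cmult ennreal_mult_less_top)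
  finally have "?c \<noteq> \<infinity>" by simp
  then show ?thesis
    using eq unfolding add.commute[of _ ?c] ennreal_add_left_cancel by blast
qed

end

section \<open>Coupling with the stationary law\<close>

lemma index_set [measurable]: "{z :: bool \<times> 'a::topological_space. fst z = i} \<in> sets states"
proof -
  have "fst -` {i} \<inter> space states \<in> sets (states :: (bool \<times> 'a) measure)"
    by (rule measurable_sets[OF measurable_fst]) simp
  then show ?thesis by (simp add: vimage_def)
qed

lemma ball_set [measurable]: "{z :: bool \<times> 'a::euclidean_space. norm (snd z) \<le> r} \<in> sets states"
proof -
  have "{z \<in> space (states :: (bool \<times> 'a) measure). norm (snd z) \<le> r} \<in> sets states" by measurable
  then show ?thesis by simp
qed

lemma nn_integral_bool_fst:
  fixes h :: "bool \<Rightarrow> ennreal"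
  assumes [measurable_cong, simp]: "sets \<mu> = sets states"
  shows "(\<integral>\<^sup>+z. h (fst z) \<partial>\<mu>) = h True * emeasure \<mu> {z. fst z = True} + h False * emeasure \<mu> {z. fst z = False}"
proof -
  have [simp]: "space \<mu> = UNIV"
    using sets_eq_imp_space_eq[of \<mu> states] by simp
  have "{z. fst z = i} \<in> sets \<mu>" for i
    by measurable
  then have ind: "(\<integral>\<^sup>+z. c * indicator {z. fst z = i} z \<partial>\<mu>) = c * emeasure \<mu> {z. fst z = i}" for c i
    by (rule nn_integral_cmult_indicator)
  have "(\<integral>\<^sup>+z. h (fst z) \<partial>\<mu>) = (\<integral>\<^sup>+z. h True * indicator {z. fst z = True} z + h False * indicator {z. fst z = False} z \<partial>\<mu>)"
    by (intro nn_integral_cong) (auto simp: indicator_def)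
  also have "\<dots> = h True * emeasure \<mu> {z. fst z = True} + h False * emeasure \<mu> {z. fst z = False}"
    unfolding ind[symmetric] by (rule nn_integral_add) measurable
  finally show ?thesis .
qed

text \<open>The coupling has a density with respect to the product measure that depends on the indices only:
  as much mass as possible keeps its index, the excess of the more likely index is moved.\<close>

lemma index_coupling:
  fixes \<alpha> \<mu> :: "(bool \<times> 'a::euclidean_space) measure"
  assumes \<alpha>: "prob_space \<alpha>" "sets \<alpha> = sets states" and \<mu>: "prob_space \<mu>" "sets \<mu> = sets states"
    and \<mu>_half: "\<And>i. emeasure \<mu> {z. fst z = i} = ennreal (1 / 2)"
    and \<alpha>_half: "\<And>i. emeasure \<alpha> {z. fst z = i} \<le> ennreal (1 / 2 + \<epsilon>)" and \<epsilon>: "0 \<le> \<epsilon>"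
  obtains \<Gamma> where "prob_space \<Gamma>" "sets \<Gamma> = sets (states \<Otimes>\<^sub>M states)"
    "distr \<Gamma> states fst = \<alpha>" "distr \<Gamma> states snd = \<mu>"
    "emeasure \<Gamma> {z. fst (fst z) \<noteq> fst (snd z)} \<le> ennreal \<epsilon>"
proof -
  interpret \<alpha>: prob_space \<alpha> by fact
  interpret \<mu>: prob_space \<mu> by fact
  interpret pair: pair_sigma_finite \<alpha> \<mu> ..
  note [measurable_cong, simp] = \<alpha>(2) \<mu>(2)
  have [simp]: "space \<alpha> = UNIV" "space \<mu> = UNIV"
    using sets_eq_imp_space_eq[OF \<alpha>(2)] sets_eq_imp_space_eq[OF \<mu>(2)] by simp_all
  define a where "a i = measure \<alpha> {z. fst z = i}" for i
  have a: "emeasure \<alpha> {z. fst z = i} = ennreal (a i)" for i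
    by (simp add: a_def \<alpha>.emeasure_eq_measure)
  have a_nonneg: "0 \<le> a i" for i by (simp add: a_def)
  have a_le: "a i \<le> 1 / 2 + \<epsilon>" for i
    using \<alpha>_half[of i] \<epsilon> unfolding a by (subst (asm) ennreal_le_iff) auto
  have a_sum: "a True + a False = 1"
  proof -
    have "ennreal (a True + a False) = (\<integral>\<^sup>+z. 1 \<partial>\<alpha>)"
      using nn_integral_bool_fst[OF \<alpha>(2), of "\<lambda>_. 1"] unfolding a by (simp add: a_nonneg del: nn_integral_const)
    also have "\<dots> = ennreal 1" using \<alpha>.emeasure_space_1 by simp
    finally show ?thesis by (subst (asm) ennreal_inj) (auto simp: a_nonneg)
  qed
  \<comment> \<open>The target puts mass 1/2 on each index, so the common mass min (a i) (1/2) has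
    density 2 min (a i) (1/2) / a i on the diagonal. The other entry is what makes the row average
    1. If a i = 0, division by zero yields the row 0, 2, whose average is still 1.\<close>
  define g where "g i j = (if i = j then 2 * min (a i) (1 / 2) / a i else 2 - 2 * min (a i) (1 / 2) / a i)" for i j
  have a_g: "a i * g i i = 2 * min (a i) (1 / 2)" for i
    using a_nonneg[of i] by (auto simp: g_def)
  have g_nonneg: "0 \<le> g i j" for i j
    using a_nonneg[of i] by (cases "a i = 0") (auto simp: g_def divide_le_eq min_def)
  have a_not: "a (\<not> i) = 1 - a i" for i using a_sum by (cases i) auto
  have a_g_not: "a i * g i (\<not> i) = 2 * a i - 2 * min (a i) (1 / 2)" for i
    using a_g[of i] by (simp add: g_def algebra_simps)
  have row: "(\<integral>\<^sup>+z. ennreal (g i (fst z)) \<partial>\<mu>) = 1" for i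
  proof -
    have "(\<integral>\<^sup>+z. ennreal (g i (fst z)) \<partial>\<mu>) = ennreal (g i True) * ennreal (1 / 2) + ennreal (g i False) * ennreal (1 / 2)"
      using nn_integral_bool_fst[OF \<mu>(2), of "\<lambda>j. ennreal (g i j)"] unfolding \<mu>_half .
    also have "\<dots> = ennreal (g i True * (1 / 2) + g i False * (1 / 2))"
      by (subst (1 2) ennreal_mult''[symmetric]) (simp_all add: g_nonneg)
    also have "g i True * (1 / 2) + g i False * (1 / 2) = 1"
      by (cases i) (simp_all add: g_def field_simps)
    finally show ?thesis by simp
  qed
  have col: "(\<integral>\<^sup>+z. ennreal (g (fst z) j) \<partial>\<alpha>) = 1" for j
  proof -
    have "(\<integral>\<^sup>+z. ennreal (g (fst z) j) \<partial>\<alpha>) = ennreal (a j * g j j + a (\<not> j) * g (\<not> j) j)"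
      using nn_integral_bool_fst[OF \<alpha>(2), of "\<lambda>i. ennreal (g i j)"] unfolding a
      by (cases j) (simp_all add: a_nonneg g_nonneg ennreal_mult mult.commute add.commute)
    also have "a j * g j j + a (\<not> j) * g (\<not> j) j = 1"
      using a_g_not[of "\<not> j"] a_g[of j] by (auto simp: a_not min_def)
    finally show ?thesis by simp
  qed
  define G where "G z = ennreal (g (fst (fst z)) (fst (snd z)))" for z :: "(bool \<times> 'a) \<times> (bool \<times> 'a)"
  have g_meas: "(\<lambda>z. ennreal (g (i z) (j z))) \<in> borel_measurable M"
    if [measurable]: "i \<in> M \<rightarrow>\<^sub>M count_space UNIV" "j \<in> M \<rightarrow>\<^sub>M count_space UNIV"
    for i j and M :: "'c measure"
    by (rule measurable_compose_countable[where f = "\<lambda>i' z. ennreal (g i' (j z))"])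
       (auto intro: measurable_compose[OF that(2)])
  have [measurable]: "G \<in> borel_measurable (states \<Otimes>\<^sub>M states)"
    unfolding G_def by (rule g_meas) measurable
  define \<Gamma> where "\<Gamma> = density (\<alpha> \<Otimes>\<^sub>M \<mu>) G"
  have sets_\<Gamma> [simp, measurable_cong]: "sets \<Gamma> = sets (states \<Otimes>\<^sub>M states)"
    by (simp add: \<Gamma>_def cong: sets_pair_measure_cong)
  have int: "(\<integral>\<^sup>+z. f z \<partial>\<Gamma>) = (\<integral>\<^sup>+z. \<integral>\<^sup>+z'. ennreal (g (fst z) (fst z')) * f (z, z') \<partial>\<mu> \<partial>\<alpha>)"
    if [measurable]: "f \<in> borel_measurable (states \<Otimes>\<^sub>M states)" for f
    unfolding \<Gamma>_def
    by (subst nn_integral_density, measurable, subst \<mu>.nn_integral_fst[symmetric]) (auto simp: G_def)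
  have g1 [measurable]: "(\<lambda>z'. ennreal (g i (fst z'))) \<in> borel_measurable \<mu>" for i
    by (rule g_meas) measurable
  have g2 [measurable]: "(\<lambda>z. ennreal (g (fst z) i)) \<in> borel_measurable \<alpha>" for i
    by (rule g_meas) measurable
  have fst: "distr \<Gamma> states fst = \<alpha>"
  proof (rule measure_eqI)
    fix B assume "B \<in> sets (distr \<Gamma> states fst)"
    then have B [measurable]: "B \<in> sets states" by simp
    have "emeasure (distr \<Gamma> states fst) B = (\<integral>\<^sup>+z. indicator B (fst z) \<partial>\<Gamma>)"
      by (subst nn_integral_indicator[symmetric], simp, subst nn_integral_distr) auto
    also have "\<dots> = (\<integral>\<^sup>+z. \<integral>\<^sup>+z'. ennreal (g (fst z) (fst z')) * indicator B z \<partial>\<mu> \<partial>\<alpha>)"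
      by (subst int) auto
    also have "\<dots> = emeasure \<alpha> B"
      by (simp add: nn_integral_multc row)
    finally show "emeasure (distr \<Gamma> states fst) B = emeasure \<alpha> B" .
  qed simp
  have snd: "distr \<Gamma> states snd = \<mu>"
  proof (rule measure_eqI)
    fix B assume "B \<in> sets (distr \<Gamma> states snd)"
    then have B [measurable]: "B \<in> sets states" by simp
    have [measurable]: "(\<lambda>z. ennreal (g (fst (fst z)) (fst (snd z)))) \<in> borel_measurable (\<alpha> \<Otimes>\<^sub>M \<mu>)"
      by (rule g_meas) measurable
    have "emeasure (distr \<Gamma> states snd) B = (\<integral>\<^sup>+z. indicator B (snd z) \<partial>\<Gamma>)"
      by (subst nn_integral_indicator[symmetric], simp, subst nn_integral_distr) auto
    also have "\<dots> = (\<integral>\<^sup>+z. \<integral>\<^sup>+z'. ennreal (g (fst z) (fst z')) * indicator B z' \<partial>\<mu> \<partial>\<alpha>)"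
      by (subst int) auto
    also have "\<dots> = (\<integral>\<^sup>+z'. \<integral>\<^sup>+z. ennreal (g (fst z) (fst z')) * indicator B z' \<partial>\<alpha> \<partial>\<mu>)"
      by (rule pair.Fubini'[symmetric]) (auto simp: split_def)
    also have "\<dots> = emeasure \<mu> B"
      by (simp add: nn_integral_multc col)
    finally show "emeasure (distr \<Gamma> states snd) B = emeasure \<mu> B" .
  qed simp
  have sp: "space \<Gamma> = UNIV"
    using sets_eq_imp_space_eq[OF sets_\<Gamma>] by (simp add: space_pair_measure)
  have prob: "prob_space \<Gamma>"
    using prob_space_distrD[of fst \<Gamma> states] \<alpha>(1) fst by (simp add: measurable_fst)
  have "emeasure \<Gamma> {z. fst (fst z) \<noteq> fst (snd z)} = (\<integral>\<^sup>+z. (if fst (fst z) \<noteq> fst (snd z) then 1 else 0) \<partial>\<Gamma>)"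
  proof -
    have "{z \<in> space \<Gamma>. fst (fst z) \<noteq> fst (snd z)} \<in> sets \<Gamma>" by measurable
    then have "{z. fst (fst z) \<noteq> fst (snd z)} \<in> sets \<Gamma>" by (simp add: sp)
    then show ?thesis
      by (simp add: nn_integral_indicator[symmetric] indicator_def of_bool_def del: nn_integral_indicator)
  qed
  also have "\<dots> = (\<integral>\<^sup>+z. \<integral>\<^sup>+z'. ennreal (g (fst z) (fst z')) * (if fst z \<noteq> fst z' then 1 else 0) \<partial>\<mu> \<partial>\<alpha>)"
    by (subst int) auto
  also have "\<dots> = (\<integral>\<^sup>+z. ennreal (g (fst z) (\<not> fst z) / 2) \<partial>\<alpha>)"
  proof (rule nn_integral_cong)
    fix z
    have "(\<integral>\<^sup>+z'. ennreal (g (fst z) (fst z')) * (if fst z \<noteq> fst z' then 1 else 0) \<partial>\<mu>) = ennreal (g (fst z) (\<not> fst z)) * ennreal (1 / 2)"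
      using nn_integral_bool_fst[OF \<mu>(2), of "\<lambda>j. ennreal (g (fst z) j) * (if fst z \<noteq> j then 1 else 0)"] unfolding \<mu>_half
      by (cases "fst z") simp_all
    then show "(\<integral>\<^sup>+z'. ennreal (g (fst z) (fst z')) * (if fst z \<noteq> fst z' then 1 else 0) \<partial>\<mu>) = ennreal (g (fst z) (\<not> fst z) / 2)"
      using ennreal_mult''[of "1 / 2" "g (fst z) (\<not> fst z)"] by simp
  qed
  also have "\<dots> = ennreal (a True * g True False / 2 + a False * g False True / 2)"
    using nn_integral_bool_fst[OF \<alpha>(2), of "\<lambda>j. ennreal (g j (\<not> j) / 2)"] unfolding a
    by (simp add: a_nonneg g_nonneg ennreal_mult[symmetric] ennreal_plus[symmetric] mult_ac del: ennreal_plus)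
  \<comment> \<open>The moved mass from index i is a i minus min (a i) (1/2), the excess over one
    half; at most one index has an excess, and it is bounded by \<open>\<epsilon>\<close>.\<close>
  also have "\<dots> \<le> ennreal \<epsilon>"
    using a_g_not[of True] a_g_not[of False] a_le[of True] a_le[of False] a_sum \<epsilon>
    by (intro ennreal_leI) (auto simp: min_def split: if_splits)
  finally show ?thesis
    using that prob sets_\<Gamma> fst snd by blast
qed

context switched_flow
begin

text \<open>The dual action of \<open>P\<close> on initial laws.\<close>

definition evolve :: "(bool \<times> 'a) measure \<Rightarrow> real \<Rightarrow> (bool \<times> 'a) measure" where
  "evolve \<alpha> t = distr (\<alpha> \<Otimes>\<^sub>M \<W>) states (\<lambda>(z, w). traj t z w)"

definition start :: "bool measure \<Rightarrow> 'a \<Rightarrow> (bool \<times> 'a) measure" where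
  "start q x = distr q states (\<lambda>j. (j, x))"

lemma sets_evolve [simp, measurable_cong]: "sets (evolve \<alpha> t) = sets states"
  by (simp add: evolve_def)

lemma sets_start [simp, measurable_cong]: "sets (start q x) = sets states"
  by (simp add: start_def)

lemma nn_integral_evolve:
  assumes [simp, measurable_cong]: "sets \<alpha> = sets states" and [measurable]: "f \<in> borel_measurable states"
  shows "(\<integral>\<^sup>+z. f z \<partial>evolve \<alpha> t) = (\<integral>\<^sup>+z. P t f z \<partial>\<alpha>)"
proof -
  have "(\<integral>\<^sup>+z. f z \<partial>evolve \<alpha> t) = (\<integral>\<^sup>+x. f (traj t (fst x) (snd x)) \<partial>(\<alpha> \<Otimes>\<^sub>M \<W>))"
    unfolding evolve_def by (subst nn_integral_distr) (auto simp: split_def)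
  also have "\<dots> = (\<integral>\<^sup>+z. P t f z \<partial>\<alpha>)"
    unfolding P_def by (subst PW.nn_integral_fst[symmetric]) auto
  finally show ?thesis .
qed

lemma prob_space_evolve:
  assumes "prob_space \<alpha>" and [measurable_cong]: "sets \<alpha> = sets states"
  shows "prob_space (evolve \<alpha> t)"
  unfolding evolve_def
  by (intro prob_space.prob_space_distr prob_space_pair PW.prob_space_axioms assms) measurable

lemma emeasure_evolve:
  assumes \<alpha>: "sets \<alpha> = sets states" and B [measurable]: "B \<in> sets states"
  shows "emeasure (evolve \<alpha> t) B = (\<integral>\<^sup>+z. P t (indicator B) z \<partial>\<alpha>)"
  using nn_integral_evolve[OF \<alpha>, of "indicator B" t] by simp

lemma evolve_evolve:
  assumes \<alpha>: "sets \<alpha> = sets states" and "0 \<le> s" "0 \<le> t"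
  shows "evolve (evolve \<alpha> s) t = evolve \<alpha> (s + t)"
proof (rule measure_eqI)
  fix B assume "B \<in> sets (evolve (evolve \<alpha> s) t)"
  then have B [measurable]: "B \<in> sets states" by simp
  show "emeasure (evolve (evolve \<alpha> s) t) B = emeasure (evolve \<alpha> (s + t)) B"
    using assms by (simp add: emeasure_evolve nn_integral_evolve chapman_kolmogorov)
qed simp

lemma evolve_stat:
  assumes "0 \<le> t"
  shows "evolve stat t = stat"
  by (rule measure_eqI) (use assms in \<open>auto simp: emeasure_evolve stat_invariant\<close>)

lemma emeasure_evolve_index:
  assumes \<alpha>: "prob_space \<alpha>" "sets \<alpha> = sets states" and "0 \<le> t"
  shows "emeasure (evolve \<alpha> t) {z. fst z = i} \<le> ennreal (1 / 2 + 1 / 2 * exp (- 2 * lam * t))"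
proof -
  interpret prob_space \<alpha> by fact
  have "indicator {z. fst z = i} = (\<lambda>z :: bool \<times> 'a. indicator {i} (fst z) :: ennreal)"
    by (auto simp: indicator_def fun_eq_iff)
  then have "emeasure (evolve \<alpha> t) {z. fst z = i} = (\<integral>\<^sup>+z. P t (\<lambda>z. indicator {i} (fst z)) z \<partial>\<alpha>)"
    using emeasure_evolve[OF \<alpha>(2) index_set] by simp
  also have "\<dots> \<le> (\<integral>\<^sup>+z. ennreal (1 / 2 + 1 / 2 * exp (- 2 * lam * t)) \<partial>\<alpha>)"
    by (intro nn_integral_mono P_index_le assms)
  finally show ?thesis
    using emeasure_space_1 by simp
qed

lemma emeasure_stat_index: "emeasure stat {z. fst z = i} = ennreal (1 / 2)"
proof -
  have "emeasure stat {z. fst z = i} = (\<integral>\<^sup>+z. indicator {z. fst z = i} z \<partial>stat)"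
    by simp
  also have "\<dots> = ennreal (1 / 2)"
    by (subst nn_integral_stat) (cases i, simp_all add: indicator_def)
  finally show ?thesis .
qed

lemma AE_stat_ball: "AE z in stat. norm (snd z) \<le> R"
proof -
  have [measurable]: "{z. \<not> norm (snd z) \<le> R} \<in> sets (states :: (bool \<times> 'a) measure)"
  proof -
    have "{z \<in> space (states :: (bool \<times> 'a) measure). \<not> norm (snd z) \<le> R} \<in> sets states" by measurable
    then show ?thesis by simp
  qed
  have "emeasure stat {z. \<not> norm (snd z) \<le> R} = 0"
  proof -
    have "(\<integral>\<^sup>+w. indicator {z. \<not> norm (snd z) \<le> R} (j, pull_lim j w) \<partial>\<W>) = (\<integral>\<^sup>+w. 0 \<partial>\<W>)" for j
      using AE_pull_lim_ball[of j] by (intro nn_integral_cong_AE) (auto elim!: eventually_mono)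
    then have "(\<integral>\<^sup>+z. indicator {z. \<not> norm (snd z) \<le> R} z \<partial>stat) = 0"
      by (subst nn_integral_stat) auto
    then show ?thesis by simp
  qed
  then show ?thesis
    by (intro AE_I[where N = "{z. \<not> norm (snd z) \<le> R}"]) auto
qed

lemma AE_evolve_ball:
  assumes \<alpha>: "prob_space \<alpha>" "sets \<alpha> = sets states" and ball: "AE z in \<alpha>. norm (snd z) \<le> r" and "R \<le> r" "0 \<le> t"
  shows "AE z in evolve \<alpha> t. norm (snd z) \<le> r"
proof -
  note [measurable_cong] = \<alpha>(2)
  interpret \<alpha>: prob_space \<alpha> by (rule \<alpha>)
  interpret pair_sigma_finite \<alpha> \<W> ..
  have "AE z in \<alpha>. AE w in \<W>. norm (snd (traj t z w)) \<le> r"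
    using ball
  proof eventually_elim
    case (elim z)
    show ?case
      using AE_waits_pos
      by eventually_elim (intro traj_ball assms elim, auto simp: less_imp_le)
  qed
  then have "AE x in \<alpha> \<Otimes>\<^sub>M \<W>. norm (snd (traj t (fst x) (snd x))) \<le> r"
    by (intro AE_pair_measure) auto
  then show ?thesis
    unfolding evolve_def by (subst AE_distr_iff) (auto simp: split_def)
qed

text \<open>M bounds both positions, because the ball of this radius is invariant and contains x and
  almost all of \<open>stat\<close>; thus C bounds the weighted initial distance after the half
  time. Both error terms run over t / 2, one at rate 2 lam and one at \<open>rate p\<close>, whence
  \<open>c'\<close>. The coupling itself is produced, and not only a distance, because uniqueness
  uses its integrals against Lipschitz functions.\<close>

lemma stat_coupling:
  assumes q: "prob_space q" "sets q = sets (count_space UNIV)" and p: "0 < p"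
  shows "\<exists>c>0. \<exists>c'>0. \<forall>t\<ge>0. \<exists>\<Gamma>\<in>couplings (distr stat borel snd) (distr (evolve (start q x) t) borel snd).
    (\<integral>\<^sup>+z. ennreal (min 1 (norm (fst z - snd z) powr p)) \<partial>\<Gamma>) \<le> ennreal (c * exp (- c' * t))"
proof -
  note [measurable_cong] = q(2)
  define M where "M = max R (norm x)"
  define C where "C = (1 + \<kappa> * p / (2 * lam)) * (2 * M) powr p"
  define c' where "c' = min lam (rate p / 2)"
  have C: "0 \<le> C" using \<kappa>_pos lam_pos p by (simp add: C_def)
  have c': "0 < c'" using lam_pos rate_pos[OF p] by (simp add: c'_def)
  have start: "prob_space (start q x)"
    unfolding start_def using q(1) by (rule prob_space.prob_space_distr) measurable
  have ball: "AE z in start q x. norm (snd z) \<le> M"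
    unfolding start_def by (subst AE_distr_iff) (auto simp: M_def)
  show ?thesis
  proof (intro exI conjI allI impI)
    show "0 < 1 / 2 + C" "0 < c'" using C c' by auto
    fix t :: real assume t: "0 \<le> t"
    define s where "s = t / 2"
    have s: "0 \<le> s" using t by (simp add: s_def)
    define \<alpha> where "\<alpha> = evolve (start q x) s"
    have \<alpha>: "prob_space \<alpha>" "sets \<alpha> = sets states"
      using start by (simp_all add: \<alpha>_def prob_space_evolve)
    obtain \<Gamma>0 where \<Gamma>0: "prob_space \<Gamma>0" and s\<Gamma>0 [measurable_cong, simp]: "sets \<Gamma>0 = sets (states \<Otimes>\<^sub>M states)"
      and fst0: "distr \<Gamma>0 states fst = \<alpha>" and snd0: "distr \<Gamma>0 states snd = stat"
      and mis: "emeasure \<Gamma>0 {z. fst (fst z) \<noteq> fst (snd z)} \<le> ennreal (1 / 2 * exp (- 2 * lam * s))"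
    proof (rule index_coupling[OF \<alpha> prob_space_stat sets_stat emeasure_stat_index])
      show "emeasure \<alpha> {z. fst z = i} \<le> ennreal (1 / 2 + 1 / 2 * exp (- 2 * lam * s))" for i
        unfolding \<alpha>_def by (rule emeasure_evolve_index) (use start s in auto)
    qed auto
    interpret \<Gamma>0: prob_space \<Gamma>0 by fact
    have sp0 [simp]: "space \<Gamma>0 = UNIV"
      using sets_eq_imp_space_eq[OF s\<Gamma>0] by (simp add: space_pair_measure)
    \<comment> \<open>One sequence w drives both trajectories. The components are exchanged because
      \<open>\<Gamma>0\<close> has the process first, whereas the final coupling has the stationary
      law first.\<close>
    let ?F = "\<lambda>(z, w). (snd (traj s (snd z) w), snd (traj s (fst z) w))"
    have F [measurable]: "?F \<in> \<Gamma>0 \<Otimes>\<^sub>M \<W> \<rightarrow>\<^sub>M borel \<Otimes>\<^sub>M borel"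
      by measurable
    define \<Gamma> where "\<Gamma> = distr (\<Gamma>0 \<Otimes>\<^sub>M \<W>) (borel \<Otimes>\<^sub>M borel) ?F"
    \<comment> \<open>Sharing w does not affect either marginal: for each component separately, w is
      independent of the state at time s.\<close>
    have evolve_pair: "evolve (distr \<Gamma>0 states f) s = distr (\<Gamma>0 \<Otimes>\<^sub>M \<W>) states (\<lambda>(z, w). traj s (f z) w)"
      if [measurable]: "f \<in> (states \<Otimes>\<^sub>M states) \<rightarrow>\<^sub>M states" for f
    proof (rule measure_eqI)
      fix B assume "B \<in> sets (evolve (distr \<Gamma>0 states f) s)"
      then have B [measurable]: "B \<in> sets states" by simp
      have "emeasure (evolve (distr \<Gamma>0 states f) s) B = (\<integral>\<^sup>+z. P s (indicator B) (f z) \<partial>\<Gamma>0)"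
        by (subst emeasure_evolve) (auto simp: nn_integral_distr)
      also have "\<dots> = (\<integral>\<^sup>+y. indicator B (traj s (f (fst y)) (snd y)) \<partial>(\<Gamma>0 \<Otimes>\<^sub>M \<W>))"
        unfolding P_def by (subst PW.nn_integral_fst[symmetric]) auto
      also have "\<dots> = emeasure (distr (\<Gamma>0 \<Otimes>\<^sub>M \<W>) states (\<lambda>(z, w). traj s (f z) w)) B"
        by (subst nn_integral_indicator[symmetric], simp, subst nn_integral_distr) (auto simp: split_def)
      finally show "emeasure (evolve (distr \<Gamma>0 states f) s) B = emeasure (distr (\<Gamma>0 \<Otimes>\<^sub>M \<W>) states (\<lambda>(z, w). traj s (f z) w)) B" .
    qed simp
    have "\<Gamma> \<in> couplings (distr stat borel snd) (distr (evolve (start q x) t) borel snd)"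
      unfolding couplings_def
    proof (intro CollectI conjI)
      show "prob_space \<Gamma>"
        unfolding \<Gamma>_def by (intro prob_space.prob_space_distr prob_space_pair \<Gamma>0 PW.prob_space_axioms F)
      show "sets \<Gamma> = sets (borel \<Otimes>\<^sub>M borel)" by (simp add: \<Gamma>_def)
      have "distr \<Gamma> borel fst = distr (evolve (distr \<Gamma>0 states snd) s) borel snd"
        unfolding \<Gamma>_def evolve_pair[OF measurable_snd]
        by (subst (1 2) distr_distr) (auto simp: o_def split_def intro!: measurable_snd)
      then show "distr \<Gamma> borel fst = distr stat borel snd"
        by (simp add: snd0 evolve_stat s)
      have "distr \<Gamma> borel snd = distr (evolve (distr \<Gamma>0 states fst) s) borel snd"
        unfolding \<Gamma>_def evolve_pair[OF measurable_fst]
        by (subst (1 2) distr_distr) (auto simp: o_def split_def intro!: measurable_snd)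
      then show "distr \<Gamma> borel snd = distr (evolve (start q x) t) borel snd"
        using evolve_evolve[OF sets_start s s, of q x] by (simp add: fst0 \<alpha>_def s_def)
    qed
    moreover have "(\<integral>\<^sup>+z. ennreal (min 1 (norm (fst z - snd z) powr p)) \<partial>\<Gamma>) \<le> ennreal ((1 / 2 + C) * exp (- c' * t))"
    proof -
      let ?d = "\<lambda>z z' w. ennreal (min 1 (norm (snd (traj s z' w) - snd (traj s z w)) powr p))"
      have "(\<integral>\<^sup>+z. ennreal (min 1 (norm (fst z - snd z) powr p)) \<partial>\<Gamma>) = (\<integral>\<^sup>+y. ?d (fst (fst y)) (snd (fst y)) (snd y) \<partial>(\<Gamma>0 \<Otimes>\<^sub>M \<W>))"
        unfolding \<Gamma>_def by (subst nn_integral_distr) (auto simp: split_def)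
      also have "\<dots> = (\<integral>\<^sup>+z. \<integral>\<^sup>+w. ?d (fst z) (snd z) w \<partial>\<W> \<partial>\<Gamma>0)"
        by (subst PW.nn_integral_fst[symmetric]) auto
      also have "\<dots> \<le> (\<integral>\<^sup>+z. indicator {z. fst (fst z) \<noteq> fst (snd z)} z + ennreal (C * exp (- rate p * s)) \<partial>\<Gamma>0)"
      proof (rule nn_integral_mono_AE)
        have "AE z in \<Gamma>0. norm (snd (fst z)) \<le> M"
          using AE_evolve_ball[OF start sets_start ball, of s] s AE_distrD[of fst \<Gamma>0 states]
          unfolding \<alpha>_def[symmetric] fst0[symmetric] by (auto simp: M_def)
        moreover have "AE z in \<Gamma>0. norm (snd (snd z)) \<le> R"
          using AE_stat_ball AE_distrD[of snd \<Gamma>0 states]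
          unfolding snd0[symmetric] by auto
        ultimately show "AE z in \<Gamma>0. (\<integral>\<^sup>+w. ?d (fst z) (snd z) w \<partial>\<W>)
            \<le> indicator {z. fst (fst z) \<noteq> fst (snd z)} z + ennreal (C * exp (- rate p * s))"
        proof eventually_elim
          case (elim z)
          obtain i y i' y' where z: "z = ((i, y), (i', y'))" by (metis prod.exhaust)
          show ?case
          proof (cases "i = i'")
            case False
            have "(\<integral>\<^sup>+w. ?d (fst z) (snd z) w \<partial>\<W>) \<le> (\<integral>\<^sup>+w. 1 \<partial>\<W>)"
              by (intro nn_integral_mono) auto
            also have "\<dots> \<le> 1 + ennreal (C * exp (- rate p * s))" by simp
            finally show ?thesis using False z by simp
          next
            case True
            have "(\<integral>\<^sup>+w. ?d (fst z) (snd z) w \<partial>\<W>) \<le> (\<integral>\<^sup>+w. ennreal (norm (snd (traj s (i, y') w) - snd (traj s (i, y) w)) powr p) \<partial>\<W>)"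
              using True z by (intro nn_integral_mono ennreal_leI) auto
            also have "\<dots> \<le> ennreal ((1 + \<kappa> * p / (2 * lam)) * exp (- rate p * s) * norm (y' - y) powr p)"
              by (rule traj_contract[OF p s])
            also have "\<dots> \<le> ennreal ((1 + \<kappa> * p / (2 * lam)) * exp (- rate p * s) * (2 * M) powr p)"
            proof (intro ennreal_leI mult_left_mono powr_mono2)
              show "norm (y' - y) \<le> 2 * M"
                using elim z norm_triangle_ineq4[of y' y] by (simp add: M_def)
            qed (use p \<kappa>_pos lam_pos in auto)
            finally show ?thesis using True z by (simp add: C_def mult_ac)
          qed
        qed
      qed
      also have "\<dots> = emeasure \<Gamma>0 {z. fst (fst z) \<noteq> fst (snd z)} + ennreal (C * exp (- rate p * s))"
      proof -
        have "{z \<in> space \<Gamma>0. fst (fst z) \<noteq> fst (snd z)} \<in> sets \<Gamma>0" by measurable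
        then have "{z. fst (fst z) \<noteq> fst (snd z)} \<in> sets \<Gamma>0" by simp
        then show ?thesis
          using \<Gamma>0.emeasure_space_1 by (subst nn_integral_add) auto
      qed
      also have "\<dots> \<le> ennreal (1 / 2 * exp (- 2 * lam * s)) + ennreal (C * exp (- rate p * s))"
        by (intro add_right_mono mis)
      also have "\<dots> = ennreal (1 / 2 * exp (- 2 * lam * s) + C * exp (- rate p * s))"
        using C by simp
      also have "\<dots> \<le> ennreal ((1 / 2 + C) * exp (- c' * t))"
      proof (rule ennreal_leI)
        have "c' * t \<le> 2 * lam * s" "c' * t \<le> rate p * s"
          using mult_right_mono[of c' lam t] mult_right_mono[of c' "rate p / 2" t] t
          by (simp_all add: c'_def s_def)
        then show "1 / 2 * exp (- 2 * lam * s) + C * exp (- rate p * s) \<le> (1 / 2 + C) * exp (- c' * t)"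
          using C by (auto simp: distrib_right intro!: add_mono mult_left_mono)
      qed
      finally show ?thesis .
    qed
    ultimately show "\<exists>\<Gamma>\<in>couplings (distr stat borel snd) (distr (evolve (start q x) t) borel snd).
      (\<integral>\<^sup>+z. ennreal (min 1 (norm (fst z - snd z) powr p)) \<partial>\<Gamma>) \<le> ennreal ((1 / 2 + C) * exp (- c' * t))"
      by blast
  qed
qed

end

section \<open>Uniqueness of the stationary law\<close>

text \<open>Closed sets are stable under intersection and generate the Borel sets. The indicator of
  a closed set is the limit of the Lipschitz functions max 0 (1 - n d), with d the distance to the
  set.\<close>

lemma borel_prob_eqI_lipschitz:
  fixes M N :: "'a::metric_space measure"
  assumes M: "prob_space M" "sets M = sets borel" and N: "prob_space N" "sets N = sets borel"
    and eq: "\<And>f L. 0 \<le> L \<Longrightarrow> (\<And>x y. \<bar>f x - f y\<bar> \<le> L * dist x y) \<Longrightarrow> (\<And>x. 0 \<le> f x \<and> f x \<le> 1) \<Longrightarrow>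
      (\<integral>\<^sup>+x. ennreal (f x) \<partial>M) = (\<integral>\<^sup>+x. ennreal (f x) \<partial>N)"
  shows "M = N"
proof -
  interpret M: prob_space M by fact
  interpret N: prob_space N by fact
  note [measurable_cong, simp] = M(2) N(2)
  have [simp]: "space M = UNIV" "space N = UNIV"
    using sets_eq_imp_space_eq[OF M(2)] sets_eq_imp_space_eq[OF N(2)] by simp_all
  have closed: "emeasure M C = emeasure N C" if C: "closed C" for C
  \<comment> \<open>The distance to the empty set is 0 by convention, so the approximation would
    converge to 1 there.\<close>
  proof (cases "C = {}")
    case False
    define f where "f n x = max 0 (1 - real n * infdist x C)" for n x
    have f_meas [measurable]: "f n \<in> borel_measurable borel" for n
      unfolding f_def by (intro borel_measurable_continuous_onI continuous_intros)
    have f01: "0 \<le> f n x \<and> f n x \<le> 1" for n x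
      by (auto simp: f_def infdist_nonneg)
    have "\<bar>f n x - f n y\<bar> \<le> real n * dist x y" for n x y
    proof -
      have "\<bar>f n x - f n y\<bar> \<le> \<bar>real n * infdist x C - real n * infdist y C\<bar>"
        by (auto simp: f_def max_def)
      also have "\<dots> \<le> real n * dist x y"
        using infdist_triangle_abs[of x C y] by (simp add: right_diff_distrib[symmetric] abs_mult mult_left_mono)
      finally show ?thesis .
    qed
    then have f_eq: "(\<integral>\<^sup>+x. ennreal (f n x) \<partial>M) = (\<integral>\<^sup>+x. ennreal (f n x) \<partial>N)" for n
      by (intro eq[of "real n"] f01) auto
    have lim: "(\<lambda>n. ennreal (f n x)) \<longlonglongrightarrow> indicator C x" for x
    proof (cases "x \<in> C")
      case True
      then show ?thesis using C False by (simp add: f_def)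
    next
      case False
      then have pos: "0 < infdist x C"
        using C \<open>C \<noteq> {}\<close> by (metis in_closed_iff_infdist_zero infdist_nonneg order_le_less)
      obtain m where m: "1 / infdist x C < real m" using reals_Archimedean2 by blast
      have "f n x = 0" if "m \<le> n" for n
      proof -
        have "1 < real m * infdist x C" using m pos by (simp add: field_simps)
        also have "\<dots> \<le> real n * infdist x C" using that pos by (intro mult_right_mono) auto
        finally show ?thesis by (simp add: f_def)
      qed
      then have "eventually (\<lambda>n. ennreal (f n x) = indicator C x) sequentially"
        using False by (auto simp: eventually_sequentially intro!: exI[of _ m])
      then show ?thesis by (rule tendsto_eventually)
    qed
    have conv: "(\<lambda>n. \<integral>\<^sup>+x. ennreal (f n x) \<partial>K) \<longlonglongrightarrow> emeasure K C" if "prob_space K" "sets K = sets borel" for K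
    proof -
      note [measurable_cong] = that(2)
      interpret K: prob_space K by fact
      have [measurable]: "C \<in> sets K" using C that by simp
      have "(\<lambda>n. \<integral>\<^sup>+x. ennreal (f n x) \<partial>K) \<longlonglongrightarrow> (\<integral>\<^sup>+x. indicator C x \<partial>K)"
        by (rule nn_integral_dominated_convergence[where w = "\<lambda>_. 1"])
           (use f01 lim K.emeasure_space_1 in auto)
      then show ?thesis by simp
    qed
    show ?thesis
      using conv[OF M] conv[OF N] unfolding f_eq by (rule LIMSEQ_unique)
  qed simp
  show ?thesis
  proof (rule measure_eqI_generator_eq[where E = "Collect closed" and \<Omega> = UNIV and A = "\<lambda>_. UNIV"])
    show "Int_stable (Collect closed)" by (auto simp: Int_stable_def)
    show "sets M = sigma_sets UNIV (Collect closed)" "sets N = sigma_sets UNIV (Collect closed)"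
      by (simp_all add: borel_eq_closed)
    show "emeasure M UNIV \<noteq> \<infinity>" for i :: nat
      using M.emeasure_space_1 by simp
  qed (auto simp: closed)
qed

context switched_flow
begin

text \<open>Bounded Lipschitz functions are controlled by the truncated distance, so the coupling
  estimate, used here with exponent 1/2, bounds the difference of the two integrals by a multiple of
  exp (- c' n).\<close>

lemma tendsto_P_stat:
  assumes L: "0 \<le> L" and lip: "\<And>x y. \<bar>f x - f y\<bar> \<le> L * dist x y" and f01: "\<And>x. 0 \<le> f x \<and> f x \<le> 1"
  shows "(\<lambda>n. P (real n) (\<lambda>z. ennreal (f (snd z))) (j, x)) \<longlonglongrightarrow> (\<integral>\<^sup>+z. ennreal (f (snd z)) \<partial>stat)"
proof -
  have "uniformly_continuous_on UNIV f"
    using lipschitz_onI[of UNIV f L] lip L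
    by (intro lipschitz_on_uniformly_continuous) (auto simp: dist_real_def)
  then have "continuous_on UNIV f" by (rule uniformly_continuous_imp_continuous)
  then have [measurable]: "f \<in> borel_measurable borel" by (rule borel_measurable_continuous_onI)
  let ?q = "return (count_space UNIV) j"
  have q: "prob_space ?q" "sets ?q = sets (count_space UNIV)"
    by (simp_all add: prob_space_return)
  obtain c c' where c: "0 < c" "0 < c'" and \<Gamma>: "\<And>t. 0 \<le> t \<Longrightarrow>
      \<exists>\<Gamma>\<in>couplings (distr stat borel snd) (distr (evolve (start ?q x) t) borel snd).
        (\<integral>\<^sup>+z. ennreal (min 1 (norm (fst z - snd z) powr (1 / 2))) \<partial>\<Gamma>) \<le> ennreal (c * exp (- c' * t))"
    using stat_coupling[OF q, of "1 / 2" x] by auto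
  \<comment> \<open>The entry 1 serves points at distance above 1, where f varies by at most 1; the
    entry L serves near points, where the distance is below its square root.\<close>
  define K where "K = max 1 L"
  have Lip: "\<bar>f y - f z\<bar> \<le> K * min 1 (norm (y - z) powr (1 / 2))" for y z
  proof (cases "norm (y - z) \<le> 1")
    case True
    have le: "norm (y - z) \<le> norm (y - z) powr (1 / 2)"
      using True powr_mono'[of "1 / 2" 1 "norm (y - z)"] by simp
    have "norm (y - z) powr (1 / 2) \<le> 1 powr (1 / 2)"
      using True by (intro powr_mono2) auto
    then have "min 1 (norm (y - z) powr (1 / 2)) = norm (y - z) powr (1 / 2)" by simp
    moreover have "\<bar>f y - f z\<bar> \<le> K * norm (y - z) powr (1 / 2)"
      using lip[of y z] le L
      by (intro order_trans[OF lip] mult_mono) (auto simp: K_def dist_norm)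
    ultimately show ?thesis by simp
  next
    case False
    have "\<bar>f y - f z\<bar> \<le> 1" using f01[of y] f01[of z] by auto
    moreover have "1 powr (1 / 2) \<le> norm (y - z) powr (1 / 2)"
      using False by (intro powr_mono2) auto
    ultimately show ?thesis by (simp add: K_def)
  qed
  let ?F = "\<lambda>x. ennreal (f x)"
  define B where "B = (\<integral>\<^sup>+z. ?F (snd z) \<partial>stat)"
  define a where "a n = P (real n) (\<lambda>z. ?F (snd z)) (j, x)" for n
  have a_le: "a n \<le> 1" for n
    unfolding a_def P_def by (rule order_trans[OF nn_integral_mono[of _ _ "\<lambda>_. 1"]]) (use f01 in auto)
  have B_le: "B \<le> 1"
    unfolding B_def
    by (rule order_trans[OF nn_integral_mono[of _ _ "\<lambda>_. 1"]]) (use f01 prob_space.emeasure_space_1[OF prob_space_stat] in auto)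
  have bounds: "B \<le> a n + ennreal (K * (c * exp (- c' * real n))) \<and> a n \<le> B + ennreal (K * (c * exp (- c' * real n)))" for n
  proof -
    obtain G where G: "G \<in> couplings (distr stat borel snd) (distr (evolve (start ?q x) (real n)) borel snd)"
      and Gle: "(\<integral>\<^sup>+z. ennreal (min 1 (norm (fst z - snd z) powr (1 / 2))) \<partial>G) \<le> ennreal (c * exp (- c' * real n))"
      using \<Gamma>[of "real n"] by auto
    have [measurable_cong]: "sets G = sets (borel \<Otimes>\<^sub>M borel)"
      and fst: "distr G borel fst = distr stat borel snd"
      and snd: "distr G borel snd = distr (evolve (start ?q x) (real n)) borel snd"
      using G by (auto simp: couplings_def)
    have "(\<integral>\<^sup>+z. ?F (fst z) \<partial>G) = (\<integral>\<^sup>+x. ?F x \<partial>distr G borel fst)"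
      by (subst nn_integral_distr) auto
    also have "\<dots> = B"
      unfolding fst B_def by (subst nn_integral_distr) auto
    finally have B: "(\<integral>\<^sup>+z. ?F (fst z) \<partial>G) = B" .
    have "(\<integral>\<^sup>+z. ?F (snd z) \<partial>G) = (\<integral>\<^sup>+x. ?F x \<partial>distr G borel snd)"
      by (subst nn_integral_distr) auto
    also have "\<dots> = (\<integral>\<^sup>+z. ?F (snd z) \<partial>evolve (start ?q x) (real n))"
      unfolding snd by (subst nn_integral_distr) auto
    also have "\<dots> = (\<integral>\<^sup>+z. P (real n) (\<lambda>z. ?F (snd z)) z \<partial>start ?q x)"
      by (rule nn_integral_evolve) simp_all
    also have "\<dots> = a n"
    proof -
      have "(\<lambda>z. P (real n) (\<lambda>z. ?F (snd z)) z) \<in> borel_measurable states" by measurable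
      then show ?thesis
        unfolding a_def start_def by (subst distr_return) (auto simp: nn_integral_return)
    qed
    finally have A: "(\<integral>\<^sup>+z. ?F (snd z) \<partial>G) = a n" .
    have one: "(\<integral>\<^sup>+z. ?F (g z) \<partial>G) \<le> (\<integral>\<^sup>+z. ?F (h z) \<partial>G) + ennreal (K * (c * exp (- c' * real n)))"
      if [measurable]: "g \<in> borel_measurable (borel \<Otimes>\<^sub>M borel)" "h \<in> borel_measurable (borel \<Otimes>\<^sub>M borel)"
        and gh: "\<And>z. norm (g z - h z) = norm (fst z - snd z)" for g h
    proof -
      have "(\<integral>\<^sup>+z. ?F (g z) \<partial>G) \<le> (\<integral>\<^sup>+z. ?F (h z) + ennreal K * ennreal (min 1 (norm (fst z - snd z) powr (1 / 2))) \<partial>G)"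
      proof (rule nn_integral_mono)
        fix z
        have "f (g z) \<le> f (h z) + K * min 1 (norm (fst z - snd z) powr (1 / 2))"
          using Lip[of "g z" "h z"] gh[of z] by auto
        then have "?F (g z) \<le> ennreal (f (h z) + K * min 1 (norm (fst z - snd z) powr (1 / 2)))"
          by (rule ennreal_leI)
        also have "\<dots> = ?F (h z) + ennreal K * ennreal (min 1 (norm (fst z - snd z) powr (1 / 2)))"
          using f01 by (subst ennreal_plus) (auto simp: K_def ennreal_mult)
        finally show "?F (g z) \<le> ?F (h z) + ennreal K * ennreal (min 1 (norm (fst z - snd z) powr (1 / 2)))" .
      qed
      also have "\<dots> = (\<integral>\<^sup>+z. ?F (h z) \<partial>G) + ennreal K * (\<integral>\<^sup>+z. ennreal (min 1 (norm (fst z - snd z) powr (1 / 2))) \<partial>G)"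
        by (subst nn_integral_add, measurable, subst nn_integral_cmult) auto
      also have "\<dots> \<le> (\<integral>\<^sup>+z. ?F (h z) \<partial>G) + ennreal K * ennreal (c * exp (- c' * real n))"
        by (intro add_left_mono mult_left_mono Gle) auto
      finally show ?thesis
        using c by (simp add: ennreal_mult K_def)
    qed
    show ?thesis
      using one[of fst snd] one[of snd fst] by (simp add: A B norm_minus_commute)
  qed
  have "(\<lambda>n. exp (- c' * real n)) \<longlonglongrightarrow> 0"
    using c(2) by real_asymp
  then have e0: "(\<lambda>n. K * (c * exp (- c' * real n))) \<longlonglongrightarrow> 0"
    by (intro tendsto_mult_right_zero)
  have fin: "a n < \<top>" "B < \<top>" for n
    using a_le[of n] B_le by (auto intro: order.strict_trans1)
  have "(\<lambda>n. enn2real (a n)) \<longlonglongrightarrow> enn2real B"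
  proof (rule LIM_zero_cancel, rule Lim_null_comparison[OF _ e0], rule always_eventually, rule allI)
    fix n
    let ?e = "K * (c * exp (- c' * real n))"
    have e: "0 \<le> ?e" using c by (simp add: K_def)
    have "ennreal (enn2real B) \<le> ennreal (enn2real (a n)) + ennreal ?e \<and>
        ennreal (enn2real (a n)) \<le> ennreal (enn2real B) + ennreal ?e"
      using bounds[of n] fin by simp
    then have "enn2real B \<le> enn2real (a n) + ?e \<and> enn2real (a n) \<le> enn2real B + ?e"
      using e by (simp add: ennreal_plus[symmetric] del: ennreal_plus)
    then show "norm (enn2real (a n) - enn2real B) \<le> ?e"
      by auto
  qed
  then have "(\<lambda>n. ennreal (enn2real (a n))) \<longlonglongrightarrow> ennreal (enn2real B)"
    by (rule tendsto_ennrealI)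
  moreover have "(\<lambda>n. ennreal (enn2real (a n))) = a" "ennreal (enn2real B) = B"
    using fin by (simp_all add: fun_eq_iff)
  ultimately show ?thesis
    by (simp only: a_def[abs_def] B_def)
qed

text \<open>For an invariant \<open>\<mu>\<close> the integral of P n f over \<open>\<mu>\<close>
  does not depend on n, while its integrand tends pointwise to the integral of f against
  \<open>stat\<close>. Dominated convergence needs no rate that is uniform in the starting
  point.\<close>

lemma stat_unique:
  assumes \<mu>: "prob_space \<mu>" "sets \<mu> = sets states" and inv: "\<And>t. 0 \<le> t \<Longrightarrow> evolve \<mu> t = \<mu>"
  shows "distr \<mu> borel snd = distr stat borel snd"
proof (rule borel_prob_eqI_lipschitz)
  interpret prob_space \<mu> by fact
  note [measurable_cong] = \<mu>(2)
  show "prob_space (distr \<mu> borel snd)" "prob_space (distr stat borel snd)"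
    using \<mu> prob_space_stat by (auto intro!: prob_space.prob_space_distr)
  fix f :: "'a \<Rightarrow> real" and L
  assume f: "0 \<le> L" "\<And>x y. \<bar>f x - f y\<bar> \<le> L * dist x y" "\<And>x. 0 \<le> f x \<and> f x \<le> 1"
  have "uniformly_continuous_on UNIV f"
    using lipschitz_onI[of UNIV f L] f
    by (intro lipschitz_on_uniformly_continuous) (auto simp: dist_real_def)
  then have "continuous_on UNIV f" by (rule uniformly_continuous_imp_continuous)
  then have [measurable]: "f \<in> borel_measurable borel" by (rule borel_measurable_continuous_onI)
  let ?F = "\<lambda>z :: bool \<times> 'a. ennreal (f (snd z))"
  have "(\<lambda>n. \<integral>\<^sup>+z. P (real n) ?F z \<partial>\<mu>) \<longlonglongrightarrow> (\<integral>\<^sup>+z. (\<integral>\<^sup>+y. ?F y \<partial>stat) \<partial>\<mu>)"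
  proof (rule nn_integral_dominated_convergence[where w = "\<lambda>_. 1"])
    have "P (real n) ?F z \<le> 1" for n z
      unfolding P_def by (rule order_trans[OF nn_integral_mono[of _ _ "\<lambda>_. 1"]]) (use f(3) in auto)
    then show "AE z in \<mu>. P (real n) ?F z \<le> 1" for n by simp
    show "AE z in \<mu>. (\<lambda>n. P (real n) ?F z) \<longlonglongrightarrow> (\<integral>\<^sup>+y. ?F y \<partial>stat)"
      using tendsto_P_stat[OF f] by (intro AE_I2) (metis prod.collapse)
  qed (use emeasure_space_1 in auto)
  moreover have "(\<integral>\<^sup>+z. P (real n) ?F z \<partial>\<mu>) = (\<integral>\<^sup>+z. ?F z \<partial>\<mu>)" for n
    using nn_integral_evolve[OF \<mu>(2), of ?F "real n"] inv[of "real n"] by simp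
  ultimately have "(\<integral>\<^sup>+z. ?F z \<partial>\<mu>) = (\<integral>\<^sup>+z. (\<integral>\<^sup>+y. ?F y \<partial>stat) \<partial>\<mu>)"
    by (simp add: LIMSEQ_const_iff)
  then have "(\<integral>\<^sup>+z. ?F z \<partial>\<mu>) = (\<integral>\<^sup>+y. ?F y \<partial>stat)"
    using emeasure_space_1 by simp
  then show "(\<integral>\<^sup>+x. ennreal (f x) \<partial>distr \<mu> borel snd) = (\<integral>\<^sup>+x. ennreal (f x) \<partial>distr stat borel snd)"
    by (subst (1 2) nn_integral_distr) auto
qed simp_all

section \<open>Sample paths for positive, non-exploding waiting times\<close>

definition good :: "(nat \<Rightarrow> real) \<Rightarrow> bool" where
  "good w \<longleftrightarrow> (\<forall>k. 0 < w k) \<and> unbdd w"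

lemma AE_good: "AE w in \<W>. good w"
  using AE_waits_pos AE_unbdd by eventually_elim (simp add: good_def)

lemma good_rest: "good w \<Longrightarrow> good (rest w)"
proof -
  assume w: "good w"
  have "\<exists>n. t < (\<Sum>k<n. rest w k)" if t: "0 \<le> t" for t
  proof -
    obtain n where n: "t + w 0 < (\<Sum>k<n. w k)" using w by (auto simp: good_def unbdd_def)
    have "0 < w 0" using w by (simp add: good_def)
    then obtain m where "n = Suc m" using n t by (cases n) auto
    then show ?thesis
      using n by (intro exI[of _ m]) (simp add: sum.lessThan_Suc_shift rest_def del: sum.lessThan_Suc)
  qed
  then have "\<exists>n. max 0 t < (\<Sum>k<n. rest w k)" for t
    by (meson max.cobounded1)
  then have "\<exists>n. t < (\<Sum>k<n. rest w k)" for t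
    by (meson max_less_iff_conj)
  then show ?thesis
    using w by (simp add: good_def unbdd_def rest_def)
qed

abbreviation jump_time :: "(nat \<Rightarrow> real) \<Rightarrow> nat \<Rightarrow> real" where
  "jump_time w n \<equiv> (\<Sum>k<n. w k)"

text \<open>The embedded chain: the state right after the n-th jump.\<close>

primrec chain :: "bool \<times> 'a \<Rightarrow> (nat \<Rightarrow> real) \<Rightarrow> nat \<Rightarrow> bool \<times> 'a" where
  "chain z w 0 = z"
| "chain z w (Suc n) = jump (chain z w n) (w n)"

lemma chain_rest: "chain (jump z (w 0)) (rest w) n = chain z w (Suc n)"
  by (induction n) (simp_all add: rest_def)

lemma fst_chain: "fst (chain z w n) = (fst z \<noteq> odd n)"
  by (induction n) (auto simp: jump_def)

lemma jump_time_mono: "good w \<Longrightarrow> m \<le> n \<Longrightarrow> jump_time w m \<le> jump_time w n"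
  by (intro sum_mono2) (auto simp: good_def less_imp_le)

lemma jump_interval:
  assumes w: "good w" and t: "0 \<le> t"
  obtains n where "jump_time w n \<le> t" "t < jump_time w (Suc n)"
proof -
  have ex: "\<exists>n. t < jump_time w n" using w by (simp add: good_def unbdd_def)
  define m where "m = (LEAST n. t < jump_time w n)"
  have m: "t < jump_time w m" unfolding m_def using ex by (rule LeastI_ex)
  then obtain n where n: "m = Suc n" using t by (cases m) auto
  have "\<not> t < jump_time w n"
    using not_less_Least[of n "\<lambda>n. t < jump_time w n"] n m_def by auto
  then show thesis using that[of n] m n by simp
qed

lemma traj_eq_move:
  assumes "good w" "jump_time w n \<le> t" "t < jump_time w (Suc n)"
  shows "traj t z w = move (chain z w n) (t - jump_time w n)"
  using assms
proof (induction n arbitrary: t z w)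
  case 0
  then show ?case by (subst traj_rec) (auto simp: good_def)
next
  case (Suc n)
  have sh: "jump_time w (Suc m) = w 0 + jump_time (rest w) m" for m
    by (simp add: sum.lessThan_Suc_shift rest_def del: sum.lessThan_Suc)
  have nonneg: "0 \<le> jump_time (rest w) n"
    using jump_time_mono[OF good_rest[OF Suc.prems(1)], of 0 n] by simp
  have pos: "0 < w 0" using Suc.prems(1) by (simp add: good_def)
  have t0: "0 \<le> t" "\<not> t < w 0"
    using Suc.prems(2) sh[of n] nonneg pos by linarith+
  have "traj t z w = traj (t - w 0) (jump z (w 0)) (rest w)"
    using traj_rec[OF t0(1), of w z] t0(2) Suc.prems(1) by (simp add: good_def)
  also have "\<dots> = move (chain (jump z (w 0)) (rest w) n) (t - w 0 - jump_time (rest w) n)"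
    using Suc.prems sh[of n] sh[of "Suc n"] by (intro Suc.IH good_rest) (simp_all del: sum.lessThan_Suc)
  also have "\<dots> = move (chain z w (Suc n)) (t - jump_time w (Suc n))"
    unfolding chain_rest sh by (simp only: diff_diff_eq)
  finally show ?case .
qed

lemma switching_path_eq:
  assumes w: "good w" and t: "jump_time w n \<le> t" "t < jump_time w (Suc n)"
  shows "switching_path j w t = (j \<noteq> odd n)"
proof -
  \<comment> \<open>The sum over l up to and including k is \<open>jump_time w (Suc k)\<close>, so
    exactly the indices below n are counted.\<close>
  have "{k. (\<Sum>l\<le>k. w l) \<le> t} = {..<n}"
  proof (intro set_eqI iffI)
    fix k assume "k \<in> {k. (\<Sum>l\<le>k. w l) \<le> t}"
    then have "jump_time w (Suc k) \<le> t" by (simp add: lessThan_Suc_atMost)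
    then have "\<not> Suc n \<le> Suc k" using jump_time_mono[OF w, of "Suc n" "Suc k"] t by linarith
    then show "k \<in> {..<n}" by simp
  next
    fix k assume "k \<in> {..<n}"
    then show "k \<in> {k. (\<Sum>l\<le>k. w l) \<le> t}"
      using jump_time_mono[OF w, of "Suc k" n] t by (simp add: lessThan_Suc_atMost[symmetric] del: sum.lessThan_Suc)
  qed
  then show ?thesis by (simp add: switching_path_def)
qed

lemma fst_traj: "good w \<Longrightarrow> 0 \<le> t \<Longrightarrow> fst (traj t z w) = switching_path (fst z) w t"
proof -
  assume w: "good w" and "0 \<le> t"
  then obtain n where n: "jump_time w n \<le> t" "t < jump_time w (Suc n)"
    by (rule jump_interval)
  show ?thesis
    unfolding traj_eq_move[OF w n] switching_path_eq[OF w n] by (simp add: move_def fst_chain)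
qed

text \<open>The position does not change at a jump, so the formula extends to the right end of the
  interval, where the index has already flipped. Consecutive closed intervals can then be glued to a
  continuous path.\<close>

lemma snd_traj_interval:
  assumes w: "good w" and t: "jump_time w n \<le> t" "t \<le> jump_time w (Suc n)"
  shows "snd (traj t z w) = \<phi> (fst z \<noteq> odd n) (t - jump_time w n) (snd (chain z w n))"
proof (cases "t = jump_time w (Suc n)")
  case True
  have "traj t z w = move (chain z w (Suc n)) (t - jump_time w (Suc n))"
    using w True by (intro traj_eq_move) (auto simp: good_def)
  then show ?thesis
    using True by (simp add: jump_def fst_chain)
next
  case False
  then show ?thesis
    using t w by (subst traj_eq_move[of w n]) (simp_all add: move_def fst_chain)
qed

lemma continuous_on_traj:
  assumes w: "good w"
  shows "continuous_on {0..} (\<lambda>t. snd (traj t z w))"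
proof -
  have \<phi>: "continuous_on UNIV (\<lambda>t. \<phi> j (t - a) x)" for j a x
  proof -
    have "continuous_on UNIV ((\<lambda>(t, x). \<phi> j t x) \<circ> (\<lambda>t. (t - a, x)))"
      by (intro continuous_on_compose continuous_intros continuous_on_subset[OF \<phi>_cont]) auto
    then show ?thesis by (simp add: o_def)
  qed
  have seg: "continuous_on {jump_time w n..jump_time w (Suc n)} (\<lambda>t. snd (traj t z w))" for n
    by (rule continuous_on_cong[THEN iffD1, OF refl _ continuous_on_subset[OF \<phi> subset_UNIV]])
       (auto simp: snd_traj_interval[OF w] simp del: sum.lessThan_Suc)
  have upto: "continuous_on {0..jump_time w n} (\<lambda>t. snd (traj t z w))" for n
  proof (induction n)
    case (Suc n)
    have eq: "{0..jump_time w (Suc n)} = {0..jump_time w n} \<union> {jump_time w n..jump_time w (Suc n)}"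
      using jump_time_mono[OF w, of 0 n] jump_time_mono[OF w, of n "Suc n"] by auto
    show ?case
      unfolding eq by (rule continuous_on_closed_Un[OF closed_atLeastAtMost closed_atLeastAtMost Suc seg])
  qed simp
  show ?thesis
    unfolding continuous_on_eq_continuous_within
  proof
    fix t :: real assume t: "t \<in> {0..}"
    obtain n where n: "t < jump_time w n" using w by (auto simp: good_def unbdd_def)
    have "continuous (at t within {0..jump_time w n}) (\<lambda>t. snd (traj t z w))"
      using upto[of n] t n by (auto simp: continuous_on_eq_continuous_within)
    moreover have "at t within {0..jump_time w n} = at t within {0..}"
      by (rule at_within_nhd[of _ "{..<jump_time w n}"]) (use n in auto)
    ultimately show "continuous (at t within {0..}) (\<lambda>t. snd (traj t z w))"
      by simp
  qed
qed

text \<open>The index flips at the end of the jump interval containing a, so c lies at or before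
  that end. The index is fixed on the half-open interval only, hence c may itself be a jump
  time.\<close>

lemma traj_constant_index:
  assumes w: "good w" and ac: "0 \<le> a" "a < c"
    and const: "\<And>s. s \<in> {a..<c} \<Longrightarrow> switching_path (fst z) w s = j" and t: "t \<in> {a..c}"
  shows "snd (traj t z w) = \<phi> j (t - a) (snd (traj a z w))"
proof -
  obtain n where n: "jump_time w n \<le> a" "a < jump_time w (Suc n)"
    using jump_interval[OF w ac(1)] .
  have j: "j = (fst z \<noteq> odd n)"
    using const[of a] ac switching_path_eq[OF w n] by simp
  have c: "c \<le> jump_time w (Suc n)"
  proof (rule ccontr)
    assume "\<not> c \<le> jump_time w (Suc n)"
    then have "switching_path (fst z) w (jump_time w (Suc n)) = j"
      using n by (intro const) simp
    moreover have "switching_path (fst z) w (jump_time w (Suc n)) = (fst z \<noteq> odd (Suc n))"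
      using w by (intro switching_path_eq) (auto simp: good_def)
    ultimately show False using j by (cases "even n"; cases "fst z") simp_all
  qed
  have "snd (traj t z w) = \<phi> j ((a - jump_time w n) + (t - a)) (snd (chain z w n))"
    using t n c by (subst snd_traj_interval[OF w, of n]) (auto simp: j)
  also have "\<dots> = \<phi> j (t - a) (\<phi> j (a - jump_time w n) (snd (chain z w n)))"
    using t n by (intro \<phi>_add) auto
  also have "\<phi> j (a - jump_time w n) (snd (chain z w n)) = snd (traj a z w)"
    using n by (subst snd_traj_interval[OF w, of n]) (auto simp: j)
  finally show ?thesis .
qed

text \<open>The flow assumption, applied to successive jump intervals including their right ends,
  determines the position at all jump times by induction, and then in between.\<close>

lemma traj_unique:
  assumes w: "good w" and init: "\<theta> 0 = x"
    and i: "\<And>t. 0 \<le> t \<Longrightarrow> i t = switching_path j w t"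
    and flow: "\<And>a c j t. 0 \<le> a \<Longrightarrow> a < c \<Longrightarrow> (\<And>s. s \<in> {a..<c} \<Longrightarrow> i s = j) \<Longrightarrow> t \<in> {a..c} \<Longrightarrow> \<theta> t = \<phi> j (t - a) (\<theta> a)"
    and t: "0 \<le> t"
  shows "(i t, \<theta> t) = traj t (j, x) w"
proof -
  have seg: "\<theta> t = \<phi> (j \<noteq> odd n) (t - jump_time w n) (\<theta> (jump_time w n))"
    if "jump_time w n \<le> t" "t \<le> jump_time w (Suc n)" for n t
  proof (rule flow)
    show "0 \<le> jump_time w n" using jump_time_mono[OF w, of 0 n] by simp
    then show "i s = (j \<noteq> odd n)" if "s \<in> {jump_time w n..<jump_time w (Suc n)}" for s
      using that switching_path_eq[OF w, of n s] i[of s] by (simp del: sum.lessThan_Suc)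
    show "jump_time w n < jump_time w (Suc n)" using w by (simp add: good_def)
  qed (use that in auto)
  have chain: "\<theta> (jump_time w n) = snd (chain (j, x) w n)" for n
  proof (induction n)
    case (Suc n)
    have "jump_time w n \<le> jump_time w (Suc n)" by (rule jump_time_mono[OF w]) simp
    from seg[OF this order_refl] show ?case
      by (simp add: Suc jump_def fst_chain)
  qed (simp add: init)
  obtain n where n: "jump_time w n \<le> t" "t < jump_time w (Suc n)"
    using jump_interval[OF w t] .
  have "\<theta> t = snd (traj t (j, x) w)"
    using n by (subst snd_traj_interval[OF w, of n], simp_all del: sum.lessThan_Suc)
      (subst seg[of n], simp_all add: chain del: sum.lessThan_Suc)
  moreover have "i t = fst (traj t (j, x) w)"
    using t w by (simp add: i fst_traj)
  ultimately show ?thesis by (simp add: prod_eq_iff)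
qed

end

section \<open>The stochastic approximation\<close>

lemma solves_inclusion_cong:
  assumes "\<And>t. t \<in> {a..c} \<Longrightarrow> x t = y t" "a \<le> c" "solves_inclusion F a c x"
  shows "solves_inclusion F a c y"
proof -
  obtain v where v: "set_integrable lborel {a..c} v"
      "\<forall>t\<in>{a..c}. x t = x a + (LINT s:{a..t}|lborel. v s)"
      "AE s\<in>{a..c} in lborel. v s \<in> F (x s)"
    using assms(3) unfolding solves_inclusion_def by blast
  show ?thesis
    unfolding solves_inclusion_def
  proof (intro exI[of _ v] conjI ballI v(1))
    fix t assume t: "t \<in> {a..c}"
    then show "y t = y a + (LINT s:{a..t}|lborel. v s)"
      using v(2) assms(1)[of t] assms(1)[of a] assms(2) by auto
  next
    show "AE s\<in>{a..c} in lborel. v s \<in> F (y s)"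
      using v(3) by eventually_elim (auto simp: assms(1))
  qed
qed

locale sparse_inversion = switching_rate lam for lam :: real +
  fixes A :: "real^'n^'m" and b :: "real^'m" and \<kappa> :: real
  assumes full_rank: "rank A = CARD('n)" and \<kappa>_pos: "0 < \<kappa>"
    and bounded_below: "\<And>v. \<kappa> * norm v \<le> norm (A *v v)"
begin

sublocale switched_flow lam "flow A b" "\<kappa>\<^sup>2" "norm (transpose A *v b) / \<kappa>\<^sup>2"
proof
  show "norm (flow A b j t x - flow A b j t y) \<le> exp (- (if j then 0 else \<kappa>\<^sup>2) * t) * norm (x - y)"
    if "0 \<le> t" for j t x y
    using full_rank bounded_below \<kappa>_pos that by (intro flow_contract) auto
  show "norm (flow A b j t x) \<le> r" if "0 \<le> t" "norm x \<le> r" "norm (transpose A *v b) / \<kappa>\<^sup>2 \<le> r" for j t x r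
    using data_flow_ball[OF full_rank bounded_below \<kappa>_pos that] reg_flow_ball[OF that(1), of x] that
    by (simp add: flow_def del: transpose_matrix_vector)
qed (use full_rank \<kappa>_pos in \<open>simp_all add: flow_continuous flow_zero flow_add\<close>)

text \<open>The explicit flow is one solution and monotonicity excludes any other. From here on the
  inclusion is replaced by the flow.\<close>

lemma inclusion_eq_flow:
  assumes \<theta>: "solves_inclusion (drift A b j) a c \<theta>" "continuous_on {a..c} \<theta>" and t: "t \<in> {a..c}"
  shows "\<theta> t = flow A b j (t - a) (\<theta> a)"
proof (rule monotone_inclusion_unique[OF drift_monotone \<theta>(1) _ \<theta>(2) _ _ t])
  show "solves_inclusion (drift A b j) a c (\<lambda>t. flow A b j (t - a) (\<theta> a))"
    using t by (intro flow_solves full_rank) auto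
  have "continuous_on {a..c} ((\<lambda>(t, x). flow A b j t x) \<circ> (\<lambda>t. (t - a, \<theta> a)))"
    by (intro continuous_on_compose continuous_intros continuous_on_subset[OF \<phi>_cont]) auto
  then show "continuous_on {a..c} (\<lambda>t. flow A b j (t - a) (\<theta> a))"
    by (simp add: o_def)
qed (auto simp: flow_zero)

text \<open>Almost every path is the deterministic function \<open>traj\<close> of the initial index
  and the waiting times, and the joint law of these is a product measure. Hence the law at time t
  depends on the realisation only through the law q of the initial index.\<close>

lemma stochastic_approximation_law:
  assumes S: "stochastic_approximation M lam A b x i \<theta>" and t: "0 \<le> t"
  defines "q \<equiv> distr M (count_space UNIV) (i 0)"
  shows "distr M states (\<lambda>\<omega>. (i t \<omega>, \<theta> t \<omega>)) = evolve (start q x) t"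
    and "prob_space q" and "sets q = sets (count_space UNIV)"
proof -
  have I: "index_process M lam i" and \<theta>_meas [measurable]: "\<And>t. 0 \<le> t \<Longrightarrow> \<theta> t \<in> borel_measurable M"
    and \<theta>: "AE \<omega> in M. \<theta> 0 \<omega> = x \<and> continuous_on {0..} (\<lambda>t. \<theta> t \<omega>) \<and>
       (\<forall>a c j. 0 \<le> a \<and> a < c \<and> (\<forall>s\<in>{a..<c}. i s \<omega> = j) \<longrightarrow> solves_inclusion (drift A b j) a c (\<lambda>t. \<theta> t \<omega>))"
    using S by (auto simp: stochastic_approximation_def)
  interpret M: prob_space M using I by (simp add: index_process_def)
  have i_meas [measurable]: "\<And>t. 0 \<le> t \<Longrightarrow> i t \<in> M \<rightarrow>\<^sub>M count_space UNIV"
    using I by (simp add: index_process_def)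
  have [measurable]: "i 0 \<in> M \<rightarrow>\<^sub>M count_space UNIV" by (rule i_meas) simp
  obtain W where W: "\<And>k. distributed M lborel (W k) (exponential_density lam)"
    and indep_W: "M.indep_vars (\<lambda>_. borel) W UNIV"
    and indep: "M.indep_set (sets (vimage_algebra (space M) (i 0) (count_space UNIV)))
         (sets (vimage_algebra (space M) (\<lambda>\<omega> k. W k \<omega>) (Pi\<^sub>M UNIV (\<lambda>_. borel))))"
    and i_eq: "AE \<omega> in M. \<forall>t\<ge>0. i t \<omega> = switching_path (i 0 \<omega>) (\<lambda>k. W k \<omega>) t"
    using I unfolding index_process_def by blast
  have [measurable]: "W k \<in> borel_measurable M" for k
    using distributed_measurable[OF W[of k]] by simp
  let ?W = "\<lambda>\<omega> k. W k \<omega>"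
  have W_meas [measurable]: "?W \<in> M \<rightarrow>\<^sub>M (\<Pi>\<^sub>M k\<in>UNIV. borel)"
    by (rule measurable_PiM_single') auto
  have W_meas' [measurable]: "?W \<in> M \<rightarrow>\<^sub>M \<W>" by measurable
  have W_law: "distr M \<W> ?W = \<W>"
  proof -
    have "distr M (\<Pi>\<^sub>M k\<in>UNIV. borel) (\<lambda>\<omega>. \<lambda>k\<in>UNIV. W k \<omega>) = (\<Pi>\<^sub>M k\<in>UNIV. distr M borel (W k))"
      using indep_W by (subst (asm) M.indep_vars_iff_distr_eq_PiM') auto
    moreover have "distr M borel (W k) = \<E>" for k
      using distributed_distr_eq_density[OF W[of k]] distr_cong[OF refl sets_lborel refl, of M "W k"]
      by (simp add: expm_def)
    ultimately have "distr M (\<Pi>\<^sub>M k\<in>UNIV. borel) ?W = \<W>"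
      by (simp add: waits_def restrict_def)
    moreover have "distr M \<W> ?W = distr M (\<Pi>\<^sub>M k\<in>UNIV. borel) ?W"
      by (rule distr_cong) (simp_all add: sets_waits)
    ultimately show ?thesis by simp
  qed
  show q: "prob_space q" "sets q = sets (count_space UNIV)"
    unfolding q_def by (auto intro: M.prob_space_distr)
  note [measurable_cong] = q(2)
  \<comment> \<open>Independence of the initial index from the whole sequence of waiting times,
    checked on rectangles.\<close>
  have joint: "q \<Otimes>\<^sub>M \<W> = distr M (count_space UNIV \<Otimes>\<^sub>M \<W>) (\<lambda>\<omega>. (i 0 \<omega>, ?W \<omega>))"
  proof (rule pair_measure_eqI)
    show "sigma_finite_measure q" "sigma_finite_measure \<W>"
      using q(1) PW.prob_space_axioms by (simp_all add: prob_space_imp_sigma_finite)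
    fix B C assume "B \<in> sets q" and C [measurable]: "C \<in> sets \<W>"
    then have [measurable]: "B \<in> sets (count_space UNIV)" by simp
    have "i 0 -` B \<inter> space M \<in> sets (vimage_algebra (space M) (i 0) (count_space UNIV))"
      by (rule in_vimage_algebra) simp
    moreover have "?W -` C \<inter> space M \<in> sets (vimage_algebra (space M) ?W (\<Pi>\<^sub>M k\<in>UNIV. borel))"
      using C by (intro in_vimage_algebra) (simp add: sets_waits)
    ultimately have prod: "M.prob ((i 0 -` B \<inter> space M) \<inter> (?W -` C \<inter> space M))
        = M.prob (i 0 -` B \<inter> space M) * M.prob (?W -` C \<inter> space M)"
      by (rule M.indep_setD[OF indep])
    have "emeasure q B * emeasure \<W> C = emeasure q B * emeasure (distr M \<W> ?W) C"
      by (simp only: W_law)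
    also have "\<dots> = ennreal (M.prob (i 0 -` B \<inter> space M) * M.prob (?W -` C \<inter> space M))"
      unfolding q_def by (simp add: emeasure_distr M.emeasure_eq_measure ennreal_mult)
    also have "\<dots> = emeasure M ((i 0 -` B \<inter> space M) \<inter> (?W -` C \<inter> space M))"
      by (simp only: prod[symmetric] M.emeasure_eq_measure)
    also have "(i 0 -` B \<inter> space M) \<inter> (?W -` C \<inter> space M) = (\<lambda>\<omega>. (i 0 \<omega>, ?W \<omega>)) -` (B \<times> C) \<inter> space M"
      by auto
    also have "emeasure M \<dots> = emeasure (distr M (count_space UNIV \<Otimes>\<^sub>M \<W>) (\<lambda>\<omega>. (i 0 \<omega>, ?W \<omega>))) (B \<times> C)"
      by (rule emeasure_distr[symmetric]) auto
    finally show "emeasure q B * emeasure \<W> C = emeasure (distr M (count_space UNIV \<Otimes>\<^sub>M \<W>) (\<lambda>\<omega>. (i 0 \<omega>, ?W \<omega>))) (B \<times> C)" .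
  next
    have "sets (q \<Otimes>\<^sub>M \<W>) = sets (count_space UNIV \<Otimes>\<^sub>M \<W>)"
      by (rule sets_pair_measure_cong[OF q(2) refl])
    then show "sets (q \<Otimes>\<^sub>M \<W>) = sets (distr M (count_space UNIV \<Otimes>\<^sub>M \<W>) (\<lambda>\<omega>. (i 0 \<omega>, ?W \<omega>)))"
      by simp
  qed
  have "AE \<omega> in M. good (?W \<omega>)"
  proof -
    have "AE w in distr M \<W> ?W. good w"
      unfolding W_law by (rule AE_good)
    then show ?thesis by (rule AE_distrD[OF W_meas'])
  qed
  then have ae: "AE \<omega> in M. (i t \<omega>, \<theta> t \<omega>) = traj t (i 0 \<omega>, x) (?W \<omega>)"
    using \<theta> i_eq
  proof eventually_elim
    case (elim \<omega>)
    then have init: "\<theta> 0 \<omega> = x" and cont: "continuous_on {0..} (\<lambda>t. \<theta> t \<omega>)"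
      and incl: "\<And>a c j. 0 \<le> a \<Longrightarrow> a < c \<Longrightarrow> \<forall>s\<in>{a..<c}. i s \<omega> = j \<Longrightarrow> solves_inclusion (drift A b j) a c (\<lambda>t. \<theta> t \<omega>)"
      by blast+
    show ?case
    proof (rule traj_unique[where \<theta> = "\<lambda>t. \<theta> t \<omega>" and i = "\<lambda>t. i t \<omega>"])
      fix a c :: real and j t
      assume a: "0 \<le> a" "a < c" "\<And>s. s \<in> {a..<c} \<Longrightarrow> i s \<omega> = j" "t \<in> {a..c}"
      show "\<theta> t \<omega> = flow A b j (t - a) (\<theta> a \<omega>)"
      proof (rule inclusion_eq_flow[where c = c])
        show "solves_inclusion (drift A b j) a c (\<lambda>t. \<theta> t \<omega>)"
          using a by (intro incl) blast+
        show "continuous_on {a..c} (\<lambda>t. \<theta> t \<omega>)"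
          using a(1) by (intro continuous_on_subset[OF cont]) auto
      qed fact
    qed (use elim(1,3) init t in blast)+
  qed
  have [measurable]: "(\<lambda>\<omega>. (i t \<omega>, \<theta> t \<omega>)) \<in> M \<rightarrow>\<^sub>M states"
    using t by measurable
  have "distr M states (\<lambda>\<omega>. (i t \<omega>, \<theta> t \<omega>)) = distr M states (\<lambda>\<omega>. traj t (i 0 \<omega>, x) (?W \<omega>))"
    using ae by (intro distr_cong_AE) auto
  also have "\<dots> = distr (distr M (count_space UNIV \<Otimes>\<^sub>M \<W>) (\<lambda>\<omega>. (i 0 \<omega>, ?W \<omega>))) states (\<lambda>(j, w). traj t (j, x) w)"
    by (subst distr_distr) (auto simp: o_def)
  also have "\<dots> = distr (q \<Otimes>\<^sub>M \<W>) states (\<lambda>(j, w). traj t (j, x) w)"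
    unfolding joint ..
  also have "\<dots> = evolve (start q x) t"
  proof (rule measure_eqI)
    fix B assume "B \<in> sets (distr (q \<Otimes>\<^sub>M \<W>) states (\<lambda>(j, w). traj t (j, x) w))"
    then have B [measurable]: "B \<in> sets states" by simp
    have "emeasure (distr (q \<Otimes>\<^sub>M \<W>) states (\<lambda>(j, w). traj t (j, x) w)) B
        = (\<integral>\<^sup>+y. indicator B (traj t (fst y, x) (snd y)) \<partial>(q \<Otimes>\<^sub>M \<W>))"
      by (subst nn_integral_indicator[symmetric], simp, subst nn_integral_distr) (auto simp: split_def)
    also have "\<dots> = (\<integral>\<^sup>+j. P t (indicator B) (j, x) \<partial>q)"
      unfolding P_def by (subst PW.nn_integral_fst[symmetric]) auto
    also have "\<dots> = (\<integral>\<^sup>+z. P t (indicator B) z \<partial>start q x)"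
    proof -
      have "(\<lambda>z. P t (indicator B) z) \<in> borel_measurable states" by measurable
      then show ?thesis
        unfolding start_def by (subst nn_integral_distr) auto
    qed
    finally show "emeasure (distr (q \<Otimes>\<^sub>M \<W>) states (\<lambda>(j, w). traj t (j, x) w)) B = emeasure (evolve (start q x) t) B"
      by (simp add: emeasure_evolve)
  qed simp
  finally show "distr M states (\<lambda>\<omega>. (i t \<omega>, \<theta> t \<omega>)) = evolve (start q x) t" .
qed

text \<open>The description of the transition kernel by \<open>THE\<close> needs a realisation on
  the sequence space. A deterministic initial index suffices, because the kernel starts from a
  single state.\<close>

lemma stochastic_approximation_exists:
  "\<exists>i \<theta>. stochastic_approximation \<W> lam A b x i \<theta> \<and> (\<forall>\<omega>. i 0 \<omega> = j)"
proof -
  have good_sets [measurable]: "{w. good w} \<in> sets (\<Pi>\<^sub>M k\<in>UNIV. borel)"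
  proof -
    have "unbdd w \<longleftrightarrow> (\<forall>m::nat. \<exists>n. real m < (\<Sum>k<n. w k))" for w
      unfolding unbdd_def by (meson order.strict_trans reals_Archimedean2)
    then have eq: "{w. good w} = {w \<in> space (\<Pi>\<^sub>M k\<in>UNIV. borel). (\<forall>k. 0 < w k) \<and> (\<forall>m::nat. \<exists>n. real m < (\<Sum>k<n. w k))}"
      by (auto simp: good_def space_PiM)
    show ?thesis unfolding eq by measurable
  qed
  \<comment> \<open>Exceptional sequences are replaced by the constant 1, which is
    \<open>good\<close>, so that continuity and the inclusions hold for every w.\<close>
  define reg :: "(nat \<Rightarrow> real) \<Rightarrow> nat \<Rightarrow> real" where "reg w = (if w \<in> {w. good w} then w else (\<lambda>_. 1))" for w
  have [measurable]: "reg \<in> (\<Pi>\<^sub>M k\<in>UNIV. borel) \<rightarrow>\<^sub>M (\<Pi>\<^sub>M k\<in>UNIV. borel)"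
  proof -
    have "(\<lambda>_ _. 1 :: real) \<in> (\<Pi>\<^sub>M k\<in>(UNIV :: nat set). borel) \<rightarrow>\<^sub>M (\<Pi>\<^sub>M k\<in>(UNIV :: nat set). borel)"
      by (rule measurable_const) (simp add: space_PiM)
    then show ?thesis
      unfolding reg_def by (intro measurable_If_set measurable_ident) (auto simp: space_PiM)
  qed
  have "unbdd (\<lambda>_. 1)"
    by (simp add: unbdd_def reals_Archimedean2)
  then have reg: "good (reg w)" for w
    by (simp add: reg_def good_def)
  define i where "i t w = fst (traj t (j, x) (reg w))" for t w
  define \<theta> where "\<theta> t w = snd (traj t (j, x) (reg w))" for t w
  have i_eq: "i t w = switching_path j (reg w) t" if "0 \<le> t" for t w
    using fst_traj[OF reg that] by (simp add: i_def)
  have path0: "traj 0 (j, x) (reg w) = (j, x)" for w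
    using reg[of w] by (subst traj_rec) (auto simp: good_def)
  have i0: "i 0 w = j" and \<theta>0: "\<theta> 0 w = x" for w
    by (simp_all add: i_def \<theta>_def path0)
  have i_meas: "i t \<in> \<W> \<rightarrow>\<^sub>M count_space UNIV" for t
    unfolding i_def by (rule measurable_compose[OF _ measurable_fst]) measurable
  have \<theta>_meas: "\<theta> t \<in> borel_measurable \<W>" for t
    unfolding \<theta>_def by measurable
  have "index_process \<W> lam i"
    unfolding index_process_def
  proof (intro conjI allI impI exI[of _ "\<lambda>k w. w k"])
    show "prob_space \<W>" by (rule PW.prob_space_axioms)
    show "i t \<in> \<W> \<rightarrow>\<^sub>M count_space UNIV" for t by (rule i_meas)
    have comp: "distr \<W> \<E> (\<lambda>w. w k) = \<E>" for k
      unfolding waits_def by (rule distr_PiM_component) (auto intro: E.prob_space_axioms)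
    show "distributed \<W> lborel (\<lambda>w. w k) (exponential_density lam)" for k
      unfolding distributed_def
    proof (intro conjI)
      have "distr \<W> lborel (\<lambda>w. w k) = distr \<W> \<E> (\<lambda>w. w k)"
        by (rule distr_cong) simp_all
      then show "distr \<W> lborel (\<lambda>w. w k) = density lborel (\<lambda>r. ennreal (exponential_density lam r))"
        using comp[of k] by (simp add: expm_def)
    qed measurable
    show "PW.indep_vars (\<lambda>_. borel) (\<lambda>k w. w k) UNIV"
    proof (subst PW.indep_vars_iff_distr_eq_PiM')
      have "distr \<W> borel (\<lambda>w. w k) = \<E>" for k
        by (subst comp[of k, symmetric], rule distr_cong) simp_all
      then have "(\<Pi>\<^sub>M k\<in>UNIV. distr \<W> borel (\<lambda>w. w k)) = \<W>"
        by (simp add: waits_def)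
      moreover have "distr \<W> (\<Pi>\<^sub>M k\<in>UNIV. borel) (\<lambda>w. w) = \<W>"
        by (rule distr_id2) (simp add: sets_waits)
      ultimately show "distr \<W> (\<Pi>\<^sub>M k\<in>UNIV. borel) (\<lambda>w. \<lambda>k\<in>UNIV. w k) = (\<Pi>\<^sub>M k\<in>UNIV. distr \<W> borel (\<lambda>w. w k))"
        by (simp add: restrict_def)
    qed auto
    show "PW.indep_set (sets (vimage_algebra (space \<W>) (i 0) (count_space UNIV)))
       (sets (vimage_algebra (space \<W>) (\<lambda>w k. w k) (\<Pi>\<^sub>M k\<in>UNIV. borel)))"
    proof (rule PW.indep_setI)
      have c: "sets (vimage_algebra (space \<W>) (i 0) (count_space UNIV)) = {i 0 -` B \<inter> space \<W> |B. B \<in> sets (count_space UNIV)}"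
        by (rule sets_vimage_algebra2) simp
      \<comment> \<open>The initial index is constant, so it generates the trivial sigma-algebra,
        which is independent of everything.\<close>
      have triv: "a = {} \<or> a = UNIV" if a: "a \<in> sets (vimage_algebra (space \<W>) (i 0) (count_space UNIV))" for a
      proof -
        from a obtain B where "a = i 0 -` B \<inter> space \<W>" unfolding c by blast
        then show ?thesis by (cases "j \<in> B") (auto simp: vimage_def i0)
      qed
      show "sets (vimage_algebra (space \<W>) (i 0) (count_space UNIV)) \<subseteq> PW.events"
      proof
        fix a assume "a \<in> sets (vimage_algebra (space \<W>) (i 0) (count_space UNIV))"
        with triv[of a] sets.top[of \<W>] show "a \<in> PW.events" by auto
      qed
      have w: "sets (vimage_algebra (space \<W>) (\<lambda>w k. w k) (\<Pi>\<^sub>M k\<in>UNIV. borel)) = {(\<lambda>w k. w k) -` B \<inter> space \<W> |B. B \<in> sets (\<Pi>\<^sub>M k\<in>(UNIV :: nat set). (borel :: real measure))}"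
        by (rule sets_vimage_algebra2) (simp add: space_PiM)
      show "sets (vimage_algebra (space \<W>) (\<lambda>w k. w k) (\<Pi>\<^sub>M k\<in>UNIV. borel)) \<subseteq> PW.events"
        unfolding w by (auto simp: sets_waits)
      fix a c assume "a \<in> sets (vimage_algebra (space \<W>) (i 0) (count_space UNIV))"
      then show "PW.prob (a \<inter> c) = PW.prob a * PW.prob c"
        using triv[of a] PW.prob_space by auto
    qed
    show "AE w in \<W>. \<forall>t\<ge>0. i t w = switching_path (i 0 w) (\<lambda>k. w k) t"
      using AE_good
    proof eventually_elim
      case (elim w)
      then have "reg w = w" by (simp add: reg_def)
      then show ?case using i_eq[of _ w] i0 by simp
    qed
  qed
  moreover have "solves_inclusion (drift A b j') a c (\<lambda>t. \<theta> t w)"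
    if "0 \<le> a" "a < c" "\<forall>s\<in>{a..<c}. i s w = j'" for a c j' w
  proof (rule solves_inclusion_cong)
    show "solves_inclusion (drift A b j') a c (\<lambda>t. flow A b j' (t - a) (\<theta> a w))"
      using that by (intro flow_solves full_rank) simp
    show "flow A b j' (t - a) (\<theta> a w) = \<theta> t w" if "t \<in> {a..c}" for t
      unfolding \<theta>_def
      using traj_constant_index[OF reg \<open>0 \<le> a\<close> \<open>a < c\<close> _ that, of "(j, x)" w j'] \<open>0 \<le> a\<close> i_eq[of _ w] \<open>\<forall>s\<in>{a..<c}. i s w = j'\<close>
      by simp
  qed (use that in simp)
  ultimately have "stochastic_approximation \<W> lam A b x i \<theta>"
    unfolding stochastic_approximation_def
    using \<theta>_meas \<theta>0 continuous_on_traj[OF reg] by (auto simp: \<theta>_def)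
  then show ?thesis using i0 by blast
qed

text \<open>Existence provides a candidate for \<open>THE\<close>, and the common law of all
  realisations with the same start makes it the only one.\<close>

lemma transition_kernel_eq:
  assumes t: "0 \<le> t"
  shows "transition_kernel lam A b t z = evolve (start (return (count_space UNIV) (fst z)) (snd z)) t"
  unfolding transition_kernel_def
proof (rule the_equality)
  let ?K = "evolve (start (return (count_space UNIV) (fst z)) (snd z)) t"
  have law: "distr M states (\<lambda>\<omega>. (i t \<omega>, \<theta> t \<omega>)) = ?K"
    if S: "stochastic_approximation M lam A b (snd z) i \<theta>" and i0: "AE \<omega> in M. i 0 \<omega> = fst z"
    for M :: "(nat \<Rightarrow> real) measure" and i \<theta>
  proof -
    have M: "prob_space M" and [measurable]: "i 0 \<in> M \<rightarrow>\<^sub>M count_space UNIV"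
      using S by (auto simp: stochastic_approximation_def index_process_def)
    have "distr M (count_space UNIV) (i 0) = distr M (count_space UNIV) (\<lambda>_. fst z)"
      using i0 by (intro distr_cong_AE) auto
    also have "\<dots> = return (count_space UNIV) (fst z)"
      using M by (intro prob_space.distr_const) auto
    finally show ?thesis
      using stochastic_approximation_law(1)[OF S t] by simp
  qed
  obtain i \<theta> where S: "stochastic_approximation \<W> lam A b (snd z) i \<theta>" and i0: "\<forall>\<omega>. i 0 \<omega> = fst z"
    using stochastic_approximation_exists by blast
  show "\<exists>(M :: (nat \<Rightarrow> real) measure) i \<theta>. stochastic_approximation M lam A b (snd z) i \<theta> \<and>
      (AE \<omega> in M. i 0 \<omega> = fst z) \<and> ?K = distr M states (\<lambda>\<omega>. (i t \<omega>, \<theta> t \<omega>))"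
    using S i0 law[OF S] by (intro exI[of _ \<W>] exI[of _ i] exI[of _ \<theta>]) simp
  show "\<kappa> = ?K" if "\<exists>(M :: (nat \<Rightarrow> real) measure) i \<theta>. stochastic_approximation M lam A b (snd z) i \<theta> \<and>
      (AE \<omega> in M. i 0 \<omega> = fst z) \<and> \<kappa> = distr M states (\<lambda>\<omega>. (i t \<omega>, \<theta> t \<omega>))" for \<kappa>
    using that law by blast
qed

lemma emeasure_transition_kernel:
  assumes t: "0 \<le> t" and B [measurable]: "B \<in> sets states"
  shows "emeasure (transition_kernel lam A b t z) B = P t (indicator B) z"
proof -
  have "(\<lambda>z. P t (indicator B) z) \<in> borel_measurable states" by measurable
  then show ?thesis
    unfolding transition_kernel_eq[OF t] start_def
    by (subst distr_return) (auto simp: emeasure_evolve nn_integral_return)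
qed

lemma invariant_measure_iff:
  "invariant_measure lam A b \<mu> \<longleftrightarrow>
    prob_space \<mu> \<and> sets \<mu> = sets states \<and> (\<forall>t\<ge>0. evolve \<mu> t = \<mu>)"
proof (cases "sets \<mu> = sets states")
  case True
  have "(\<forall>B\<in>sets \<mu>. (\<integral>\<^sup>+z. emeasure (transition_kernel lam A b t z) B \<partial>\<mu>) = emeasure \<mu> B) \<longleftrightarrow> evolve \<mu> t = \<mu>"
    if t: "0 \<le> t" for t
  proof -
    have "(\<integral>\<^sup>+z. emeasure (transition_kernel lam A b t z) B \<partial>\<mu>) = emeasure (evolve \<mu> t) B" if "B \<in> sets \<mu>" for B
      using that True by (simp add: emeasure_transition_kernel[OF t] emeasure_evolve)
    then show ?thesis
      using True by (metis measure_eqI sets_evolve)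
  qed
  then show ?thesis
    using True by (simp add: invariant_measure_def)
qed (simp add: invariant_measure_def)

end

theorem theorem5p3:
  fixes A :: "real^'n^'m" and b :: "real^'m" and lam :: real
  assumes "rank A = CARD('n)" and "lam > 0"
  shows "\<exists>\<pi> :: (real^'n) measure.
    stationary_measure lam A b \<pi> \<and>
    (\<forall>\<pi>'. stationary_measure lam A b \<pi>' \<longrightarrow> \<pi>' = \<pi>) \<and>
    (\<forall>(M :: 'w measure) i \<theta> \<theta>0 p.
       stochastic_approximation M lam A b \<theta>0 i \<theta> \<and> 0 < p \<and> p < 1 \<longrightarrow>
       (\<exists>c>0. \<exists>c'>0. \<forall>t\<ge>0.
          wasserstein p \<pi> (distr M borel (\<theta> t)) \<le> c * exp (- c' * t)))"
proof -
  obtain \<kappa> where "0 < \<kappa>" "\<And>v. \<kappa> * norm v \<le> norm (A *v v)"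
    using rank_bounded_below[OF assms(1)] by blast
  then interpret sparse_inversion lam A b \<kappa>
    using assms by unfold_locales
  let ?\<pi> = "distr stat borel snd"
  show ?thesis
  proof (intro exI[of _ ?\<pi>] conjI allI impI)
    show "stationary_measure lam A b ?\<pi>"
      unfolding stationary_measure_def
      by (intro exI[of _ stat]) (simp add: invariant_measure_iff prob_space_stat evolve_stat)
    show "\<pi>' = ?\<pi>" if "stationary_measure lam A b \<pi>'" for \<pi>'
      using that stat_unique unfolding stationary_measure_def invariant_measure_iff by blast
    fix M :: "'w measure" and i \<theta> \<theta>0 and p :: real
    assume asm: "stochastic_approximation M lam A b \<theta>0 i \<theta> \<and> 0 < p \<and> p < 1"
    then have S: "stochastic_approximation M lam A b \<theta>0 i \<theta>" and p: "0 < p" by auto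
    define q where "q = distr M (count_space UNIV) (i 0)"
    have q: "prob_space q" "sets q = sets (count_space UNIV)"
      using stochastic_approximation_law(2,3)[OF S order_refl] by (simp_all add: q_def)
    obtain c c' where c: "0 < c" "0 < c'" and \<Gamma>: "\<And>t. 0 \<le> t \<Longrightarrow>
        \<exists>\<Gamma>\<in>couplings ?\<pi> (distr (evolve (start q \<theta>0) t) borel snd).
          (\<integral>\<^sup>+z. ennreal (min 1 (norm (fst z - snd z) powr p)) \<partial>\<Gamma>) \<le> ennreal (c * exp (- c' * t))"
      using stat_coupling[OF q p, of \<theta>0] by blast
    show "\<exists>c>0. \<exists>c'>0. \<forall>t\<ge>0. wasserstein p ?\<pi> (distr M borel (\<theta> t)) \<le> c * exp (- c' * t)"
    proof (intro exI conjI allI impI)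
      show "0 < c" "0 < c'" by (rule c)+
      fix t :: real assume t: "0 \<le> t"
      have [measurable]: "i t \<in> M \<rightarrow>\<^sub>M count_space UNIV" "\<theta> t \<in> borel_measurable M"
        using S t by (auto simp: stochastic_approximation_def index_process_def)
      have "distr (evolve (start q \<theta>0) t) borel snd = distr (distr M states (\<lambda>\<omega>. (i t \<omega>, \<theta> t \<omega>))) borel snd"
        using stochastic_approximation_law(1)[OF S t] by (simp add: q_def)
      also have "\<dots> = distr M borel (\<theta> t)"
        by (subst distr_distr) (auto simp: o_def)
      finally obtain G where G: "G \<in> couplings ?\<pi> (distr M borel (\<theta> t))"
        and le: "(\<integral>\<^sup>+z. ennreal (min 1 (norm (fst z - snd z) powr p)) \<partial>G) \<le> ennreal (c * exp (- c' * t))"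
        using \<Gamma>[OF t] by auto
      have [measurable_cong]: "sets G = sets (borel \<Otimes>\<^sub>M borel)"
        using G by (simp add: couplings_def)
      \<comment> \<open>A single coupling bounds the infimum from above; the costs are bounded below
        by 0, as the conditionally complete infimum requires.\<close>
      have "wasserstein p ?\<pi> (distr M borel (\<theta> t)) \<le> (\<integral>z. min 1 (norm (fst z - snd z) powr p) \<partial>G)"
        unfolding wasserstein_def
        by (rule cINF_lower[OF _ G]) (auto intro!: bdd_belowI[of _ 0] integral_nonneg_AE)
      also have "\<dots> = enn2real (\<integral>\<^sup>+z. ennreal (min 1 (norm (fst z - snd z) powr p)) \<partial>G)"
        by (rule integral_eq_nn_integral) auto
      also have "\<dots> \<le> enn2real (ennreal (c * exp (- c' * t)))"
        by (rule enn2real_mono[OF le]) simp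
      also have "\<dots> = c * exp (- c' * t)"
        using c by simp
      finally show "wasserstein p ?\<pi> (distr M borel (\<theta> t)) \<le> c * exp (- c' * t)" .
    qed
  qed
qed

end
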